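(* Let $\langle X,\mathcal{M},\mathbf{O}\rangle$ be a measurement scenario with $X$ finite and nonempty, $d=|X|$, where each $\mathbf{O}_x$ is the Borel space of a compact set $O_x\subset\mathbb{R}$, taken (after completing $O_x$ by a set of measure zero) to be a compact interval $O_x=[a_x,b_x]$. Let $g_1,\dots,g_m$ be real polynomials of degree $1$ in the variables $\mathbf{x}\in\mathbb{R}^d$ such that $O_X=\prod_{x\in X}O_x=\{\mathbf{x}\in\mathbb{R}^d: g_j(\mathbf{x})\ge 0,\ j=1,\dots,m\}$, and let $e=(e_C)_{C\in\mathcal{M}}$ be an empirical model on the scenario. Then the optimal values of the semidefinite programs (SDP-CF$^k$) and (DSDP-CF$^k$), $k\ge 1$, defined in the context, provide monotonically decreasing (i.e. nonincreasing in $k$) upper bounds converging to the noncontextual fraction $\mathsf{NCF}(e)$: $$\mathrm{val}(\text{SDP-CF}^k)\downarrow \mathsf{NCF}(e)\quad\text{and}\quad \mathrm{val}(\text{DSDP-CF}^k)\downarrow \mathsf{NCF}(e)\qquad\text{as } k\to\infty.$$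
   Context: A measurement scenario $\langle X,\mathcal{M},\mathbf{O}\rangle$ consists of: a set $X$ of measurement labels; a family $\mathcal{M}$ of subsets of $X$ with $\bigcup\mathcal{M}=X$ that is an anti-chain for inclusion (its elements are called maximal contexts); and, for each $x\in X$, a measurable space $\mathbf{O}_x=\langle O_x,\mathcal{F}_x\rangle$. For $U\subseteq X$, $\mathbf{O}_U=\prod_{x\in U}\mathbf{O}_x$, with underlying set $O_U=\prod_{x\in U}O_x$; $\rho^X_C:O_X\to O_C$ is the projection; for $U\subseteq V$ and a measure $\mu$ on $\mathbf{O}_V$, $\mu|_U$ is the marginal (push-forward along the projection $O_V\to O_U$). If some $O_x$ is not an interval, it is enlarged to a compact interval $[a_x,b_x]\supseteq O_x$ and the measures $e_C$ are extended by giving measure zero to the added part; this is the sense of "completing". An empirical model is a family $e=(e_C)_{C\in\mathcal{M}}$ with $e_C$ a probability measure on $\mathbf{O}_C$ and $e_C|_{C\cap C'}=e_{C'}|_{C\cap C'}$ for all $C,C'\in\mathcal{M}$. Its noncontextual fraction is $\mathsf{NCF}(e)=\sup\{\mu(O_X):\mu\text{ a (nonnegative) measure on }\mathbf{O}_X,\ \mu|_C\le e_C\ \text{for all } C\in\mathcal{M}\}$. Moments. $\mathbb{N}^d_k=\{\alpha\in\mathbb{N}^d:|\alpha|\le k\}$ (coordinates indexed by $X$), $s(k)=\binom{d+k}{k}=|\mathbb{N}^d_k|$, $\mathbf{x}^\alpha=\prod_i x_i^{\alpha_i}$. For $\mathbf{y}=(y_\alpha)_{\alpha\in\mathbb{N}^d_{2k}}\in\mathbb{R}^{s(2k)}$,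 the moment matrix $M_k(\mathbf{y})$ is the symmetric matrix indexed by $\mathbb{N}^d_k$ with entries $M_k(\mathbf{y})_{\alpha,\beta}=y_{\alpha+\beta}$. For a polynomial $g=\sum_\gamma g_\gamma\mathbf{x}^\gamma$ of degree $1$, the localising matrix $M_{k-1}(g\mathbf{y})$ is indexed by $\mathbb{N}^d_{k-1}$ with entries $\sum_\gamma g_\gamma y_{\alpha+\beta+\gamma}$. For $C\in\mathcal{M}$, $\mathbf{y}|_C$ is the subfamily of those $y_\alpha$ with $\alpha$ supported on the coordinates in $C$ (so that if $\mathbf{y}$ is the moment sequence of $\mu$ then $\mathbf{y}|_C$ is that of $\mu|_C$), and $\mathbf{y}^{e,C}$ is the family of moments $y^{e,C}_\alpha=\int_{O_C}\mathbf{x}^\alpha\,de_C$ for $\alpha$ supported on $C$; $M_k$ of such families is the corresponding moment matrix indexed by multi-indices of total degree at most $k$ supported on $C$. $\succeq 0$ means positive semidefinite. (SDP-CF$^k$): maximise $y_{\mathbf{0}}$ over $\mathbf{y}\in\mathbb{R}^{s(2k)}$ subject to $M_k(\mathbf{y}^{e,C}-\mathbf{y}|_C)\succeq0$ for all $C\in\mathcal{M}$; $M_{k-1}(g_j\mathbf{y})\succeq0$ for $j=1,\dots,m$; $M_k(\mathbf{y})\succeq0$. Sums of squares. A polynomial is SOS if it is a finite sum of squares of real polynomials; $\Sigma_k$ denotes the set of SOS polynomials of degree at most $2k$. (DSDP-CF$^k$): minimise $\sum_{C\in\mathcal{M}}\int_{O_C}p_C\,de_C$ over families $(p_C)_{C\in\mathcal{M}}$,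 with $p_C$ an SOS polynomial of degree at most $2k$ in the variables indexed by $C$, and $\sigma_0\in\Sigma_k$, $\sigma_1,\dots,\sigma_m\in\Sigma_{k-1}$ (in the $d$ variables), subject to the polynomial identity $\sum_{C\in\mathcal{M}}p_C\circ\rho^X_C-1=\sigma_0+\sum_{j=1}^m\sigma_j g_j$. $\mathrm{val}$ denotes the optimal value (supremum, respectively infimum) of a program. *)

theory Defs
  imports "HOL-Probability.Probability" "HOL-Library.Poly_Mapping"
begin

text \<open>
  A scenario is given by labels \<open>X\<close>, maximal contexts \<open>M\<close> and outcome spaces \<open>Om\<close>. The
  measurable space at a label is represented by a value of type \<open>measure\<close> of which only the
  underlying set and the sigma-algebra are used. The joint outcome space \<open>PiM U Om\<close> consists of
  the functions that are \<open>undefined\<close> outside \<open>U\<close>, so that projections are given by \<open>restrict\<close>.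
\<close>

definition measurement_scenario :: "'x set \<Rightarrow> 'x set set \<Rightarrow> bool" where
  "measurement_scenario X M \<longleftrightarrow>
     \<Union>M = X \<and> (\<forall>C\<in>M. \<forall>C'\<in>M. C \<subseteq> C' \<longrightarrow> C = C')"

definition marginal ::
    "('x \<Rightarrow> 'o measure) \<Rightarrow> 'x set \<Rightarrow> ('x \<Rightarrow> 'o) measure \<Rightarrow> ('x \<Rightarrow> 'o) measure" where
  "marginal Om U \<mu> = distr \<mu> (PiM U Om) (\<lambda>\<omega>. restrict \<omega> U)"

definition empirical_model ::
    "'x set set \<Rightarrow> ('x \<Rightarrow> 'o measure) \<Rightarrow> ('x set \<Rightarrow> ('x \<Rightarrow> 'o) measure) \<Rightarrow> bool" where
  "empirical_model M Om e \<longleftrightarrow>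
     (\<forall>C\<in>M. prob_space (e C) \<and> sets (e C) = sets (PiM C Om)) \<and>
     (\<forall>C\<in>M. \<forall>C'\<in>M. marginal Om (C \<inter> C') (e C) = marginal Om (C \<inter> C') (e C'))"

definition subordinate_measures ::
    "'x set \<Rightarrow> 'x set set \<Rightarrow> ('x \<Rightarrow> 'o measure) \<Rightarrow> ('x set \<Rightarrow> ('x \<Rightarrow> 'o) measure)
      \<Rightarrow> ('x \<Rightarrow> 'o) measure set" where
  "subordinate_measures X M Om e =
     {\<mu>. sets \<mu> = sets (PiM X Om) \<and>
         (\<forall>C\<in>M. \<forall>A\<in>sets (PiM C Om). emeasure (marginal Om C \<mu>) A \<le> emeasure (e C) A)}"

definition NCF ::
    "'x set \<Rightarrow> 'x set set \<Rightarrow> ('x \<Rightarrow> 'o measure) \<Rightarrow> ('x set \<Rightarrow> ('x \<Rightarrow> 'o) measure) \<Rightarrow> ennreal" where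
  "NCF X M Om e = (SUP \<mu>\<in>subordinate_measures X M Om e. emeasure \<mu> (space (PiM X Om)))"

definition interval_outcomes :: "('x \<Rightarrow> real) \<Rightarrow> ('x \<Rightarrow> real) \<Rightarrow> 'x \<Rightarrow> real measure" where
  "interval_outcomes a b x = restrict_space borel {a x..b x}"

text \<open>
  Multi-indices and polynomials are finitely supported functions; multiplication of polynomials
  is the convolution product of \<open>poly_mapping\<close>. A polynomial in the variables of a context
  \<open>C\<close> is a polynomial all of whose monomials are supported on \<open>C\<close>, so precomposition with the
  projection onto \<open>C\<close> leaves it unchanged as a formal polynomial.
\<close>

type_synonym 'x multi_index = "'x \<Rightarrow>\<^sub>0 nat"
type_synonym 'x rpoly = "'x multi_index \<Rightarrow>\<^sub>0 real"

definition abs_index :: "'x multi_index \<Rightarrow> nat" where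
  "abs_index \<alpha> = (\<Sum>x\<in>Poly_Mapping.keys \<alpha>. Poly_Mapping.lookup \<alpha> x)"

definition multi_indices :: "'x set \<Rightarrow> nat \<Rightarrow> 'x multi_index set" where
  "multi_indices U k = {\<alpha>. Poly_Mapping.keys \<alpha> \<subseteq> U \<and> abs_index \<alpha> \<le> k}"

definition monomial_value :: "'x multi_index \<Rightarrow> ('x \<Rightarrow> real) \<Rightarrow> real" where
  "monomial_value \<alpha> \<omega> = (\<Prod>x\<in>Poly_Mapping.keys \<alpha>. \<omega> x ^ Poly_Mapping.lookup \<alpha> x)"

definition poly_value :: "'x rpoly \<Rightarrow> ('x \<Rightarrow> real) \<Rightarrow> real" where
  "poly_value p \<omega> = (\<Sum>\<alpha>\<in>Poly_Mapping.keys p. Poly_Mapping.lookup p \<alpha> * monomial_value \<alpha> \<omega>)"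

definition total_degree :: "'x rpoly \<Rightarrow> nat" where
  "total_degree p = Max (insert 0 (abs_index ` Poly_Mapping.keys p))"

definition polys_over :: "'x set \<Rightarrow> 'x rpoly set" where
  "polys_over U = {p. \<forall>\<alpha>\<in>Poly_Mapping.keys p. Poly_Mapping.keys \<alpha> \<subseteq> U}"

definition sos_polys :: "'x set \<Rightarrow> nat \<Rightarrow> 'x rpoly set" where
  "sos_polys U k =
     {p. (\<exists>(n::nat) q. (\<forall>i<n. q i \<in> polys_over U) \<and> p = (\<Sum>i<n. (q i)\<^sup>2))
         \<and> total_degree p \<le> 2 * k}"

definition moments :: "('x \<Rightarrow> real) measure \<Rightarrow> 'x multi_index \<Rightarrow> real" where
  "moments \<mu> \<alpha> = (\<integral>\<omega>. monomial_value \<alpha> \<omega> \<partial>\<mu>)"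

definition psd_on :: "'i set \<Rightarrow> ('i \<Rightarrow> 'i \<Rightarrow> real) \<Rightarrow> bool" where
  "psd_on I A \<longleftrightarrow>
     (\<forall>i\<in>I. \<forall>j\<in>I. A i j = A j i) \<and>
     (\<forall>v. 0 \<le> (\<Sum>i\<in>I. \<Sum>j\<in>I. v i * A i j * v j))"

definition moment_matrix ::
    "('x multi_index \<Rightarrow> real) \<Rightarrow> 'x multi_index \<Rightarrow> 'x multi_index \<Rightarrow> real" where
  "moment_matrix y \<alpha> \<beta> = y (\<alpha> + \<beta>)"

definition localising_matrix ::
    "'x rpoly \<Rightarrow> ('x multi_index \<Rightarrow> real) \<Rightarrow> 'x multi_index \<Rightarrow> 'x multi_index \<Rightarrow> real" where
  "localising_matrix g y \<alpha> \<beta> =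
     (\<Sum>\<gamma>\<in>Poly_Mapping.keys g. Poly_Mapping.lookup g \<gamma> * y (\<alpha> + \<beta> + \<gamma>))"

text \<open>
  Both programs are meant for \<open>k \<ge> 1\<close>. Restricting a moment family to a context \<open>C\<close> is done by
  indexing the matrix with the multi-indices supported on \<open>C\<close>. Optimal values are extended reals,
  so that they are the supremum and infimum without any convention for real-valued \<open>Sup\<close>
  and \<open>Inf\<close>.
\<close>

definition sdp_feasible ::
    "'x set \<Rightarrow> 'x set set \<Rightarrow> nat \<Rightarrow> (nat \<Rightarrow> 'x rpoly) \<Rightarrow> ('x set \<Rightarrow> ('x \<Rightarrow> real) measure)
      \<Rightarrow> nat \<Rightarrow> ('x multi_index \<Rightarrow> real) set" where
  "sdp_feasible X M m g e k =
     {y \<in> multi_indices X (2 * k) \<rightarrow>\<^sub>E UNIV.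
        (\<forall>C\<in>M. psd_on (multi_indices C k) (moment_matrix (\<lambda>\<alpha>. moments (e C) \<alpha> - y \<alpha>))) \<and>
        (\<forall>j\<in>{1..m}. psd_on (multi_indices X (k - 1)) (localising_matrix (g j) y)) \<and>
        psd_on (multi_indices X k) (moment_matrix y)}"

definition sdp_val ::
    "'x set \<Rightarrow> 'x set set \<Rightarrow> nat \<Rightarrow> (nat \<Rightarrow> 'x rpoly) \<Rightarrow> ('x set \<Rightarrow> ('x \<Rightarrow> real) measure)
      \<Rightarrow> nat \<Rightarrow> ereal" where
  "sdp_val X M m g e k = (SUP y\<in>sdp_feasible X M m g e k. ereal (y 0))"

definition dsdp_feasible ::
    "'x set \<Rightarrow> 'x set set \<Rightarrow> nat \<Rightarrow> (nat \<Rightarrow> 'x rpoly) \<Rightarrow> nat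
      \<Rightarrow> (('x set \<Rightarrow> 'x rpoly) \<times> (nat \<Rightarrow> 'x rpoly)) set" where
  "dsdp_feasible X M m g k =
     {(p, \<sigma>). (\<forall>C\<in>M. p C \<in> sos_polys C k) \<and>
              \<sigma> 0 \<in> sos_polys X k \<and> (\<forall>j\<in>{1..m}. \<sigma> j \<in> sos_polys X (k - 1)) \<and>
              (\<Sum>C\<in>M. p C) - 1 = \<sigma> 0 + (\<Sum>j=1..m. \<sigma> j * g j)}"

definition dsdp_val ::
    "'x set \<Rightarrow> 'x set set \<Rightarrow> nat \<Rightarrow> (nat \<Rightarrow> 'x rpoly) \<Rightarrow> ('x set \<Rightarrow> ('x \<Rightarrow> real) measure)
      \<Rightarrow> nat \<Rightarrow> ereal" where
  "dsdp_val X M m g e k =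
     (INF (p, \<sigma>)\<in>dsdp_feasible X M m g k.
        ereal (\<Sum>C\<in>M. \<integral>\<omega>. poly_value (p C) \<omega> \<partial>(e C)))"

definition decreasing_bounds_to :: "(nat \<Rightarrow> ereal) \<Rightarrow> ereal \<Rightarrow> bool" where
  "decreasing_bounds_to v L \<longleftrightarrow>
     (\<forall>k\<ge>1. L \<le> v k) \<and> (\<forall>k\<ge>1. v (Suc k) \<le> v k) \<and> v \<longlonglongrightarrow> L"

end

theory Submission
  imports Defs
begin

text \<open>
  Feasibility of moment sequences gives \<open>NCF \<le> sdp_val\<close>, and testing a moment sequence against an
  SOS certificate gives \<open>sdp_val \<le> dsdp_val\<close>; so it suffices to bound the limit \<open>v\<close> of the dual
  values by \<open>NCF\<close>. The Hahn-Banach theorem provides a linear functional \<open>L\<close> on polynomials with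
  \<open>L 1 = v\<close> that is nonnegative on squares and satisfies \<open>L (p\<^sup>2) \<le> \<integral> p\<^sup>2 de\<^sub>C\<close> for every polynomial
  \<open>p\<close> in the variables of a context \<open>C\<close>. The latter inequality alone makes \<open>L\<close> bounded by suprema
  over the box in each variable, so that neither Putinar's theorem nor the multipliers of the \<open>g j\<close>
  are needed: \<open>L\<close> is nonnegative on products of Bernstein polynomials in the single variables.
  Its values on them are the weights of discrete measures on grids whose moments converge to those
  given by \<open>L\<close>. Parametrising the box by Schoenberg's space-filling curve turns these into measures
  on the line, and Helly's selection theorem yields a measure \<open>\<mu>\<close> on the box representing \<open>L\<close>.
  Approximating indicators by polynomials in mean turns the inequalities for squares into
  \<open>\<mu>|\<^sub>C \<le> e\<^sub>C\<close>, whence \<open>v = \<mu> O\<^sub>X \<le> NCF\<close>.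
\<close>

section \<open>Polynomials as finitely supported functions\<close>

text \<open>The functional arises from perturbing the right-hand side: \<open>dual_gauge f\<close>
  is the infimum of the dual objective when \<open>1\<close> is replaced by \<open>f\<close> and
  degrees are unrestricted. Certificates can be added and scaled, so this is sublinear in
  \<open>f\<close>; a linear functional below it that touches it at \<open>1\<close> inherits its
  inequalities from two trivial certificates. The obstacle is that the contexts give upper bounds
  for squares in their own variables only, and none directly for products of functions of variables
  that share no context. Cauchy-Schwarz bounds \<open>L (h * u)\<close> through
  \<open>L (u\<^sup>2)\<close>, and iterating it along the powers of \<open>u\<close> removes the
  loss in the constant. Variables can then be treated one at a time, since the Bernstein polynomials
  of a box are products of univariate ones. A separate difficulty is that the programs bound
  degrees: before a moment matrix can test a sum of squares of degree \<open>2 * k\<close>, each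
  squared polynomial must be known to have degree at most \<open>k\<close>.\<close>

lemma poly_mapping_single_plus_induct [case_names zero single plus]:
  fixes f :: "'a \<Rightarrow>\<^sub>0 'b::comm_monoid_add"
  assumes "P 0" and "\<And>k v. P (Poly_Mapping.single k v)" and "\<And>f g. P f \<Longrightarrow> P g \<Longrightarrow> P (f + g)"
  shows "P f"
proof (induction f rule: update_induct)
  case (update f a b)
  have "Poly_Mapping.update a b f = Poly_Mapping.single a b + f"
    using update(1) by (intro poly_mapping_eqI)
      (auto simp: lookup_update lookup_add lookup_single in_keys_iff when_def)
  with update assms show ?case by simp
qed (rule assms)

section \<open>Multi-indices, their degrees and their monomials\<close>

lemma keys_add_nat: "Poly_Mapping.keys (\<alpha> + \<beta> :: 'x multi_index) = Poly_Mapping.keys \<alpha> \<union> Poly_Mapping.keys \<beta>"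
  by (auto simp: in_keys_iff lookup_add)

lemma abs_index_superset:
  assumes "finite S" "Poly_Mapping.keys \<alpha> \<subseteq> S"
  shows "abs_index \<alpha> = (\<Sum>x\<in>S. Poly_Mapping.lookup \<alpha> x)"
  unfolding abs_index_def using assms
  by (intro sum.mono_neutral_left) (auto simp: in_keys_iff)

lemma abs_index_add: "abs_index (\<alpha> + \<beta>) = abs_index \<alpha> + abs_index \<beta>"
  by (simp add: abs_index_superset[of "Poly_Mapping.keys \<alpha> \<union> Poly_Mapping.keys \<beta>"] keys_add_nat
      lookup_add sum.distrib)

lemma abs_index_zero [simp]: "abs_index 0 = 0"
  by (simp add: abs_index_def)

lemma multi_indices_add:
  "\<alpha> \<in> multi_indices U k \<Longrightarrow> \<beta> \<in> multi_indices U l \<Longrightarrow> \<alpha> + \<beta> \<in> multi_indices U (k + l)"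
  by (auto simp: multi_indices_def abs_index_add keys_add_nat)

lemma multi_indices_mono: "U \<subseteq> V \<Longrightarrow> k \<le> l \<Longrightarrow> multi_indices U k \<subseteq> multi_indices V l"
  by (auto simp: multi_indices_def)

lemma finite_multi_indices:
  assumes "finite U"
  shows "finite (multi_indices U k)"
proof (rule finite_imageD)
  have "Poly_Mapping.lookup \<alpha> x \<le> k" if "\<alpha> \<in> multi_indices U k" for \<alpha> x
  proof (cases "x \<in> Poly_Mapping.keys \<alpha>")
    case True
    then have "Poly_Mapping.lookup \<alpha> x \<le> abs_index \<alpha>"
      unfolding abs_index_def by (intro member_le_sum) auto
    with that show ?thesis by (simp add: multi_indices_def)
  qed (simp add: in_keys_iff)
  moreover have "Poly_Mapping.lookup \<alpha> x = 0" if "\<alpha> \<in> multi_indices U k" "x \<notin> U" for \<alpha> x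
    using that by (auto simp: multi_indices_def in_keys_iff)
  ultimately have "Poly_Mapping.lookup ` multi_indices U k
      \<subseteq> {f. (\<forall>x. x \<in> U \<longrightarrow> f x \<in> {..k}) \<and> (\<forall>x. x \<notin> U \<longrightarrow> f x = 0)}"
    by auto
  moreover have "finite {f. (\<forall>x. x \<in> U \<longrightarrow> f x \<in> {..k}) \<and> (\<forall>x. x \<notin> U \<longrightarrow> f x = 0)}"
    using finite_set_of_finite_funs[of U "{..k}" 0] assms by (simp add: all_conj_distrib)
  ultimately show "finite (Poly_Mapping.lookup ` multi_indices U k)"
    by (rule finite_subset)
  show "inj_on Poly_Mapping.lookup (multi_indices U k)"
    by (intro inj_onI poly_mapping_eqI) simp
qed

lemma monomial_value_superset:
  assumes "finite S" "Poly_Mapping.keys \<alpha> \<subseteq> S"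
  shows "monomial_value \<alpha> \<omega> = (\<Prod>x\<in>S. \<omega> x ^ Poly_Mapping.lookup \<alpha> x)"
  unfolding monomial_value_def using assms
  by (intro prod.mono_neutral_left) (auto simp: in_keys_iff)

lemma monomial_value_add: "monomial_value (\<alpha> + \<beta>) \<omega> = monomial_value \<alpha> \<omega> * monomial_value \<beta> \<omega>"
  by (simp add: monomial_value_superset[of "Poly_Mapping.keys \<alpha> \<union> Poly_Mapping.keys \<beta>"] keys_add_nat
      lookup_add power_add prod.distrib)

lemma monomial_value_zero [simp]: "monomial_value 0 \<omega> = 1"
  by (simp add: monomial_value_def)

lemma monomial_value_cong:
  "(\<And>x. x \<in> Poly_Mapping.keys \<alpha> \<Longrightarrow> \<omega> x = \<omega>' x) \<Longrightarrow> monomial_value \<alpha> \<omega> = monomial_value \<alpha> \<omega>'"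
  unfolding monomial_value_def by (intro prod.cong) auto

text \<open>The linear functional on formal polynomials that sends the monomial
  \<open>\<alpha>\<close> to \<open>y \<alpha>\<close>, known as the Riesz functional of
  \<open>y\<close>. It covers evaluation at a point (\<open>y\<close> the monomial values),
  integration (\<open>y\<close> the moments) and the quadratic forms of the matrices in the
  semidefinite program.\<close>

definition riesz :: "('x multi_index \<Rightarrow> real) \<Rightarrow> 'x rpoly \<Rightarrow> real" where
  "riesz y p = (\<Sum>\<alpha>\<in>Poly_Mapping.keys p. Poly_Mapping.lookup p \<alpha> * y \<alpha>)"

lemma riesz_superset:
  assumes "finite S" "Poly_Mapping.keys p \<subseteq> S"
  shows "riesz y p = (\<Sum>\<alpha>\<in>S. Poly_Mapping.lookup p \<alpha> * y \<alpha>)"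
  unfolding riesz_def using assms
  by (intro sum.mono_neutral_left) (auto simp: in_keys_iff)

lemma riesz_zero [simp]: "riesz y 0 = 0"
  by (simp add: riesz_def)

lemma riesz_single [simp]: "riesz y (Poly_Mapping.single \<alpha> c) = c * y \<alpha>"
  by (simp add: riesz_def)

lemma riesz_one [simp]: "riesz y 1 = y 0"
  by (simp add: riesz_def)

lemma riesz_add: "riesz y (p + q) = riesz y p + riesz y q"
proof -
  let ?S = "Poly_Mapping.keys p \<union> Poly_Mapping.keys q"
  show ?thesis
    by (simp add: riesz_superset[of ?S] keys_add lookup_add sum.distrib algebra_simps)
qed

lemma riesz_minus: "riesz y (p - q) = riesz y p - riesz y q"
  using riesz_add[of y "p - q" q] by simp

lemma riesz_sum: "riesz y (\<Sum>i\<in>I. p i) = (\<Sum>i\<in>I. riesz y (p i))"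
  by (induction I rule: infinite_finite_induct) (auto simp: riesz_add)

lemma riesz_diff_family: "riesz (\<lambda>\<alpha>. y \<alpha> - z \<alpha>) p = riesz y p - riesz z p"
  by (simp add: riesz_def algebra_simps sum_subtractf)

lemma poly_eq_sum_single: "p = (\<Sum>\<alpha>\<in>Poly_Mapping.keys p. Poly_Mapping.single \<alpha> (Poly_Mapping.lookup p \<alpha>))"
  by (intro poly_mapping_eqI)
     (auto simp: lookup_sum lookup_single when_def in_keys_iff)

lemma riesz_mult:
  "riesz y (p * q) = (\<Sum>\<alpha>\<in>Poly_Mapping.keys p. \<Sum>\<beta>\<in>Poly_Mapping.keys q.
     Poly_Mapping.lookup p \<alpha> * Poly_Mapping.lookup q \<beta> * y (\<alpha> + \<beta>))"
proof -
  have "p * q = (\<Sum>\<alpha>\<in>Poly_Mapping.keys p. Poly_Mapping.single \<alpha> (Poly_Mapping.lookup p \<alpha>)) *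
    (\<Sum>\<beta>\<in>Poly_Mapping.keys q. Poly_Mapping.single \<beta> (Poly_Mapping.lookup q \<beta>))"
    by (simp flip: poly_eq_sum_single)
  then show ?thesis
    by (simp add: sum_product mult_single riesz_sum)
qed

lemma poly_value_eq_riesz: "poly_value p \<omega> = riesz (\<lambda>\<alpha>. monomial_value \<alpha> \<omega>) p"
  by (simp add: poly_value_def riesz_def)

lemma poly_value_single [simp]: "poly_value (Poly_Mapping.single \<alpha> c) \<omega> = c * monomial_value \<alpha> \<omega>"
  and poly_value_zero [simp]: "poly_value 0 \<omega> = 0"
  and poly_value_one [simp]: "poly_value 1 \<omega> = 1"
  and poly_value_add [simp]: "poly_value (p + q) \<omega> = poly_value p \<omega> + poly_value q \<omega>"
  and poly_value_minus [simp]: "poly_value (p - q) \<omega> = poly_value p \<omega> - poly_value q \<omega>"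
  and poly_value_sum [simp]: "poly_value (\<Sum>i\<in>I. f i) \<omega> = (\<Sum>i\<in>I. poly_value (f i) \<omega>)"
  by (simp_all add: poly_value_eq_riesz riesz_add riesz_minus riesz_sum)

lemma poly_value_mult [simp]: "poly_value (p * q) \<omega> = poly_value p \<omega> * poly_value q \<omega>"
  unfolding poly_value_eq_riesz[of "p * q"] riesz_mult
  by (simp add: poly_value_def sum_product monomial_value_add mult_ac)

lemma poly_value_power [simp]: "poly_value (p ^ n) \<omega> = poly_value p \<omega> ^ n"
  by (induction n) auto

section \<open>Polynomials in a subset of the variables\<close>

lemma polys_over_mono: "U \<subseteq> V \<Longrightarrow> polys_over U \<subseteq> polys_over V"
  by (auto simp: polys_over_def)

lemma polys_over_single [simp]:
  "Poly_Mapping.single \<alpha> c \<in> polys_over U \<longleftrightarrow> c = 0 \<or> Poly_Mapping.keys \<alpha> \<subseteq> U"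
  by (auto simp: polys_over_def)

lemma polys_over_zero [simp]: "0 \<in> polys_over U"
  by (simp add: polys_over_def)

lemma polys_over_one [simp]: "1 \<in> polys_over U"
  by (simp add: polys_over_def)

lemma polys_over_add [intro]: "p \<in> polys_over U \<Longrightarrow> q \<in> polys_over U \<Longrightarrow> p + q \<in> polys_over U"
  unfolding polys_over_def using keys_add[of p q] by blast

lemma polys_over_mult [intro]: "p \<in> polys_over U \<Longrightarrow> q \<in> polys_over U \<Longrightarrow> p * q \<in> polys_over U"
  unfolding polys_over_def using keys_mult[of p q] by (fastforce simp: keys_add_nat)

lemma polys_over_uminus [intro]: "p \<in> polys_over U \<Longrightarrow> - p \<in> polys_over U"
  by (simp add: polys_over_def in_keys_iff)

lemma polys_over_minus [intro]: "p \<in> polys_over U \<Longrightarrow> q \<in> polys_over U \<Longrightarrow> p - q \<in> polys_over U"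
  using polys_over_add[of p U "- q"] by auto

lemma polys_over_power [intro]: "p \<in> polys_over U \<Longrightarrow> p ^ n \<in> polys_over U"
  by (induction n) auto

lemma polys_over_sum [intro]: "(\<And>i. i \<in> I \<Longrightarrow> p i \<in> polys_over U) \<Longrightarrow> (\<Sum>i\<in>I. p i) \<in> polys_over U"
  by (induction I rule: infinite_finite_induct) auto

lemma polys_over_prod [intro]: "(\<And>i. i \<in> I \<Longrightarrow> p i \<in> polys_over U) \<Longrightarrow> (\<Prod>i\<in>I. p i) \<in> polys_over U"
  by (induction I rule: infinite_finite_induct) auto

lemma poly_value_cong:
  assumes "p \<in> polys_over U" "\<And>x. x \<in> U \<Longrightarrow> \<omega> x = \<omega>' x"
  shows "poly_value p \<omega> = poly_value p \<omega>'"
  unfolding poly_value_def using assms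
  by (intro sum.cong refl arg_cong2[where f = "(*)"] monomial_value_cong) (auto simp: polys_over_def)

lemma polys_over_induct [consumes 1, case_names single plus]:
  assumes "p \<in> polys_over U"
    and single: "\<And>\<alpha> c. Poly_Mapping.keys \<alpha> \<subseteq> U \<Longrightarrow> P (Poly_Mapping.single \<alpha> c)"
    and plus: "\<And>p q. P p \<Longrightarrow> P q \<Longrightarrow> P (p + q)"
  shows "P p"
proof -
  have P0: "P 0" using single[of 0 0] by simp
  have "P (\<Sum>\<alpha>\<in>A. Poly_Mapping.single \<alpha> (Poly_Mapping.lookup p \<alpha>))"
    if "finite A" "A \<subseteq> Poly_Mapping.keys p" for A
    using that
  proof (induction A rule: finite_induct)
    case (insert \<alpha> A)
    then have "Poly_Mapping.keys \<alpha> \<subseteq> U" using assms(1) by (auto simp: polys_over_def)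
    with insert show ?case by (auto intro!: plus single)
  qed (simp add: P0)
  from this[of "Poly_Mapping.keys p"] show ?thesis by (simp flip: poly_eq_sum_single)
qed

section \<open>Degrees, and the absence of cancellation in sums of squares\<close>

lemma total_degree_le_iff: "total_degree p \<le> k \<longleftrightarrow> (\<forall>\<alpha>\<in>Poly_Mapping.keys p. abs_index \<alpha> \<le> k)"
  by (auto simp: total_degree_def)

lemma keys_subset_multi_indices:
  "p \<in> polys_over U \<Longrightarrow> total_degree p \<le> k \<Longrightarrow> Poly_Mapping.keys p \<subseteq> multi_indices U k"
  by (auto simp: polys_over_def multi_indices_def total_degree_le_iff)

text \<open>The hypothesis makes \<open>\<alpha>\<close> behave like an extreme point of the
  support: among the products contributing to the exponent \<open>\<alpha> + \<alpha>\<close> only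
  the diagonal one survives. The case of \<open>\<alpha>\<close> outside the support, where both
  sides vanish, is included because an exponent chosen from a whole sum of squares need not occur in
  every summand.\<close>

lemma lookup_square_extreme:
  fixes q :: "'a::comm_monoid_add \<Rightarrow>\<^sub>0 real"
  assumes "\<And>\<beta> \<gamma>. \<beta> \<in> Poly_Mapping.keys q \<Longrightarrow> \<gamma> \<in> Poly_Mapping.keys q \<Longrightarrow> \<alpha> + \<alpha> = \<beta> + \<gamma> \<Longrightarrow> \<beta> = \<alpha> \<and> \<gamma> = \<alpha>"
  shows "Poly_Mapping.lookup (q\<^sup>2) (\<alpha> + \<alpha>) = (Poly_Mapping.lookup q \<alpha>)\<^sup>2"
proof -
  let ?q = "Poly_Mapping.lookup q" and ?K = "Poly_Mapping.keys q"
  have "q\<^sup>2 = (\<Sum>\<beta>\<in>?K. \<Sum>\<gamma>\<in>?K. Poly_Mapping.single (\<beta> + \<gamma>) (?q \<beta> * ?q \<gamma>))"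
    by (subst (1) poly_eq_sum_single[of q]) (simp add: power2_eq_square sum_product mult_single)
  then have "Poly_Mapping.lookup (q\<^sup>2) (\<alpha> + \<alpha>) =
      (\<Sum>\<beta>\<in>?K. \<Sum>\<gamma>\<in>?K. (?q \<beta> * ?q \<gamma> when \<beta> + \<gamma> = \<alpha> + \<alpha>))"
    by (simp add: lookup_sum lookup_single)
  also have "\<dots> = (\<Sum>\<beta>\<in>?K. \<Sum>\<gamma>\<in>?K. if \<beta> = \<alpha> then if \<gamma> = \<alpha> then ?q \<beta> * ?q \<gamma> else 0 else 0)"
    using assms by (intro sum.cong refl) (auto simp: when_def; metis)
  also have "\<dots> = (\<Sum>\<beta>\<in>?K. if \<beta> = \<alpha> then \<Sum>\<gamma>\<in>?K. if \<gamma> = \<alpha> then ?q \<beta> * ?q \<gamma> else 0 else 0)"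
    by (intro sum.cong) auto
  also have "\<dots> = (?q \<alpha>)\<^sup>2"
    by (auto simp: power2_eq_square in_keys_iff)
  finally show ?thesis .
qed

text \<open>No cancellation: among the exponents of maximal degree the one of maximal Euclidean norm is
  an extreme point, so its double occurs in the sum of squares with a positive coefficient.\<close>

lemma total_degree_summand_of_sos:
  fixes q :: "nat \<Rightarrow> 'x rpoly"
  assumes deg: "total_degree (\<Sum>i<n. (q i)\<^sup>2) \<le> 2 * k" and "i < n"
  shows "total_degree (q i) \<le> k"
proof (rule ccontr)
  assume "\<not> total_degree (q i) \<le> k"
  then obtain \<alpha>0 where \<alpha>0: "\<alpha>0 \<in> Poly_Mapping.keys (q i)" "abs_index \<alpha>0 > k"
    by (auto simp: total_degree_le_iff not_le)
  define S where "S = (\<Union>i<n. Poly_Mapping.keys (q i))"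
  have "finite S" by (auto simp: S_def)
  have "\<alpha>0 \<in> S" using \<alpha>0 \<open>i < n\<close> by (auto simp: S_def)
  define D where "D = Max (abs_index ` S)"
  have le_D: "abs_index \<alpha> \<le> D" if "\<alpha> \<in> S" for \<alpha>
    using that \<open>finite S\<close> by (auto simp: D_def)
  define V where "V = (\<Union>\<alpha>\<in>S. Poly_Mapping.keys \<alpha>)"
  have "finite V" using \<open>finite S\<close> by (auto simp: V_def)
  \<comment> \<open>The squared Euclidean norm, taken in the integers so that exponents can be
    subtracted.\<close>
  define N where "N \<alpha> = (\<Sum>x\<in>V. (int (Poly_Mapping.lookup \<alpha> x))\<^sup>2)" for \<alpha> :: "'x multi_index"
  define T where "T = {\<alpha>\<in>S. abs_index \<alpha> = D}"
  have "D \<in> abs_index ` S"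
    unfolding D_def using \<open>finite S\<close> \<open>\<alpha>0 \<in> S\<close> by (intro Max_in) auto
  then have "finite T" "T \<noteq> {}" using \<open>finite S\<close> by (auto simp: T_def)
  have "Max (N ` T) \<in> N ` T" using \<open>finite T\<close> \<open>T \<noteq> {}\<close> by (intro Max_in) auto
  then obtain \<alpha> where \<alpha>: "\<alpha> \<in> T" "N \<alpha> = Max (N ` T)" by auto
  have \<alpha>_max: "N \<beta> \<le> N \<alpha>" if "\<beta> \<in> T" for \<beta>
    unfolding \<alpha>(2) using \<open>finite T\<close> that by (intro Max_ge) auto
  have extreme: "\<beta> = \<alpha> \<and> \<gamma> = \<alpha>" if "\<beta> \<in> S" "\<gamma> \<in> S" "\<alpha> + \<alpha> = \<beta> + \<gamma>" for \<beta> \<gamma>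
  proof -
    have "abs_index \<beta> + abs_index \<gamma> = D + D"
      using \<alpha>(1) arg_cong[OF that(3), of abs_index] by (auto simp: abs_index_add T_def)
    with le_D[OF that(1)] le_D[OF that(2)] have "\<beta> \<in> T" "\<gamma> \<in> T"
      using that by (auto simp: T_def)
    have *: "2 * Poly_Mapping.lookup \<alpha> x = Poly_Mapping.lookup \<beta> x + Poly_Mapping.lookup \<gamma> x" for x
      using arg_cong[OF that(3), of "\<lambda>f. Poly_Mapping.lookup f x"] by (simp add: lookup_add)
    \<comment> \<open>Parallelogram law for \<open>2 * \<alpha> = \<beta> + \<gamma>\<close>.
      Neither \<open>\<beta>\<close> nor \<open>\<gamma>\<close> has larger norm than
      \<open>\<alpha>\<close>, which forces their difference to vanish.\<close>
    have "4 * N \<alpha> = 2 * N \<beta> + 2 * N \<gamma>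
        - (\<Sum>x\<in>V. (int (Poly_Mapping.lookup \<beta> x) - int (Poly_Mapping.lookup \<gamma> x))\<^sup>2)"
      unfolding N_def sum_distrib_left sum.distrib[symmetric] sum_subtractf[symmetric]
    proof (intro sum.cong refl)
      fix x
      have "4 * (int (Poly_Mapping.lookup \<alpha> x))\<^sup>2 = (int (2 * Poly_Mapping.lookup \<alpha> x))\<^sup>2"
        by (simp add: power_mult_distrib)
      also have "\<dots> = (int (Poly_Mapping.lookup \<beta> x) + int (Poly_Mapping.lookup \<gamma> x))\<^sup>2"
        by (simp add: *)
      finally show "4 * (int (Poly_Mapping.lookup \<alpha> x))\<^sup>2 = 2 * (int (Poly_Mapping.lookup \<beta> x))\<^sup>2
          + 2 * (int (Poly_Mapping.lookup \<gamma> x))\<^sup>2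
          - (int (Poly_Mapping.lookup \<beta> x) - int (Poly_Mapping.lookup \<gamma> x))\<^sup>2"
        by (simp add: power2_eq_square algebra_simps)
    qed
    with \<alpha>_max[OF \<open>\<beta> \<in> T\<close>] \<alpha>_max[OF \<open>\<gamma> \<in> T\<close>]
    have "(\<Sum>x\<in>V. (int (Poly_Mapping.lookup \<beta> x) - int (Poly_Mapping.lookup \<gamma> x))\<^sup>2) \<le> 0"
      by linarith
    then have "(\<Sum>x\<in>V. (int (Poly_Mapping.lookup \<beta> x) - int (Poly_Mapping.lookup \<gamma> x))\<^sup>2) = 0"
      by (intro antisym sum_nonneg) auto
    then have **: "Poly_Mapping.lookup \<beta> x = Poly_Mapping.lookup \<gamma> x" if "x \<in> V" for x
      using \<open>finite V\<close> that by (subst (asm) sum_nonneg_eq_0_iff) auto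
    have "Poly_Mapping.lookup \<beta> x = 0" "Poly_Mapping.lookup \<gamma> x = 0" if "x \<notin> V" for x
      using that \<open>\<beta> \<in> S\<close> \<open>\<gamma> \<in> S\<close> unfolding V_def by (auto simp: in_keys_iff)
    with ** have eq: "Poly_Mapping.lookup \<beta> x = Poly_Mapping.lookup \<gamma> x" for x by metis
    have "Poly_Mapping.lookup \<beta> x = Poly_Mapping.lookup \<alpha> x"
      "Poly_Mapping.lookup \<gamma> x = Poly_Mapping.lookup \<alpha> x" for x
      using *[of x] eq[of x] by auto
    then show ?thesis by (auto intro!: poly_mapping_eqI)
  qed
  have "Poly_Mapping.lookup (\<Sum>i<n. (q i)\<^sup>2) (\<alpha> + \<alpha>) = (\<Sum>i<n. (Poly_Mapping.lookup (q i) \<alpha>)\<^sup>2)"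
    unfolding lookup_sum
  proof (intro sum.cong lookup_square_extreme refl)
    fix j \<beta> \<gamma>
    assume "j \<in> {..<n}" "\<beta> \<in> Poly_Mapping.keys (q j)" "\<gamma> \<in> Poly_Mapping.keys (q j)" "\<alpha> + \<alpha> = \<beta> + \<gamma>"
    then show "\<beta> = \<alpha> \<and> \<gamma> = \<alpha>" by (intro extreme) (auto simp: S_def)
  qed
  also have "\<dots> > 0"
  proof -
    obtain j where j: "j < n" "\<alpha> \<in> Poly_Mapping.keys (q j)" using \<alpha>(1) by (auto simp: T_def S_def)
    then show ?thesis
      by (intro sum_pos2[where i = j]) (auto simp: in_keys_iff)
  qed
  finally have "\<alpha> + \<alpha> \<in> Poly_Mapping.keys (\<Sum>i<n. (q i)\<^sup>2)"
    by (simp add: in_keys_iff)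
  with deg have "abs_index (\<alpha> + \<alpha>) \<le> 2 * k" by (simp add: total_degree_le_iff)
  moreover have "abs_index \<alpha> > k" using le_D[OF \<open>\<alpha>0 \<in> S\<close>] \<alpha>0(2) \<alpha>(1) by (auto simp: T_def)
  ultimately show False by (simp add: abs_index_add)
qed

section \<open>The Hahn-Banach theorem for sublinear functionals\<close>

text \<open>The scalar action is a parameter because it will be multiplication by constant
  polynomials.\<close>

definition sublinear :: "(real \<Rightarrow> 'v \<Rightarrow> 'v::ab_group_add) \<Rightarrow> ('v \<Rightarrow> real) \<Rightarrow> bool" where
  "sublinear sc \<phi> \<longleftrightarrow> (\<forall>x y. \<phi> (x + y) \<le> \<phi> x + \<phi> y) \<and> (\<forall>c x. 0 \<le> c \<longrightarrow> \<phi> (sc c x) = c * \<phi> x)"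

context
  fixes sc :: "real \<Rightarrow> 'v \<Rightarrow> 'v::ab_group_add"
  assumes vs: "vector_space sc"
begin

interpretation vector_space sc by (rule vs)

lemma sublinear_zero: "sublinear sc \<phi> \<Longrightarrow> \<phi> 0 = 0"
  unfolding sublinear_def by (metis mult_zero_left order_refl scale_zero_left)

lemma sublinear_ge: "sublinear sc \<phi> \<Longrightarrow> - \<phi> (- x) \<le> \<phi> x"
proof -
  assume *: "sublinear sc \<phi>"
  then have "\<phi> (x + - x) \<le> \<phi> x + \<phi> (- x)" unfolding sublinear_def by blast
  with sublinear_zero[OF *] show ?thesis by simp
qed

text \<open>The infimum runs over a ray in direction \<open>z\<close>; it is finite because
  subadditivity bounds all its terms below by \<open>- \<phi> (- x)\<close>. As
  \<open>\<psi> z\<close> lies below \<open>\<phi>\<close> and has value at most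
  \<open>- \<phi> z\<close> at \<open>- z\<close>, a sublinear functional that cannot be decreased
  must be odd.\<close>

lemma sublinear_refine:
  assumes \<phi>: "sublinear sc \<phi>"
  defines "\<psi> \<equiv> \<lambda>z x. INF t\<in>{0..}. \<phi> (x + sc t z) - t * \<phi> z"
  shows "sublinear sc (\<psi> z)" "\<psi> z x \<le> \<phi> x" "\<psi> z (- z) \<le> - \<phi> z"
proof -
  have \<psi>_eq: "\<psi> z x = (INF t\<in>{0..}. \<phi> (x + sc t z) - t * \<phi> z)" for z x
    by (simp add: \<psi>_def)
  have add: "\<phi> (x + y) \<le> \<phi> x + \<phi> y" and hom: "0 \<le> c \<Longrightarrow> \<phi> (sc c x) = c * \<phi> x" for c x y
    using \<phi> unfolding sublinear_def by auto
  have lower: "- \<phi> (- x) \<le> \<phi> (x + sc t z) - t * \<phi> z" if "0 \<le> t" for t x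
    using add[of "x + sc t z" "- x"] hom[OF that, of z] by simp
  have bdd: "bdd_below ((\<lambda>t. \<phi> (x + sc t z) - t * \<phi> z) ` {0..})" for x
    using lower by (intro bdd_belowI2[where m = "- \<phi> (- x)"]) auto
  have le: "\<psi> z x \<le> \<phi> (x + sc t z) - t * \<phi> z" if "0 \<le> t" for t x
    unfolding \<psi>_eq using that by (intro cINF_lower bdd) auto
  show "\<psi> z x \<le> \<phi> x" for x using le[of 0] by simp
  show "\<psi> z (- z) \<le> - \<phi> z"
    using le[of 1 "- z"] sublinear_zero[OF \<phi>] by simp
  have "\<psi> z (x + y) \<le> \<psi> z x + \<psi> z y" for x y
  proof -
    have 1: "\<psi> z (x + y) - (\<phi> (y + sc t z) - t * \<phi> z) \<le> \<phi> (x + sc s z) - s * \<phi> z"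
      if "0 \<le> t" "0 \<le> s" for s t
      using le[of "s + t" "x + y"] that add[of "x + sc s z" "y + sc t z"]
      by (simp add: scale_left_distrib algebra_simps)
    have 2: "\<psi> z (x + y) - (\<phi> (y + sc t z) - t * \<phi> z) \<le> \<psi> z x" if "0 \<le> t" for t
      unfolding \<psi>_eq[of z x] using 1[OF that] by (intro cINF_greatest) auto
    have "\<psi> z (x + y) - \<psi> z x \<le> \<psi> z y"
      unfolding \<psi>_eq[of z y] using 2 by (intro cINF_greatest) (auto simp: algebra_simps)
    then show ?thesis by simp
  qed
  moreover have "\<psi> z (sc c x) = c * \<psi> z x" if "0 \<le> c" for c x
  proof (cases "c = 0")
    case True
    have "\<psi> z 0 = (INF t\<in>{0::real..}. 0)"
      unfolding \<psi>_eq by (intro INF_cong) (auto simp: hom)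
    with True show ?thesis by simp
  next
    case False
    with that have "c > 0" by simp
    have le': "c * \<psi> z x \<le> \<psi> z (sc c x)" if "c > 0" for c x
      unfolding \<psi>_eq[of z "sc c x"]
    proof (rule cINF_greatest)
      fix t :: real assume "t \<in> {0..}"
      then have "\<psi> z x \<le> \<phi> (x + sc (t / c) z) - t / c * \<phi> z"
        using \<open>c > 0\<close> by (intro le) auto
      then have "c * \<psi> z x \<le> c * (\<phi> (x + sc (t / c) z) - t / c * \<phi> z)"
        using \<open>c > 0\<close> by (intro mult_left_mono) auto
      also have "\<dots> = \<phi> (sc c (x + sc (t / c) z)) - t * \<phi> z"
        using \<open>c > 0\<close> by (simp add: hom right_diff_distrib)
      also have "sc c (x + sc (t / c) z) = sc c x + sc t z"
        using \<open>c > 0\<close> by (simp add: scale_right_distrib)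
      finally show "c * \<psi> z x \<le> \<phi> (sc c x + sc t z) - t * \<phi> z" .
    qed auto
    \<comment> \<open>The reverse inequality is the same one for the factor \<open>1 / c\<close> and
      the point \<open>sc c x\<close>.\<close>
    have "1 / c * \<psi> z (sc c x) \<le> \<psi> z (sc (1 / c) (sc c x))"
      using \<open>c > 0\<close> by (intro le') auto
    then have "\<psi> z (sc c x) \<le> c * \<psi> z x"
      using \<open>c > 0\<close> by (simp add: field_simps)
    with le'[OF \<open>c > 0\<close>, of x] show ?thesis by simp
  qed
  ultimately show "sublinear sc (\<psi> z)" unfolding sublinear_def by blast
qed

text \<open>A minimal sublinear functional below \<open>\<phi>\<close>, found by Zorn's lemma, is
  odd by the refinement, and an odd sublinear functional is linear. A chain is bounded below by its
  pointwise infimum, which is finite since every member is at least \<open>- \<phi> (- x)\<close> at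
  \<open>x\<close>.\<close>

lemma ex_linear_below_sublinear:
  assumes \<phi>: "sublinear sc \<phi>"
  shows "\<exists>l. (\<forall>x y. l (x + y) = l x + l y) \<and> (\<forall>c x. l (sc c x) = c * l x) \<and> (\<forall>x. l x \<le> \<phi> x)"
proof -
  define A where "A = {\<psi>. sublinear sc \<psi> \<and> (\<forall>x. \<psi> x \<le> \<phi> x)}"
  have "\<exists>m\<in>A. \<forall>\<psi>\<in>A. (\<forall>x. \<psi> x \<le> m x) \<longrightarrow> \<psi> = m"
  proof (rule predicate_Zorn)
    \<comment> \<open>The relation is the reversed pointwise order, so that a maximal element for it
      is a minimal functional.\<close>
    show "partial_order_on A (relation_of (\<lambda>f g. \<forall>x. g x \<le> f x) A)"
      by (rule partial_order_on_relation_ofI) (auto intro: order_trans antisym simp: fun_eq_iff)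
  next
    fix C assume "C \<in> Chains (relation_of (\<lambda>f g. \<forall>x. g x \<le> f x) A)"
    then have chain: "f \<in> A" "(\<forall>x. f x \<le> g x) \<or> (\<forall>x. g x \<le> f x)" if "f \<in> C" "g \<in> C" for f g
      using that by (auto simp: Chains_def relation_of_def)
    show "\<exists>u\<in>A. \<forall>a\<in>C. \<forall>x. u x \<le> a x"
    proof (cases "C = {}")
      case True
      with \<phi> show ?thesis by (auto simp: A_def)
    next
      case False
      define u where "u x = (INF f\<in>C. f x)" for x
      have f: "f (x + y) \<le> f x + f y" "f x \<le> \<phi> x" "- \<phi> (- x) \<le> f x" "0 \<le> c \<Longrightarrow> f (sc c x) = c * f x"
        if "f \<in> C" for f x y c
      proof -
        have "f \<in> A" using chain that by blast
        then have *: "sublinear sc f" "\<And>x. f x \<le> \<phi> x" by (auto simp: A_def)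
        from * show "f (x + y) \<le> f x + f y" "f x \<le> \<phi> x" "0 \<le> c \<Longrightarrow> f (sc c x) = c * f x"
          unfolding sublinear_def by auto
        from *(2)[of "- x"] sublinear_ge[OF *(1), of x] show "- \<phi> (- x) \<le> f x" by linarith
      qed
      have bdd: "bdd_below ((\<lambda>f. f x) ` C)" for x
        using f(3) by (intro bdd_belowI2)
      have le: "u x \<le> f x" if "f \<in> C" for f x
        unfolding u_def using that by (intro cINF_lower bdd)
      have "u (x + y) \<le> u x + u y" for x y
      proof -
        \<comment> \<open>Of two members of the chain, the smaller one can serve for both
          arguments.\<close>
        have 1: "u (x + y) - g y \<le> f x" if "f \<in> C" "g \<in> C" for f g
        proof -
          from chain(2)[OF that] show ?thesis
          proof
            assume "\<forall>x. f x \<le> g x"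
            with le[OF that(1), of "x + y"] f(1)[OF that(1), of x y] show ?thesis
              by (smt (verit))
          next
            assume "\<forall>x. g x \<le> f x"
            with le[OF that(2), of "x + y"] f(1)[OF that(2), of x y] show ?thesis
              by (smt (verit))
          qed
        qed
        have 2: "u (x + y) - g y \<le> u x" if "g \<in> C" for g
          unfolding u_def[of x] using 1 that False by (intro cINF_greatest) auto
        have "u (x + y) - u x \<le> u y"
          unfolding u_def[of y] using 2 False by (intro cINF_greatest) (auto simp: algebra_simps)
        then show ?thesis by simp
      qed
      moreover have "u (sc c x) = c * u x" if "0 \<le> c" for c x
      proof (cases "c = 0")
        case True
        have "u (sc c x) = (INF f\<in>C. 0)"
          unfolding u_def by (intro INF_cong) (auto simp: f(4) True simp del: scale_zero_left)
        with True False show ?thesis by simp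
      next
        case c: False
        have le': "c * u x \<le> u (sc c x)" if "c > 0" for c x
          unfolding u_def[of "sc c x"] using that False le
          by (intro cINF_greatest) (auto simp: f(4) intro!: mult_left_mono)
        have "1 / c * u (sc c x) \<le> u (sc (1 / c) (sc c x))"
          using c that by (intro le') auto
        then have "u (sc c x) \<le> c * u x"
          using c that by (simp add: field_simps)
        with le'[of c x] c that show ?thesis by simp
      qed
      moreover have "u x \<le> \<phi> x" for x
        using False le f(2) by (meson all_not_in_conv order_trans)
      ultimately have "u \<in> A" by (simp add: A_def sublinear_def)
      with le show ?thesis by auto
    qed
  qed
  then obtain l where "l \<in> A" and least: "\<forall>\<psi>\<in>A. (\<forall>x. \<psi> x \<le> l x) \<longrightarrow> \<psi> = l" ..
  then have l: "sublinear sc l" "\<And>x. l x \<le> \<phi> x" by (auto simp: A_def)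
  have min: "\<psi> = l" if "sublinear sc \<psi>" "\<And>x. \<psi> x \<le> l x" for \<psi>
  proof -
    have "\<psi> \<in> A" using that l(2) by (auto simp: A_def intro: order_trans)
    with least that(2) show ?thesis by blast
  qed
  have uminus: "l (- x) = - l x" for x
  proof -
    have "l (- x) \<le> - l x"
      using sublinear_refine(3)[OF l(1), of x]
        fun_cong[OF min[OF sublinear_refine(1)[OF l(1)] sublinear_refine(2)[OF l(1)], of x], of "- x"] by linarith
    with sublinear_ge[OF l(1), of x] show ?thesis by simp
  qed
  have "l (x + y) = l x + l y" for x y
  proof -
    have "l (- x + - y) \<le> l (- x) + l (- y)" "l (x + y) \<le> l x + l y"
      using l(1) unfolding sublinear_def by blast+
    with uminus[of "x + y"] show ?thesis by (simp add: uminus)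
  qed
  moreover have "l (sc c x) = c * l x" for c x
  proof (cases "0 \<le> c")
    case False
    then have "0 \<le> - c" by simp
    then have "l (sc (- c) x) = - c * l x" using l(1) unfolding sublinear_def by blast
    with uminus[of "sc c x"] show ?thesis by simp
  qed (use l(1) in \<open>auto simp: sublinear_def\<close>)
  ultimately show ?thesis using l(2) by blast
qed

text \<open>Instead of extending from the line spanned by \<open>z\<close>, the existence result is
  applied to the refinement of \<open>\<phi>\<close> at \<open>z\<close>: it yields
  \<open>l (- z) \<le> - \<phi> z\<close>, which together with \<open>l z \<le> \<phi> z\<close> is
  equality.\<close>

theorem hahn_banach_sublinear:
  assumes \<phi>: "sublinear sc \<phi>"
  shows "\<exists>l. (\<forall>x y. l (x + y) = l x + l y) \<and> (\<forall>c x. l (sc c x) = c * l x) \<and>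
    (\<forall>x. l x \<le> \<phi> x) \<and> l z = \<phi> z"
proof -
  obtain l where l: "\<And>x y. l (x + y) = l x + l y" "\<And>c x. l (sc c x) = c * l x"
    "\<And>x. l x \<le> (INF t\<in>{0..}. \<phi> (x + sc t z) - t * \<phi> z)"
    using ex_linear_below_sublinear[OF sublinear_refine(1)[OF \<phi>, of z]] by blast
  have le: "l x \<le> \<phi> x" for x using l(3)[of x] sublinear_refine(2)[OF \<phi>, of x z] by linarith
  have "l (- z) \<le> - \<phi> z" using l(3)[of "- z"] sublinear_refine(3)[OF \<phi>, of z] by linarith
  moreover have "l (- z) = - l z" using l(2)[of "-1" z] by simp
  ultimately have "l z = \<phi> z" using le[of z] by simp
  with l le show ?thesis by blast
qed

end

section \<open>Schoenberg's space-filling curve\<close>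

text \<open>Continuous, of period 2, equal to 0 on [0, 1/3] and to 1 on [2/3, 1], because 1/2 - cos
  is nonpositive on [0, pi/3] and at least 1 on [2 pi/3, pi]. It is thus able to read a ternary
  digit 0 or 2.\<close>

definition cosine_clamp :: "real \<Rightarrow> real" where
  "cosine_clamp t = max 0 (min 1 (1 / 2 - cos (pi * t)))"

text \<open>Coordinate \<open>i\<close> of a curve in the \<open>d\<close>-dimensional cube. At a
  point of the Cantor set the factor \<open>3 ^ (d * k + i)\<close> brings up ternary digit
  \<open>d * k + i\<close>, whose half becomes binary digit \<open>k\<close> of the coordinate;
  different coordinates read disjoint sets of digits.\<close>

definition schoenberg :: "nat \<Rightarrow> nat \<Rightarrow> real \<Rightarrow> real" where
  "schoenberg d i t = suminf (\<lambda>k. cosine_clamp (3 ^ (d * k + i) * t) / 2 ^ Suc k)"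

lemma cosine_clamp_bounds: "0 \<le> cosine_clamp t" "cosine_clamp t \<le> 1"
  by (auto simp: cosine_clamp_def)

lemma cosine_clamp_periodic: "cosine_clamp (2 * of_nat n + s) = cosine_clamp s"
proof -
  have "cos (pi * (2 * of_nat n + s)) = cos (2 * of_nat n * pi + pi * s)"
    by (simp add: algebra_simps)
  also have "\<dots> = cos (pi * s)"
    by (simp add: cos_add)
  finally have "cos (pi * (2 * of_nat n + s)) = cos (pi * s)" .
  then show ?thesis by (simp add: cosine_clamp_def)
qed

lemma cosine_clamp_eq_0: "0 \<le> s \<Longrightarrow> s \<le> 1 / 3 \<Longrightarrow> cosine_clamp s = 0"
  using cos_monotone_0_pi_le[of "pi * s" "pi / 3"] by (simp add: cosine_clamp_def cos_60)

lemma cosine_clamp_eq_1: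
  assumes "2 / 3 \<le> s" "s \<le> 1" shows "cosine_clamp s = 1"
proof -
  have "cos (pi * s) \<le> cos (2 * pi / 3)"
    using assms by (intro cos_monotone_0_pi_le) (auto simp: field_simps)
  then show ?thesis by (simp add: cosine_clamp_def cos_120)
qed

lemma half_power_sums: "(\<lambda>k. 1 / 2 ^ Suc k) sums (1::real)"
  using power_half_series by (simp add: power_one_over)

lemma schoenberg_term_bound: "norm (cosine_clamp t / 2 ^ Suc k) \<le> 1 / 2 ^ Suc k"
  using cosine_clamp_bounds[of t] by (auto simp: divide_simps)

lemma continuous_schoenberg: "continuous_on UNIV (schoenberg d i)"
proof -
  have "uniform_limit UNIV (\<lambda>n t. \<Sum>k<n. cosine_clamp (3 ^ (d * k + i) * t) / 2 ^ Suc k)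
      (\<lambda>t. suminf (\<lambda>k. cosine_clamp (3 ^ (d * k + i) * t) / 2 ^ Suc k)) sequentially"
    by (rule Weierstrass_m_test[where M = "\<lambda>k. 1 / 2 ^ Suc k"])
       (rule schoenberg_term_bound sums_summable[OF half_power_sums])+
  then show ?thesis
    unfolding schoenberg_def[abs_def]
    by (rule uniform_limit_theorem[rotated])
       (auto intro!: always_eventually continuous_intros simp: cosine_clamp_def)
qed

lemma schoenberg_bounds: "0 \<le> schoenberg d i t" "schoenberg d i t \<le> 1"
proof -
  have sum: "summable (\<lambda>k. cosine_clamp (3 ^ (d * k + i) * t) / 2 ^ Suc k)"
    by (rule summable_comparison_test'[OF sums_summable[OF half_power_sums]])
       (rule schoenberg_term_bound)
  then show "0 \<le> schoenberg d i t"
    unfolding schoenberg_def using cosine_clamp_bounds by (intro suminf_nonneg) auto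
  have "schoenberg d i t \<le> suminf (\<lambda>k. 1 / 2 ^ Suc k)"
    unfolding schoenberg_def using cosine_clamp_bounds
    by (intro suminf_le sum sums_summable[OF half_power_sums]) (auto simp: divide_simps)
  also have "\<dots> = 1" using half_power_sums by (rule sums_unique[symmetric])
  finally show "schoenberg d i t \<le> 1" .
qed

lemma binary_expansion:
  assumes "0 \<le> x" "x \<le> (1::real)"
  obtains b :: "nat \<Rightarrow> nat" where "\<And>k. b k \<le> 1" "(\<lambda>k. real (b k) / 2 ^ Suc k) sums x"
proof (cases "x = 1")
  case True
  \<comment> \<open>At \<open>x = 1\<close> the floor construction used below would produce only
    zeros.\<close>
  then show ?thesis using half_power_sums by (intro that[of "\<lambda>_. 1"]) auto
next
  case False
  define b where "b k = nat (\<lfloor>2 ^ Suc k * x\<rfloor> mod 2)" for k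
  have partial: "(\<Sum>k<n. real (b k) / 2 ^ Suc k) = of_int \<lfloor>2 ^ n * x\<rfloor> / 2 ^ n" for n
  proof (induction n)
    case 0
    have "\<lfloor>x\<rfloor> = 0" using assms False by linarith
    then show ?case by simp
  next
    case (Suc n)
    have "\<lfloor>2 ^ n * x\<rfloor> = \<lfloor>2 ^ Suc n * x\<rfloor> div 2"
      using floor_divide_real_eq_div[of 2 "2 ^ Suc n * x"] by simp
    moreover have "real (b n) = of_int (\<lfloor>2 ^ Suc n * x\<rfloor> mod 2)"
      by (simp add: b_def)
    moreover have "real_of_int \<lfloor>2 ^ Suc n * x\<rfloor>
        = 2 * of_int (\<lfloor>2 ^ Suc n * x\<rfloor> div 2) + of_int (\<lfloor>2 ^ Suc n * x\<rfloor> mod 2)"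
      using mult_div_mod_eq[of 2 "\<lfloor>2 ^ Suc n * x\<rfloor>"] by (metis of_int_add of_int_mult of_int_numeral)
    ultimately show ?case
      using Suc.IH by (simp add: field_simps)
  qed
  have "(\<lambda>n. of_int \<lfloor>2 ^ n * x\<rfloor> / 2 ^ n) \<longlonglongrightarrow> x"
  proof (rule LIMSEQ_I)
    fix r :: real assume "r > 0"
    then obtain N where N: "(1 / 2) ^ N < r" using real_arch_pow_inv[of r "1/2"] by auto
    have "norm (of_int \<lfloor>2 ^ n * x\<rfloor> / 2 ^ n - x) < r" if "n \<ge> N" for n
    proof -
      have "\<bar>of_int \<lfloor>2 ^ n * x\<rfloor> - 2 ^ n * x\<bar> \<le> 1" by linarith
      moreover have "of_int \<lfloor>2 ^ n * x\<rfloor> / 2 ^ n - x = (of_int \<lfloor>2 ^ n * x\<rfloor> - 2 ^ n * x) / 2 ^ n"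
        by (simp add: field_simps)
      ultimately have "\<bar>of_int \<lfloor>2 ^ n * x\<rfloor> / 2 ^ n - x\<bar> \<le> (1 / 2) ^ n"
        by (simp add: power_one_over divide_right_mono)
      also have "\<dots> \<le> (1 / 2) ^ N" using that by (intro power_decreasing) auto
      finally show ?thesis using N by simp
    qed
    then show "\<exists>N. \<forall>n\<ge>N. norm (of_int \<lfloor>2 ^ n * x\<rfloor> / 2 ^ n - x) < r" by blast
  qed
  then have "(\<lambda>k. real (b k) / 2 ^ Suc k) sums x"
    by (simp only: sums_def partial)
  moreover have "b k \<le> 1" for k by (simp add: b_def nat_le_iff)
  ultimately show ?thesis by (rule that[rotated])
qed

text \<open>Multiplying the Cantor point by \<open>3 ^ n\<close> leaves an even integer, from the
  earlier digits, plus \<open>2 * c n / 3 + r / 3\<close> with \<open>r\<close> in [0, 1], from the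
  later ones. Periodicity removes the even integer, and the rest lies in [0, 1/3] or in [2/3, 1]
  according to \<open>c n\<close>.\<close>

lemma cosine_clamp_ternary:
  fixes c :: "nat \<Rightarrow> nat"
  assumes c: "\<And>j. c j \<le> 1"
  shows "cosine_clamp (3 ^ n * suminf (\<lambda>j. 2 * real (c j) / 3 ^ Suc j)) = c n"
proof -
  have geo: "(\<lambda>j. 2 / 3 ^ Suc j) sums (1::real)"
    using sums_mult[OF geometric_sums[of "1 / 3::real"], of "2 / 3"]
    by (simp add: power_one_over field_simps)
  have summ: "summable (\<lambda>j. 2 * real (c (j + m)) / 3 ^ Suc j)" for m
    using c by (intro summable_comparison_test'[OF sums_summable[OF geo]])
      (auto simp: divide_simps)
  define r where "r = suminf (\<lambda>j. 2 * real (c (j + Suc n)) / 3 ^ Suc j)"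
  have "0 \<le> r" unfolding r_def by (intro suminf_nonneg summ) auto
  have "r \<le> 1"
    unfolding r_def sums_unique[OF geo] using c
    by (intro suminf_le summ sums_summable[OF geo]) (auto simp: divide_simps)
  define N where "N = (\<Sum>j<n. c j * 3 ^ (n - Suc j))"
  have "suminf (\<lambda>j. 2 * real (c j) / 3 ^ Suc j)
      = suminf (\<lambda>j. 2 * real (c (j + Suc n)) / 3 ^ Suc (j + Suc n)) + (\<Sum>j<Suc n. 2 * real (c j) / 3 ^ Suc j)"
    using suminf_split_initial_segment[OF summ[of 0], of "Suc n"] by simp
  also have "suminf (\<lambda>j. 2 * real (c (j + Suc n)) / 3 ^ Suc (j + Suc n)) = r / 3 ^ Suc n"
    unfolding r_def suminf_divide[OF summ, symmetric] by (simp add: power_add field_simps)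
  also have "3 ^ n * (r / 3 ^ Suc n + (\<Sum>j<Suc n. 2 * real (c j) / 3 ^ Suc j))
      = 2 * real N + (2 * real (c n) / 3 + r / 3)"
  proof -
    have "3 ^ n * (\<Sum>j<n. 2 * real (c j) / 3 ^ Suc j) = 2 * real N"
      unfolding N_def of_nat_sum sum_distrib_left
    proof (intro sum.cong refl)
      fix j assume "j \<in> {..<n}"
      then have "(3::real) ^ n = 3 ^ (n - Suc j) * 3 ^ Suc j"
        by (simp flip: power_add del: power_Suc)
      then show "3 ^ n * (2 * real (c j) / 3 ^ Suc j) = 2 * real (c j * 3 ^ (n - Suc j))"
        by simp
    qed
    then show ?thesis by (simp add: algebra_simps)
  qed
  finally have "cosine_clamp (3 ^ n * suminf (\<lambda>j. 2 * real (c j) / 3 ^ Suc j))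
      = cosine_clamp (2 * real (c n) / 3 + r / 3)"
    by (simp only: cosine_clamp_periodic)
  also have "\<dots> = c n"
  proof (cases "c n = 0")
    case True
    then show ?thesis using \<open>0 \<le> r\<close> \<open>r \<le> 1\<close> by (simp add: cosine_clamp_eq_0)
  next
    case False
    then have "c n = 1" using c[of n] by simp
    then show ?thesis using \<open>0 \<le> r\<close> \<open>r \<le> 1\<close> by (simp add: cosine_clamp_eq_1)
  qed
  finally show ?thesis .
qed

text \<open>Binary expansions of all coordinates are interleaved into one Cantor point: digit
  \<open>k\<close> of coordinate \<open>i\<close> goes to place \<open>d * k + i\<close>.\<close>

theorem schoenberg_surj:
  assumes x: "\<And>i. i < d \<Longrightarrow> 0 \<le> x i \<and> x i \<le> 1"
  obtains t where "0 \<le> t" "t \<le> 1" "\<And>i. i < d \<Longrightarrow> schoenberg d i t = x i"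
proof -
  have "\<exists>b::nat \<Rightarrow> nat. (\<forall>k. b k \<le> 1) \<and> (i < d \<longrightarrow> (\<lambda>k. real (b k) / 2 ^ Suc k) sums x i)" for i
  proof (cases "i < d")
    case True
    with x[of i] show ?thesis by (metis binary_expansion)
  qed (auto intro!: exI[of _ "\<lambda>_. 0"])
  then obtain b :: "nat \<Rightarrow> nat \<Rightarrow> nat" where b: "\<And>i k. b i k \<le> 1"
    "\<And>i. i < d \<Longrightarrow> (\<lambda>k. real (b i k) / 2 ^ Suc k) sums x i" by metis
  define c where "c j = b (j mod d) (j div d)" for j
  have c: "c j \<le> 1" for j using b(1)[of "j mod d" "j div d"] by (simp add: c_def)
  define t where "t = suminf (\<lambda>j. 2 * real (c j) / 3 ^ Suc j)"
  have geo: "(\<lambda>j. 2 / 3 ^ Suc j) sums (1::real)"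
    using sums_mult[OF geometric_sums[of "1 / 3::real"], of "2 / 3"]
    by (simp add: power_one_over field_simps)
  have summ: "summable (\<lambda>j. 2 * real (c j) / 3 ^ Suc j)"
    using c by (intro summable_comparison_test'[OF sums_summable[OF geo]])
      (auto simp: divide_simps)
  have "schoenberg d i t = x i" if "i < d" for i
  proof -
    have "c (d * k + i) = b i k" for k using that by (simp add: c_def)
    then have "schoenberg d i t = suminf (\<lambda>k. real (b i k) / 2 ^ Suc k)"
      unfolding schoenberg_def t_def by (simp only: cosine_clamp_ternary[OF c])
    with b(2)[OF that] show ?thesis by (simp add: sums_iff)
  qed
  moreover have "0 \<le> t" unfolding t_def by (intro suminf_nonneg summ) auto
  moreover have "t \<le> 1"
    unfolding t_def sums_unique[OF geo] using c
    by (intro suminf_le summ sums_summable[OF geo]) (auto simp: divide_simps)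
  ultimately show ?thesis by (rule that[rotated 2])
qed

section \<open>Functionals on polynomials over a box\<close>

text \<open>The affine map of [l, h] onto [0, 1] in the variable \<open>i\<close>. It is a formal
  polynomial, like the Bernstein polynomials built from it, because the functionals to be
  represented act on formal polynomials and not on functions.\<close>

definition unit_coordinate :: "real \<Rightarrow> real \<Rightarrow> 'x \<Rightarrow> 'x rpoly" where
  "unit_coordinate l h i = Poly_Mapping.single 0 (1 / (h - l)) *
     (Poly_Mapping.single (Poly_Mapping.single i 1) 1 - Poly_Mapping.single 0 l)"

definition bernstein_basis :: "real \<Rightarrow> real \<Rightarrow> nat \<Rightarrow> nat \<Rightarrow> 'x \<Rightarrow> 'x rpoly" where
  "bernstein_basis l h n k i =
     of_nat (n choose k) * unit_coordinate l h i ^ k * (1 - unit_coordinate l h i) ^ (n - k)"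

definition bernstein_poly :: "real \<Rightarrow> real \<Rightarrow> (real \<Rightarrow> real) \<Rightarrow> nat \<Rightarrow> 'x \<Rightarrow> 'x rpoly" where
  "bernstein_poly l h f n i =
     (\<Sum>k\<le>n. Poly_Mapping.single 0 (f (l + (h - l) * (k / n))) * bernstein_basis l h n k i)"

section \<open>Values and approximation properties of Bernstein polynomials\<close>

lemma monomial_value_single_index [simp]: "monomial_value (Poly_Mapping.single i n) \<omega> = \<omega> i ^ n"
  by (simp add: monomial_value_def)

lemma poly_value_of_nat [simp]: "poly_value (of_nat n) \<omega> = of_nat n"
  by (induction n) auto

lemma polys_over_of_nat [simp]: "of_nat n \<in> polys_over U"
  by (induction n) auto

lemma unit_coordinate_over: "unit_coordinate l h i \<in> polys_over {i}"
  unfolding unit_coordinate_def by (intro polys_over_mult polys_over_minus) auto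

lemma bernstein_basis_over: "bernstein_basis l h n k i \<in> polys_over {i}"
  unfolding bernstein_basis_def by (intro polys_over_mult polys_over_power polys_over_minus unit_coordinate_over) auto

lemma bernstein_poly_over: "bernstein_poly l h f n i \<in> polys_over {i}"
  unfolding bernstein_poly_def by (intro polys_over_sum polys_over_mult bernstein_basis_over) auto

text \<open>The binomial theorem in the ring of formal polynomials. Since the partition of unity is
  formal, and not just pointwise on the interval, a functional can be applied to it.\<close>

lemma sum_bernstein_basis: "(\<Sum>k\<le>n. bernstein_basis l h n k i) = 1"
  using binomial_ring[of "unit_coordinate l h i" "1 - unit_coordinate l h i" n]
  by (simp add: bernstein_basis_def)

lemma poly_value_unit_coordinate: "poly_value (unit_coordinate l h i) \<omega> = (\<omega> i - l) / (h - l)"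
  by (simp add: unit_coordinate_def diff_divide_distrib)

lemma poly_value_bernstein_basis:
  "poly_value (bernstein_basis l h n k i) \<omega> = Bernstein n k ((\<omega> i - l) / (h - l))"
  by (simp add: bernstein_basis_def Bernstein_def poly_value_unit_coordinate)

lemma poly_value_bernstein_poly:
  "poly_value (bernstein_poly l h f n i) \<omega> =
     (\<Sum>k\<le>n. f (l + (h - l) * (k / n)) * Bernstein n k ((\<omega> i - l) / (h - l)))"
  by (simp add: bernstein_poly_def poly_value_bernstein_basis)

lemma unit_coordinate_bounds:
  fixes x :: real
  assumes "x \<in> {l..h}"
  shows "(x - l) / (h - l) \<in> {0..1}"
  using assms by (auto simp: divide_simps)

text \<open>Division by zero returning zero makes this correct for \<open>l = h\<close> as well.\<close>

lemma unit_coordinate_inverse: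
  fixes x :: real
  assumes "x \<in> {l..h}"
  shows "l + (h - l) * ((x - l) / (h - l)) = x"
  using assms by auto

lemma affine_in_interval:
  fixes t :: real
  assumes "l \<le> h" "t \<in> {0..1}"
  shows "l + (h - l) * t \<in> {l..h}"
  using assms mult_left_mono[of t 1 "h - l"] by auto

lemma bernstein_poly_converges:
  assumes "l \<le> h" and f: "continuous_on {l..h} f" and "0 < \<epsilon>"
  shows "\<exists>N. \<forall>n\<ge>N. \<forall>\<omega>. \<omega> i \<in> {l..h} \<longrightarrow>
    \<bar>poly_value (bernstein_poly l h f n i) \<omega> - f (\<omega> i)\<bar> < \<epsilon>"
proof -
  have "continuous_on {0..1} (\<lambda>t. f (l + (h - l) * t))"
    using affine_in_interval[OF \<open>l \<le> h\<close>]
    by (intro continuous_on_compose2[OF f] continuous_intros) blast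
  from Bernstein_Weierstrass[OF this \<open>0 < \<epsilon>\<close>] obtain N where
    N: "\<And>n x. N \<le> n \<Longrightarrow> x \<in> {0..1} \<Longrightarrow>
      \<bar>f (l + (h - l) * x) - (\<Sum>k\<le>n. f (l + (h - l) * (k / n)) * Bernstein n k x)\<bar> < \<epsilon>"
    by blast
  have "\<bar>poly_value (bernstein_poly l h f n i) \<omega> - f (\<omega> i)\<bar> < \<epsilon>"
    if "N \<le> n" "\<omega> i \<in> {l..h}" for n \<omega>
    using N[OF that(1) unit_coordinate_bounds[OF that(2)]] unit_coordinate_inverse[OF that(2)]
    by (simp add: poly_value_bernstein_poly abs_minus_commute)
  then show ?thesis by blast
qed

lemma bernstein_poly_bounded:
  assumes "l \<le> h" "\<And>x. x \<in> {l..h} \<Longrightarrow> \<bar>f x\<bar> \<le> K" "\<omega> i \<in> {l..h}"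
  shows "\<bar>poly_value (bernstein_poly l h f n i) \<omega>\<bar> \<le> K"
proof -
  let ?t = "(\<omega> i - l) / (h - l)"
  have t: "0 \<le> ?t" "?t \<le> 1" using unit_coordinate_bounds[OF assms(3)] by auto
  have "\<bar>poly_value (bernstein_poly l h f n i) \<omega>\<bar>
      \<le> (\<Sum>k\<le>n. \<bar>f (l + (h - l) * (k / n)) * Bernstein n k ?t\<bar>)"
    unfolding poly_value_bernstein_poly by (rule sum_abs)
  also have "\<dots> \<le> (\<Sum>k\<le>n. K * Bernstein n k ?t)"
  proof (intro sum_mono)
    fix k assume "k \<in> {..n}"
    then have "\<bar>f (l + (h - l) * (k / n))\<bar> \<le> K"
      by (intro assms affine_in_interval) (auto simp: divide_simps)
    then show "\<bar>f (l + (h - l) * (k / n)) * Bernstein n k ?t\<bar> \<le> K * Bernstein n k ?t"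
      using Bernstein_nonneg[OF t, of n k] by (simp add: abs_mult mult_right_mono)
  qed
  also have "\<dots> = K" by (simp flip: sum_distrib_left)
  finally show ?thesis .
qed

lemma continuous_on_poly_value_diagonal: "continuous_on S (\<lambda>x. poly_value p (\<lambda>_. x))"
  unfolding poly_value_def monomial_value_def by (intro continuous_intros)

lemma poly_value_univariate: "p \<in> polys_over {i} \<Longrightarrow> poly_value p \<omega> = poly_value p (\<lambda>_. \<omega> i)"
  by (rule poly_value_cong) auto

lemma continuous_on_interval_bounded:
  fixes f :: "real \<Rightarrow> real"
  assumes "continuous_on {l..h} f"
  obtains K where "0 \<le> K" "\<And>x. x \<in> {l..h} \<Longrightarrow> \<bar>f x\<bar> \<le> K"
proof -
  have "bounded (f ` {l..h})"
    by (intro compact_imp_bounded compact_continuous_image assms) auto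
  then obtain K where "\<forall>y\<in>f ` {l..h}. norm y \<le> K" unfolding bounded_iff by blast
  then show ?thesis by (intro that[of "max 0 K"]) (auto simp: le_max_iff_disj)
qed

text \<open>The square root of \<open>p\<close> is continuous on the interval and hence uniformly
  close to a Bernstein polynomial \<open>u\<close>; \<open>p - u\<^sup>2\<close> is then a small
  factor times a bounded one.\<close>

lemma nonneg_univariate_approx_square:
  assumes "l \<le> h" and p: "p \<in> polys_over {i}"
    and nonneg: "\<And>\<omega>. \<omega> i \<in> {l..h} \<Longrightarrow> 0 \<le> poly_value p \<omega>" and "0 < \<epsilon>"
  shows "\<exists>u\<in>polys_over {i}. \<forall>\<omega>. \<omega> i \<in> {l..h} \<longrightarrow> \<bar>poly_value (p - u\<^sup>2) \<omega>\<bar> \<le> \<epsilon>"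
proof -
  define f where "f x = sqrt (poly_value p (\<lambda>_. x))" for x
  have f: "continuous_on {l..h} f"
    unfolding f_def by (intro continuous_intros continuous_on_poly_value_diagonal)
  then obtain K where K: "0 \<le> K" "\<And>x. x \<in> {l..h} \<Longrightarrow> \<bar>f x\<bar> \<le> K"
    by (rule continuous_on_interval_bounded) blast
  \<comment> \<open>Chosen to make \<open>\<delta> \<le> 1\<close>, so that the bounded factor is at
    most \<open>2 * K + 1\<close>, and also
    \<open>\<delta> * (2 * K + 1) \<le> \<epsilon>\<close>.\<close>
  define \<delta> where "\<delta> = \<epsilon> / (2 * K + \<epsilon> + 1)"
  have "0 < \<delta>" using \<open>0 < \<epsilon>\<close> K by (simp add: \<delta>_def)
  have "\<delta> \<le> 1" using \<open>0 < \<epsilon>\<close> K by (simp add: \<delta>_def divide_simps)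
  have "\<delta> * (2 * K + 1) \<le> \<epsilon>"
    using \<open>0 < \<epsilon>\<close> K by (simp add: \<delta>_def divide_simps)
  from bernstein_poly_converges[OF \<open>l \<le> h\<close> f \<open>0 < \<delta>\<close>, of i] obtain n where
    n: "\<And>\<omega>. \<omega> i \<in> {l..h} \<Longrightarrow> \<bar>poly_value (bernstein_poly l h f n i) \<omega> - f (\<omega> i)\<bar> < \<delta>"
    by blast
  define u where "u = bernstein_poly l h f n i"
  have "\<bar>poly_value (p - u\<^sup>2) \<omega>\<bar> \<le> \<epsilon>" if \<omega>: "\<omega> i \<in> {l..h}" for \<omega>
  proof -
    let ?v = "poly_value u \<omega>" and ?f = "f (\<omega> i)"
    have d: "\<bar>?v - ?f\<bar> \<le> \<delta>" using n[of \<omega>] \<omega> by (simp add: u_def)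
    have "poly_value p \<omega> = ?f\<^sup>2"
      using nonneg[of "\<lambda>_. \<omega> i"] \<omega> by (simp add: f_def poly_value_univariate[OF p, of \<omega>])
    then have "poly_value (p - u\<^sup>2) \<omega> = - ((?v - ?f) * (?v + ?f))"
      by (simp add: power2_eq_square algebra_simps)
    then have "\<bar>poly_value (p - u\<^sup>2) \<omega>\<bar> = \<bar>?v - ?f\<bar> * \<bar>?v + ?f\<bar>"
      by (simp add: abs_mult)
    also have "\<dots> \<le> \<delta> * (2 * K + 1)"
      using d K(2)[OF \<omega>] \<open>\<delta> \<le> 1\<close> \<open>0 < \<delta>\<close> by (intro mult_mono) auto
    finally show ?thesis using \<open>\<delta> * (2 * K + 1) \<le> \<epsilon>\<close> by linarith
  qed
  moreover have "u \<in> polys_over {i}" by (simp add: u_def bernstein_poly_over)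
  ultimately show ?thesis by blast
qed

text \<open>Log-convexity makes the ratios of successive terms nondecreasing. If the initial ratio
  exceeded \<open>q\<close>, the sequence would grow at least geometrically at that larger rate,
  against the assumed bound.\<close>

lemma log_convex_bound:
  fixes A :: "nat \<Rightarrow> real"
  assumes nonneg: "\<And>n. 0 \<le> A n" and convex: "\<And>n. (A (Suc n))\<^sup>2 \<le> A n * A (Suc (Suc n))"
    and bound: "\<And>n. A n \<le> K * q ^ n" and "0 \<le> q"
  shows "A 1 \<le> q * A 0"
proof (rule ccontr)
  assume "\<not> A 1 \<le> q * A 0"
  then have gt: "q * A 0 < A 1" by simp
  have "A 0 \<noteq> 0"
  proof
    assume "A 0 = 0"
    with convex[of 0] have "A 1 = 0" by simp
    with gt \<open>A 0 = 0\<close> show False by simp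
  qed
  with nonneg[of 0] have "0 < A 0" by simp
  define \<rho> where "\<rho> = A 1 / A 0"
  have "q < \<rho>" using gt \<open>0 < A 0\<close> by (simp add: \<rho>_def field_simps)
  with \<open>0 \<le> q\<close> have "0 < \<rho>" by simp
  have step: "0 < A n \<and> \<rho> * A n \<le> A (Suc n)" for n
  proof (induction n)
    case 0
    then show ?case using \<open>0 < A 0\<close> by (simp add: \<rho>_def)
  next
    case (Suc n)
    then have "0 < A (Suc n)" using mult_pos_pos[OF \<open>0 < \<rho>\<close>, of "A n"] by linarith
    have "\<rho> * A n * A (Suc n) \<le> A (Suc n) * A (Suc n)"
      using Suc \<open>0 < A (Suc n)\<close> by (intro mult_right_mono) auto
    also have "\<dots> \<le> A n * A (Suc (Suc n))" using convex[of n] by (simp add: power2_eq_square)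
    finally have "\<rho> * A (Suc n) \<le> A (Suc (Suc n))" using Suc by (simp add: mult_ac)
    with \<open>0 < A (Suc n)\<close> show ?case by simp
  qed
  have pow: "\<rho> ^ n * A 0 \<le> A n" for n
  proof (induction n)
    case (Suc n)
    have "\<rho> ^ Suc n * A 0 \<le> \<rho> * A n" using Suc \<open>0 < \<rho>\<close> by (simp add: mult_left_mono mult_ac)
    then show ?case using step[of n] by linarith
  qed simp
  show False
  proof (cases "q = 0")
    case True
    then have "\<rho> * A 0 \<le> 0" using pow[of 1] bound[of 1] by simp
    with mult_pos_pos[OF \<open>0 < \<rho>\<close> \<open>0 < A 0\<close>] show False by simp
  next
    case False
    with \<open>0 \<le> q\<close> have "0 < q" by simp
    obtain n where n: "K / A 0 < (\<rho> / q) ^ n"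
      using real_arch_pow[of "\<rho> / q" "K / A 0"] \<open>q < \<rho>\<close> \<open>0 < q\<close> by auto
    have "\<rho> ^ n * A 0 \<le> K * q ^ n" using pow[of n] bound[of n] by linarith
    then have "(\<rho> / q) ^ n \<le> K / A 0"
      using \<open>0 < A 0\<close> \<open>0 < q\<close> by (simp add: field_simps)
    with n show False by simp
  qed
qed

text \<open>What is kept of the dual program. \<open>L_univariate_bound\<close> will come from
  domination by \<open>e C\<close> for a context \<open>C\<close> that contains \<open>i\<close>,
  because \<open>e C\<close> is a probability measure on a box.\<close>

locale box_functional =
  fixes X :: "'x set" and a b :: "'x \<Rightarrow> real" and L :: "'x rpoly \<Rightarrow> real"
  assumes finite_X: "finite X"
    and interval: "\<And>i. i \<in> X \<Longrightarrow> a i \<le> b i"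
    and L_add: "L (p + q) = L p + L q"
    and L_scale: "L (Poly_Mapping.single 0 c * p) = c * L p"
    and L_square: "p \<in> polys_over X \<Longrightarrow> 0 \<le> L (p\<^sup>2)"
    and L_univariate_bound: "i \<in> X \<Longrightarrow> u \<in> polys_over {i} \<Longrightarrow> 0 \<le> r \<Longrightarrow>
      (\<And>\<omega>. \<omega> i \<in> {a i..b i} \<Longrightarrow> \<bar>poly_value u \<omega>\<bar> \<le> r) \<Longrightarrow> L (u\<^sup>2) \<le> r\<^sup>2"
begin

lemma L_minus: "L (p - q) = L p - L q"
  using L_add[of "p - q" q] by simp

lemma L_zero: "L 0 = 0"
  using L_minus[of 0 0] by simp

lemma L_sum: "L (\<Sum>i\<in>I. f i) = (\<Sum>i\<in>I. L (f i))"
  by (induction I rule: infinite_finite_induct) (auto simp: L_add L_zero)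

lemma univariate_over_X: "i \<in> X \<Longrightarrow> u \<in> polys_over {i} \<Longrightarrow> u \<in> polys_over X"
  using polys_over_mono[of "{i}" X] by blast

text \<open>The discriminant argument for the square of \<open>p - t * q\<close>.\<close>

lemma L_cauchy_schwarz:
  assumes "p \<in> polys_over X" "q \<in> polys_over X"
  shows "(L (p * q))\<^sup>2 \<le> L (p\<^sup>2) * L (q\<^sup>2)"
proof -
  have nonneg: "0 \<le> L (p\<^sup>2) - 2 * t * L (p * q) + t\<^sup>2 * L (q\<^sup>2)" for t
  proof -
    let ?t = "Poly_Mapping.single 0 t :: 'x rpoly"
    have "0 \<le> L ((p - ?t * q)\<^sup>2)"
      using assms by (intro L_square polys_over_minus polys_over_mult) auto
    also have "(p - ?t * q)\<^sup>2 = p\<^sup>2 - ?t * (p * q) - ?t * (p * q) + ?t * (?t * q\<^sup>2)"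
      by (simp add: power2_eq_square algebra_simps)
    finally show ?thesis
      by (simp only: L_add L_minus L_scale) (simp add: power2_eq_square)
  qed
  show ?thesis
  proof (cases "L (q\<^sup>2) = 0")
    case True
    have "L (p * q) = 0"
    proof (rule ccontr)
      assume "L (p * q) \<noteq> 0"
      then show False
        \<comment> \<open>Without its quadratic term the expression is affine in \<open>t\<close>,
          and at this \<open>t\<close> it equals -1.\<close>
        using nonneg[of "(L (p\<^sup>2) + 1) / (2 * L (p * q))"] True by simp
    qed
    with True show ?thesis by simp
  next
    case False
    with L_square[OF assms(2)] have "0 < L (q\<^sup>2)" by simp
    then show ?thesis
      using nonneg[of "L (p * q) / L (q\<^sup>2)"] by (simp add: power2_eq_square field_simps)
  qed
qed

text \<open>A crude estimate from Cauchy-Schwarz between \<open>h\<close> and \<open>u\<close>. Its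
  constant involves \<open>L (h\<^sup>2)\<close>, but it is linear in \<open>r\<close>, and this is
  enough for limits and for rates of growth.\<close>

lemma L_mult_univariate_abs:
  assumes "h \<in> polys_over X" "i \<in> X" "u \<in> polys_over {i}" "0 \<le> r"
    and "\<And>\<omega>. \<omega> i \<in> {a i..b i} \<Longrightarrow> \<bar>poly_value u \<omega>\<bar> \<le> r"
  shows "\<bar>L (h * u)\<bar> \<le> sqrt (L (h\<^sup>2)) * r"
proof -
  have "(L (h * u))\<^sup>2 \<le> L (h\<^sup>2) * L (u\<^sup>2)"
    using assms univariate_over_X[of i u] by (intro L_cauchy_schwarz) auto
  also have "\<dots> \<le> L (h\<^sup>2) * r\<^sup>2"
    using assms by (intro mult_left_mono L_univariate_bound[of i] L_square)
  finally have "sqrt ((L (h * u))\<^sup>2) \<le> sqrt (L (h\<^sup>2) * r\<^sup>2)"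
    by (rule real_sqrt_le_mono)
  then show ?thesis using \<open>0 \<le> r\<close> by (simp add: real_sqrt_mult)
qed

text \<open>The sequence \<open>L ((s * u ^ n)\<^sup>2)\<close> is log-convex and grows at most like \<open>r\<close> to the \<open>2 * n\<close>,
  hence already its first ratio is at most the square of \<open>r\<close>.\<close>

lemma L_square_mult_univariate:
  assumes s: "s \<in> polys_over X" and i: "i \<in> X" and u: "u \<in> polys_over {i}" and "0 \<le> r"
    and r: "\<And>\<omega>. \<omega> i \<in> {a i..b i} \<Longrightarrow> \<bar>poly_value u \<omega>\<bar> \<le> r"
  shows "L ((s * u)\<^sup>2) \<le> r\<^sup>2 * L (s\<^sup>2)"
proof -
  define A where "A n = L ((s * u ^ n)\<^sup>2)" for n
  have su: "s * u ^ n \<in> polys_over X" for n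
    using s univariate_over_X[OF i u] by auto
  have "A 1 \<le> r\<^sup>2 * A 0"
  proof (rule log_convex_bound)
    fix n
    show "0 \<le> A n" unfolding A_def by (intro L_square su)
    have "(s * u ^ Suc n)\<^sup>2 = (s * u ^ n) * (s * u ^ Suc (Suc n))"
      by (simp add: power2_eq_square algebra_simps)
    then show "(A (Suc n))\<^sup>2 \<le> A n * A (Suc (Suc n))"
      unfolding A_def by (metis L_cauchy_schwarz su)
    have un: "(u ^ n)\<^sup>2 \<in> polys_over {i}" using u by auto
    \<comment> \<open>The crude estimate with \<open>h = s\<^sup>2\<close>: the constant does not
      depend on \<open>n\<close>, and only the rate of growth matters.\<close>
    have "\<bar>L (s\<^sup>2 * (u ^ n)\<^sup>2)\<bar> \<le> sqrt (L ((s\<^sup>2)\<^sup>2)) * (r\<^sup>2) ^ n"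
    proof (rule L_mult_univariate_abs[OF _ i un])
      fix \<omega> assume "\<omega> i \<in> {a i..b i}"
      then have "\<bar>poly_value u \<omega>\<bar> ^ (n * 2) \<le> r ^ (n * 2)" by (intro power_mono r) auto
      then show "\<bar>poly_value ((u ^ n)\<^sup>2) \<omega>\<bar> \<le> (r\<^sup>2) ^ n"
        by (simp add: power_abs mult.commute flip: power_mult)
    qed (use s in auto)
    then show "A n \<le> sqrt (L ((s\<^sup>2)\<^sup>2)) * (r\<^sup>2) ^ n"
      unfolding A_def by (simp add: power_mult_distrib)
  qed auto
  then show ?thesis by (simp add: A_def)
qed

lemma L_square_mult_prod:
  assumes "I \<subseteq> X" and s: "s \<in> polys_over X" and u: "\<And>i. i \<in> I \<Longrightarrow> u i \<in> polys_over {i}"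
    and c: "\<And>i. i \<in> I \<Longrightarrow> 0 \<le> c i"
      "\<And>i \<omega>. i \<in> I \<Longrightarrow> \<omega> i \<in> {a i..b i} \<Longrightarrow> \<bar>poly_value (u i) \<omega>\<bar> \<le> c i"
  shows "L ((s * (\<Prod>i\<in>I. u i))\<^sup>2) \<le> (\<Prod>i\<in>I. c i)\<^sup>2 * L (s\<^sup>2)"
proof -
  have "finite I" using \<open>I \<subseteq> X\<close> finite_X by (rule finite_subset)
  then show ?thesis using assms
  proof (induction I rule: finite_induct)
    case (insert j I)
    have "s * (\<Prod>i\<in>I. u i) \<in> polys_over X"
      using insert.prems by (intro polys_over_mult polys_over_prod) (auto intro: univariate_over_X)
    then have "L ((s * (\<Prod>i\<in>I. u i) * u j)\<^sup>2) \<le> (c j)\<^sup>2 * L ((s * (\<Prod>i\<in>I. u i))\<^sup>2)"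
      using insert.prems by (intro L_square_mult_univariate[of _ j]) auto
    also have "\<dots> \<le> (c j)\<^sup>2 * ((\<Prod>i\<in>I. c i)\<^sup>2 * L (s\<^sup>2))"
      using insert.prems by (intro mult_left_mono insert.IH) auto
    finally show ?case using insert.hyps by (simp add: power_mult_distrib mult_ac)
  qed simp
qed

text \<open>One variable at a time, \<open>B j\<close> is replaced by a square
  \<open>u\<^sup>2\<close> up to an error \<epsilon>. The square is absorbed into \<open>s\<close>,
  which is why the induction leaves \<open>s\<close> arbitrary; the error is controlled by the crude
  estimate with a cofactor independent of \<epsilon>, and \<epsilon> tends to 0.\<close>

lemma L_square_mult_prod_nonneg:
  assumes "I \<subseteq> X" and "s \<in> polys_over X" and B: "\<And>i. i \<in> I \<Longrightarrow> B i \<in> polys_over {i}"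
    and "\<And>i \<omega>. i \<in> I \<Longrightarrow> \<omega> i \<in> {a i..b i} \<Longrightarrow> 0 \<le> poly_value (B i) \<omega>"
  shows "0 \<le> L (s\<^sup>2 * (\<Prod>i\<in>I. B i))"
proof -
  have "finite I" using \<open>I \<subseteq> X\<close> finite_X by (rule finite_subset)
  then show ?thesis using assms
  proof (induction I arbitrary: s rule: finite_induct)
    case empty
    then show ?case by (simp add: L_square)
  next
    case (insert j I)
    define h where "h = s\<^sup>2 * (\<Prod>i\<in>I. B i)"
    have h: "h \<in> polys_over X"
      unfolding h_def using insert.prems by (intro polys_over_mult polys_over_prod) (auto intro: univariate_over_X)
    have j: "j \<in> X" "B j \<in> polys_over {j}" using insert.prems by auto
    have "- (sqrt (L (h\<^sup>2)) * \<epsilon>) \<le> L (h * B j)" if "0 < \<epsilon>" for \<epsilon>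
    proof -
      obtain u where u: "u \<in> polys_over {j}"
        "\<And>\<omega>. \<omega> j \<in> {a j..b j} \<Longrightarrow> \<bar>poly_value (B j - u\<^sup>2) \<omega>\<bar> \<le> \<epsilon>"
        using nonneg_univariate_approx_square[OF interval[OF j(1)] j(2) _ \<open>0 < \<epsilon>\<close>] insert.prems by blast
      have "\<bar>L (h * (B j - u\<^sup>2))\<bar> \<le> sqrt (L (h\<^sup>2)) * \<epsilon>"
        using h j u that by (intro L_mult_univariate_abs[of _ j]) auto
      moreover have "0 \<le> L ((s * u)\<^sup>2 * (\<Prod>i\<in>I. B i))"
        using insert.prems univariate_over_X[OF j(1) u(1)] by (intro insert.IH) auto
      moreover have "L (h * B j) = L (h * (B j - u\<^sup>2)) + L ((s * u)\<^sup>2 * (\<Prod>i\<in>I. B i))"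
        by (simp flip: L_add) (simp add: h_def power2_eq_square algebra_simps)
      ultimately show ?thesis by linarith
    qed
    then have "((\<lambda>\<epsilon>. - (sqrt (L (h\<^sup>2)) * \<epsilon>)) \<longlongrightarrow> 0) (at_right 0) \<Longrightarrow> 0 \<le> L (h * B j)"
      by (elim tendsto_upperbound) (auto simp: eventually_at_right_less intro!: eventually_at_rightI[of 0 1])
    moreover have "((\<lambda>\<epsilon>. - (sqrt (L (h\<^sup>2)) * \<epsilon>)) \<longlongrightarrow> 0) (at_right 0)"
      by (auto intro!: tendsto_eq_intros)
    ultimately show ?case using insert.hyps by (simp add: h_def mult_ac)
  qed
qed

text \<open>Telescoping over the variables: \<open>F n j\<close> is exchanged for its limit
  \<open>G j\<close>, which is absorbed into \<open>h\<close>. The bounds \<open>c\<close> keep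
  \<open>L\<close> of the squared remaining product bounded in \<open>n\<close>, so uniform
  convergence in the single variable \<open>j\<close> makes the error vanish.\<close>

lemma L_prod_tendsto:
  fixes F :: "nat \<Rightarrow> 'x \<Rightarrow> 'x rpoly"
  assumes "I \<subseteq> X" and "h \<in> polys_over X"
    and "\<And>n i. i \<in> I \<Longrightarrow> F n i \<in> polys_over {i}" "\<And>i. i \<in> I \<Longrightarrow> G i \<in> polys_over {i}"
    and "\<And>i. i \<in> I \<Longrightarrow> 0 \<le> c i"
      "\<And>n i \<omega>. i \<in> I \<Longrightarrow> \<omega> i \<in> {a i..b i} \<Longrightarrow> \<bar>poly_value (F n i) \<omega>\<bar> \<le> c i"
    and "\<And>i \<epsilon>. i \<in> I \<Longrightarrow> 0 < \<epsilon> \<Longrightarrow>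
      \<exists>N. \<forall>n\<ge>N. \<forall>\<omega>. \<omega> i \<in> {a i..b i} \<longrightarrow> \<bar>poly_value (F n i - G i) \<omega>\<bar> < \<epsilon>"
  shows "(\<lambda>n. L (h * (\<Prod>i\<in>I. F n i))) \<longlonglongrightarrow> L (h * (\<Prod>i\<in>I. G i))"
proof -
  have "finite I" using \<open>I \<subseteq> X\<close> finite_X by (rule finite_subset)
  then show ?thesis using assms
  proof (induction I arbitrary: h rule: finite_induct)
    case (insert j I)
    define P where "P n = h * (\<Prod>i\<in>I. F n i)" for n
    define C where "C = sqrt ((\<Prod>i\<in>I. c i)\<^sup>2 * L (h\<^sup>2))"
    have P: "P n \<in> polys_over X" for n
      unfolding P_def using insert.prems
      by (intro polys_over_mult polys_over_prod) (auto intro: univariate_over_X)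
    have PC: "sqrt (L ((P n)\<^sup>2)) \<le> C" for n
      unfolding C_def P_def using insert.prems by (intro real_sqrt_le_mono L_square_mult_prod) auto
    have "C \<ge> 0" using PC[of 0] L_square[OF P, of 0] by (meson order_trans real_sqrt_ge_zero)
    have "(\<lambda>n. L (P n * (F n j - G j))) \<longlonglongrightarrow> 0"
    proof (rule LIMSEQ_I)
      fix r :: real assume "0 < r"
      then have "0 < r / (C + 1)" using \<open>C \<ge> 0\<close> by simp
      then obtain N where N: "\<And>n \<omega>. n \<ge> N \<Longrightarrow> \<omega> j \<in> {a j..b j} \<Longrightarrow>
          \<bar>poly_value (F n j - G j) \<omega>\<bar> < r / (C + 1)"
        using insert.prems(7)[of j] by blast
      have "norm (L (P n * (F n j - G j)) - 0) < r" if "n \<ge> N" for n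
      proof -
        have "\<bar>L (P n * (F n j - G j))\<bar> \<le> sqrt (L ((P n)\<^sup>2)) * (r / (C + 1))"
          using insert.prems P N[OF that] \<open>0 < r / (C + 1)\<close>
          by (intro L_mult_univariate_abs[of _ j]) (auto intro: less_imp_le simp del: poly_value_minus)
        also have "\<dots> \<le> C * (r / (C + 1))"
          using PC \<open>0 < r / (C + 1)\<close> by (intro mult_right_mono) auto
        also have "\<dots> < r" using \<open>0 < r\<close> \<open>C \<ge> 0\<close> by (simp add: field_simps)
        finally show ?thesis by simp
      qed
      then show "\<exists>N. \<forall>n\<ge>N. norm (L (P n * (F n j - G j)) - 0) < r" by blast
    qed
    moreover have "(\<lambda>n. L (h * G j * (\<Prod>i\<in>I. F n i))) \<longlonglongrightarrow> L (h * G j * (\<Prod>i\<in>I. G i))"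
      using insert.prems univariate_over_X[of j "G j"] by (intro insert.IH) auto
    ultimately have "(\<lambda>n. L (P n * (F n j - G j)) + L (h * G j * (\<Prod>i\<in>I. F n i)))
        \<longlonglongrightarrow> 0 + L (h * G j * (\<Prod>i\<in>I. G i))"
      by (rule tendsto_add)
    moreover have "L (P n * (F n j - G j)) + L (h * G j * (\<Prod>i\<in>I. F n i))
        = L (h * (F n j * (\<Prod>i\<in>I. F n i)))" for n
      by (simp flip: L_add) (simp add: P_def algebra_simps)
    ultimately show ?case using insert.hyps by (simp add: mult_ac)
  qed simp
qed

section \<open>Discrete measures on grids in the box\<close>

definition grid_weight :: "nat \<Rightarrow> ('x \<Rightarrow> nat) \<Rightarrow> real" where
  "grid_weight n \<kappa> = L (\<Prod>i\<in>X. bernstein_basis (a i) (b i) n (\<kappa> i) i)"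

definition grid_point :: "nat \<Rightarrow> ('x \<Rightarrow> nat) \<Rightarrow> 'x \<Rightarrow> real" where
  "grid_point n \<kappa> i = a i + (b i - a i) * (real (\<kappa> i) / real n)"

lemma grid_weight_nonneg: "0 \<le> grid_weight n \<kappa>"
proof -
  have "0 \<le> L (1\<^sup>2 * (\<Prod>i\<in>X. bernstein_basis (a i) (b i) n (\<kappa> i) i))"
  proof (rule L_square_mult_prod_nonneg)
    fix i \<omega> assume "i \<in> X" "\<omega> i \<in> {a i..b i}"
    then show "0 \<le> poly_value (bernstein_basis (a i) (b i) n (\<kappa> i) i) \<omega>"
      unfolding poly_value_bernstein_basis
      using unit_coordinate_bounds[of "\<omega> i" "a i" "b i"] by (intro Bernstein_nonneg) auto
  qed (auto intro: bernstein_basis_over)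
  then show ?thesis by (simp add: grid_weight_def)
qed

lemma sum_grid_weight: "(\<Sum>\<kappa>\<in>Pi\<^sub>E X (\<lambda>_. {..n}). grid_weight n \<kappa>) = L 1"
proof -
  have "(\<Sum>\<kappa>\<in>Pi\<^sub>E X (\<lambda>_. {..n}). grid_weight n \<kappa>)
      = L (\<Prod>i\<in>X. \<Sum>k\<le>n. bernstein_basis (a i) (b i) n k i)"
    unfolding grid_weight_def L_sum[symmetric] using finite_X by (subst prod_sum_PiE) auto
  then show ?thesis by (simp add: sum_bernstein_basis)
qed

text \<open>Expanded over the grid, the product over the variables of the Bernstein approximants of
  the powers \<open>x ^ Poly_Mapping.lookup \<alpha> i\<close> has exactly this sum as its value
  under \<open>L\<close>; the product of the powers themselves is the monomial
  \<open>\<alpha>\<close>.\<close>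

lemma grid_moments_tendsto:
  assumes "Poly_Mapping.keys \<alpha> \<subseteq> X"
  shows "(\<lambda>n. \<Sum>\<kappa>\<in>Pi\<^sub>E X (\<lambda>_. {..n}). grid_weight n \<kappa> * monomial_value \<alpha> (grid_point n \<kappa>))
    \<longlonglongrightarrow> L (Poly_Mapping.single \<alpha> 1)"
proof -
  define f where "f i x = x ^ Poly_Mapping.lookup \<alpha> i" for i and x :: real
  define F where "F n i = bernstein_poly (a i) (b i) (f i) n i" for n i
  define G :: "'x \<Rightarrow> 'x rpoly" where
    "G i = Poly_Mapping.single (Poly_Mapping.single i (Poly_Mapping.lookup \<alpha> i)) 1" for i
  have f: "continuous_on {a i..b i} (f i)" for i unfolding f_def by (intro continuous_intros)
  have "\<exists>K\<ge>0. \<forall>x\<in>{a i..b i}. \<bar>f i x\<bar> \<le> K" for i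
    by (rule continuous_on_interval_bounded[OF f]) blast
  then obtain c where c: "\<And>i. 0 \<le> c i" "\<And>i x. x \<in> {a i..b i} \<Longrightarrow> \<bar>f i x\<bar> \<le> c i" by metis
  have "(\<lambda>n. L (1 * (\<Prod>i\<in>X. F n i))) \<longlonglongrightarrow> L (1 * (\<Prod>i\<in>X. G i))"
  proof (rule L_prod_tendsto[where c = c])
    fix i n and \<omega> :: "'x \<Rightarrow> real" assume i: "i \<in> X" and "\<omega> i \<in> {a i..b i}"
    then show "\<bar>poly_value (F n i) \<omega>\<bar> \<le> c i"
      unfolding F_def using c interval by (intro bernstein_poly_bounded) auto
  next
    fix i and \<epsilon> :: real assume "i \<in> X" "0 < \<epsilon>"
    then show "\<exists>N. \<forall>n\<ge>N. \<forall>\<omega>. \<omega> i \<in> {a i..b i} \<longrightarrow> \<bar>poly_value (F n i - G i) \<omega>\<bar> < \<epsilon>"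
      using bernstein_poly_converges[OF interval f, of i \<epsilon> i]
      by (simp add: F_def G_def f_def)
  qed (auto simp: F_def G_def c intro: bernstein_poly_over)
  moreover have "L (1 * (\<Prod>i\<in>X. F n i))
      = (\<Sum>\<kappa>\<in>Pi\<^sub>E X (\<lambda>_. {..n}). grid_weight n \<kappa> * monomial_value \<alpha> (grid_point n \<kappa>))" for n
  proof -
    have const: "(\<Prod>i\<in>A. Poly_Mapping.single 0 (r i)) = (Poly_Mapping.single 0 (\<Prod>i\<in>A. r i) :: 'x rpoly)"
      for A and r :: "'x \<Rightarrow> real"
      by (induction A rule: infinite_finite_induct) (auto simp: mult_single)
    have "L (1 * (\<Prod>i\<in>X. F n i)) = (\<Sum>\<kappa>\<in>Pi\<^sub>E X (\<lambda>_. {..n}).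
        L (\<Prod>i\<in>X. Poly_Mapping.single 0 (f i (grid_point n \<kappa> i)) * bernstein_basis (a i) (b i) n (\<kappa> i) i))"
      unfolding F_def bernstein_poly_def grid_point_def using finite_X
      by (subst prod_sum_PiE) (auto simp: L_sum)
    also have "\<dots> = (\<Sum>\<kappa>\<in>Pi\<^sub>E X (\<lambda>_. {..n}). monomial_value \<alpha> (grid_point n \<kappa>) * grid_weight n \<kappa>)"
      by (simp add: prod.distrib const L_scale grid_weight_def f_def
          monomial_value_superset[OF finite_X assms])
    finally show ?thesis by (simp only: mult.commute)
  qed
  moreover have "(\<Prod>i\<in>X. G i) = Poly_Mapping.single \<alpha> 1"
  proof -
    have "(\<Prod>i\<in>A. G i) = Poly_Mapping.single (\<Sum>i\<in>A. Poly_Mapping.single i (Poly_Mapping.lookup \<alpha> i)) 1" for A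
      by (induction A rule: infinite_finite_induct) (auto simp: G_def mult_single)
    moreover have "(\<Sum>i\<in>X. Poly_Mapping.single i (Poly_Mapping.lookup \<alpha> i)) = \<alpha>"
      using assms finite_X
      by (intro poly_mapping_eqI) (auto simp: lookup_sum lookup_single when_def in_keys_iff)
    ultimately show ?thesis by simp
  qed
  ultimately show ?thesis by simp
qed

end

section \<open>Representing measures\<close>

lemma space_box: "space (PiM U (interval_outcomes a b)) = (\<Pi>\<^sub>E i\<in>U. {a i..b i})"
  by (auto simp: space_PiM interval_outcomes_def space_restrict_space PiE_iff)

lemma measurable_coordinate:
  "i \<in> U \<Longrightarrow> (\<lambda>\<omega>. \<omega> i) \<in> borel_measurable (PiM U (interval_outcomes a b))"
  using measurable_component_singleton[of i U "interval_outcomes a b"]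
  by (auto simp: interval_outcomes_def measurable_restrict_space2_iff)

lemma measurable_poly_value:
  "p \<in> polys_over U \<Longrightarrow> poly_value p \<in> borel_measurable (PiM U (interval_outcomes a b))"
  unfolding poly_value_def monomial_value_def polys_over_def
  by (intro borel_measurable_sum borel_measurable_times borel_measurable_prod borel_measurable_power
      borel_measurable_const measurable_coordinate) auto

lemma poly_value_bounded:
  assumes "p \<in> polys_over U"
  obtains K where "0 \<le> K" "\<And>\<omega>. \<omega> \<in> space (PiM U (interval_outcomes a b)) \<Longrightarrow> \<bar>poly_value p \<omega>\<bar> \<le> K"
proof -
  have "\<exists>K\<ge>0. \<forall>\<omega>\<in>space (PiM U (interval_outcomes a b)). \<bar>poly_value p \<omega>\<bar> \<le> K"
    using assms
  proof (induction p rule: polys_over_induct)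
    case (single \<alpha> c)
    let ?K = "\<bar>c\<bar> * (\<Prod>i\<in>Poly_Mapping.keys \<alpha>. max \<bar>a i\<bar> \<bar>b i\<bar> ^ Poly_Mapping.lookup \<alpha> i)"
    have "\<bar>poly_value (Poly_Mapping.single \<alpha> c) \<omega>\<bar> \<le> ?K"
      if "\<omega> \<in> space (PiM U (interval_outcomes a b))" for \<omega>
    proof -
      have "\<bar>\<omega> i\<bar> \<le> max \<bar>a i\<bar> \<bar>b i\<bar>" if "i \<in> Poly_Mapping.keys \<alpha>" for i
      proof -
        have "\<omega> i \<in> {a i..b i}"
          using that single \<open>\<omega> \<in> _\<close> by (auto simp: space_box)
        then show ?thesis by auto
      qed
      then have "(\<Prod>i\<in>Poly_Mapping.keys \<alpha>. \<bar>\<omega> i\<bar> ^ Poly_Mapping.lookup \<alpha> i)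
          \<le> (\<Prod>i\<in>Poly_Mapping.keys \<alpha>. max \<bar>a i\<bar> \<bar>b i\<bar> ^ Poly_Mapping.lookup \<alpha> i)"
        by (intro prod_mono) (auto intro!: power_mono)
      then show ?thesis
        by (simp add: monomial_value_def abs_mult abs_prod power_abs mult_left_mono)
    qed
    moreover have "0 \<le> ?K" by (intro mult_nonneg_nonneg prod_nonneg) auto
    ultimately show ?case by blast
  next
    case (plus p q)
    then obtain K K' where "0 \<le> K" "0 \<le> K'"
      "\<forall>\<omega>\<in>space (PiM U (interval_outcomes a b)). \<bar>poly_value p \<omega>\<bar> \<le> K"
      "\<forall>\<omega>\<in>space (PiM U (interval_outcomes a b)). \<bar>poly_value q \<omega>\<bar> \<le> K'" by blast
    then show ?case by (intro exI[of _ "K + K'"]) (fastforce intro: order_trans[OF abs_triangle_ineq])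
  qed
  then show ?thesis using that by blast
qed

lemma integrable_poly_value:
  assumes "finite_measure \<mu>" and sets: "sets \<mu> = sets (PiM U (interval_outcomes a b))"
    and p: "p \<in> polys_over U"
  shows "integrable \<mu> (poly_value p)"
proof -
  interpret finite_measure \<mu> by fact
  obtain K where K: "\<And>\<omega>. \<omega> \<in> space (PiM U (interval_outcomes a b)) \<Longrightarrow> \<bar>poly_value p \<omega>\<bar> \<le> K"
    using poly_value_bounded[OF p] by blast
  show ?thesis
  proof (rule integrable_const_bound[of _ K])
    show "AE \<omega> in \<mu>. norm (poly_value p \<omega>) \<le> K"
      using K sets_eq_imp_space_eq[OF sets] by (intro AE_I2) auto
    show "poly_value p \<in> borel_measurable \<mu>"
      using measurable_poly_value[OF p] measurable_cong_sets[OF sets refl] by blast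
  qed
qed

text \<open>Settles the degenerate case in which the grid weights cannot be normalised to
  probabilities: the zero measure then represents \<open>L\<close>.\<close>

lemma (in box_functional) L_eq_0:
  assumes "L 1 = 0" "p \<in> polys_over X"
  shows "L p = 0"
  using L_cauchy_schwarz[of 1 p] assms by simp

text \<open>The grid masses are moved to preimages of the grid points under the curve, all in
  [0, 1], which makes tightness immediate. A monomial along the curve is bounded and continuous on
  the line, so its integrals pass to the weak limit. The image of that limit under the curve, scaled
  by \<open>L 1\<close>, has the required moments.\<close>

lemma (in box_functional) representing_measure:
  "\<exists>\<mu>. sets \<mu> = sets (PiM X (interval_outcomes a b)) \<and> finite_measure \<mu> \<and>
     (\<forall>p\<in>polys_over X. (\<integral>\<omega>. poly_value p \<omega> \<partial>\<mu>) = L p)"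
proof (cases "L 1 = 0")
  case True
  then show ?thesis
    using L_eq_0 by (intro exI[of _ "null_measure (PiM X (interval_outcomes a b))"])
      (auto intro!: finite_measureI)
next
  case False
  with L_square[of 1] have L1: "0 < L 1" by simp
  define d where "d = card X"
  obtain idx where idx: "bij_betw idx X {0..<d}"
    using ex_bij_betw_finite_nat[OF finite_X] by (auto simp: d_def)
  \<comment> \<open>Defined for every real \<open>t\<close> and always inside the box, so the
    support of the weak limit need not be located.\<close>
  define curve where "curve t i = a i + (b i - a i) * schoenberg d (idx i) t" for t i
  have curve_cont: "continuous_on UNIV (\<lambda>t. curve t i)" for i
    unfolding curve_def by (intro continuous_intros continuous_schoenberg)
  have curve_in: "curve t i \<in> {a i..b i}" if "i \<in> X" for t i
    unfolding curve_def using interval[OF that] schoenberg_bounds by (intro affine_in_interval) auto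
  define G where "G n = Pi\<^sub>E X (\<lambda>_. {..n::nat})" for n
  have finite_G: "finite (G n)" for n unfolding G_def using finite_X by (intro finite_PiE) auto
  have "\<exists>t. 0 \<le> t \<and> t \<le> 1 \<and> (\<forall>i\<in>X. curve t i = grid_point n \<kappa> i)" if "\<kappa> \<in> G n" for n \<kappa>
  proof -
    define x where "x j = real (\<kappa> (inv_into X idx j)) / real n" for j
    have "inv_into X idx j \<in> X" if "j < d" for j
      using that idx by (auto simp: bij_betw_def intro!: inv_into_into)
    then have "0 \<le> x j \<and> x j \<le> 1" if "j < d" for j
      using that \<open>\<kappa> \<in> G n\<close> by (auto simp: x_def G_def PiE_iff divide_simps)
    then obtain t where t: "0 \<le> t" "t \<le> 1" "\<And>j. j < d \<Longrightarrow> schoenberg d j t = x j"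
      using schoenberg_surj[of d x] by metis
    have "curve t i = grid_point n \<kappa> i" if "i \<in> X" for i
    proof -
      have "idx i < d" using idx that by (auto simp: bij_betw_def)
      moreover have "inv_into X idx (idx i) = i"
        using idx that by (auto simp: bij_betw_def)
      ultimately show ?thesis by (simp add: curve_def grid_point_def t x_def)
    qed
    with t show ?thesis by blast
  qed
  then have "\<forall>n \<kappa>. \<exists>t. \<kappa> \<in> G n \<longrightarrow> 0 \<le> t \<and> t \<le> 1 \<and> (\<forall>i\<in>X. curve t i = grid_point n \<kappa> i)"
    by blast
  then obtain \<tau> where
    "\<forall>n \<kappa>. \<kappa> \<in> G n \<longrightarrow> 0 \<le> \<tau> n \<kappa> \<and> \<tau> n \<kappa> \<le> 1 \<and> (\<forall>i\<in>X. curve (\<tau> n \<kappa>) i = grid_point n \<kappa> i)"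
    unfolding choice_iff by blast
  then have \<tau>: "\<And>n \<kappa>. \<kappa> \<in> G n \<Longrightarrow> 0 \<le> \<tau> n \<kappa> \<and> \<tau> n \<kappa> \<le> 1"
    "\<And>n \<kappa> i. \<kappa> \<in> G n \<Longrightarrow> i \<in> X \<Longrightarrow> curve (\<tau> n \<kappa>) i = grid_point n \<kappa> i" by blast+
  define P where "P n = point_measure (G n) (\<lambda>\<kappa>. ennreal (grid_weight n \<kappa> / L 1))" for n
  have P_prob: "prob_space (P n)" for n
  proof (rule prob_spaceI)
    have "emeasure (P n) (space (P n)) = (\<Sum>\<kappa>\<in>G n. ennreal (grid_weight n \<kappa> / L 1))"
      unfolding P_def by (simp add: space_point_measure emeasure_point_measure_finite finite_G)
    also have "\<dots> = ennreal ((\<Sum>\<kappa>\<in>G n. grid_weight n \<kappa>) / L 1)"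
      using L1 grid_weight_nonneg by (subst sum_ennreal) (auto simp: sum_divide_distrib)
    also have "\<dots> = 1" using L1 by (simp add: G_def sum_grid_weight)
    finally show "emeasure (P n) (space (P n)) = 1" .
  qed
  have \<tau>_meas [measurable]: "\<tau> n \<in> borel_measurable (P n)" for n
    by (simp add: P_def)
  define \<nu> where "\<nu> n = distr (P n) borel (\<tau> n)" for n
  have \<nu>: "real_distribution (\<nu> n)" for n
    unfolding \<nu>_def by (intro prob_space.real_distribution_distr P_prob \<tau>_meas)
  have "tight \<nu>"
    unfolding tight_def
  proof (intro conjI allI impI \<nu>)
    fix \<epsilon> :: real assume "0 < \<epsilon>"
    \<comment> \<open>Tightness is phrased with half-open intervals; this one contains
      [0, 1].\<close>
    have "measure (\<nu> n) {-1<..1} = 1" for n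
    proof -
      interpret prob_space "P n" by (rule P_prob)
      have "\<tau> n -` {-1<..1} \<inter> space (P n) = space (P n)"
        using \<tau>(1) by (force simp: P_def space_point_measure)
      then show ?thesis unfolding \<nu>_def by (subst measure_distr) (auto simp: prob_space)
    qed
    with \<open>0 < \<epsilon>\<close> show "\<exists>a b. a < b \<and> (\<forall>n. 1 - \<epsilon> < measure (\<nu> n) {a<..b})"
      by (intro exI[of _ "-1"] exI[of _ 1]) auto
  qed
  then obtain r N where "strict_mono (r :: nat \<Rightarrow> nat)" and N: "real_distribution N"
    and weak: "weak_conv_m (\<nu> \<circ> id \<circ> r) N"
    using tight_imp_convergent_subsubsequence[of \<nu> id] by (auto simp: strict_mono_def)
  interpret N: real_distribution N by (rule N)
  have moment: "(\<integral>t. monomial_value \<alpha> (curve t) \<partial>N) = L (Poly_Mapping.single \<alpha> 1) / L 1"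
    if \<alpha>: "Poly_Mapping.keys \<alpha> \<subseteq> X" for \<alpha>
  proof -
    let ?f = "\<lambda>t. monomial_value \<alpha> (curve t)"
    have cont: "continuous_on UNIV ?f"
      unfolding monomial_value_def by (intro continuous_intros curve_cont)
    obtain K where K: "\<And>\<omega>. \<omega> \<in> space (PiM X (interval_outcomes a b)) \<Longrightarrow>
        \<bar>poly_value (Poly_Mapping.single \<alpha> 1) \<omega>\<bar> \<le> K"
      by (rule poly_value_bounded[of "Poly_Mapping.single \<alpha> 1" X a b]) (use \<alpha> in auto)
    have bound: "norm (?f t) \<le> K" for t
    proof -
      have "restrict (curve t) X \<in> space (PiM X (interval_outcomes a b))"
        using curve_in by (auto simp: space_box)
      moreover have "monomial_value \<alpha> (restrict (curve t) X) = ?f t"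
        using \<alpha> by (intro monomial_value_cong) auto
      ultimately show ?thesis using K[of "restrict (curve t) X"] by simp
    qed
    have "(\<lambda>n. \<integral>t. ?f t \<partial>(\<nu> (r n))) \<longlonglongrightarrow> (\<integral>t. ?f t \<partial>N)"
      using weak cont bound
      by (intro weak_conv_imp_integral_bdd_continuous_conv \<nu> N)
         (auto simp: continuous_on_eq_continuous_at \<nu> comp_def)
    moreover have "(\<integral>t. ?f t \<partial>(\<nu> n)) = (\<Sum>\<kappa>\<in>G n. grid_weight n \<kappa> * monomial_value \<alpha> (grid_point n \<kappa>)) / L 1" for n
    proof -
      have "(\<integral>t. ?f t \<partial>(\<nu> n)) = (\<integral>\<kappa>. ?f (\<tau> n \<kappa>) \<partial>(P n))"
        unfolding \<nu>_def using cont by (intro integral_distr borel_measurable_continuous_onI) auto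
      also have "\<dots> = (\<Sum>\<kappa>\<in>G n. grid_weight n \<kappa> / L 1 * ?f (\<tau> n \<kappa>))"
        unfolding P_def using finite_G grid_weight_nonneg L1
        by (subst lebesgue_integral_point_measure_finite) auto
      also have "\<dots> = (\<Sum>\<kappa>\<in>G n. grid_weight n \<kappa> / L 1 * monomial_value \<alpha> (grid_point n \<kappa>))"
        using \<tau>(2) \<alpha>
        by (intro sum.cong refl arg_cong2[where f = "(*)"] monomial_value_cong) auto
      finally show ?thesis by (simp add: sum_divide_distrib)
    qed
    moreover have "((\<lambda>n. (\<Sum>\<kappa>\<in>G n. grid_weight n \<kappa> * monomial_value \<alpha> (grid_point n \<kappa>)) / L 1) \<circ> r)
        \<longlonglongrightarrow> L (Poly_Mapping.single \<alpha> 1) / L 1"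
      unfolding G_def using L1
      by (intro LIMSEQ_subseq_LIMSEQ tendsto_divide grid_moments_tendsto \<alpha> tendsto_const \<open>strict_mono r\<close>) auto
    ultimately show ?thesis by (auto intro: LIMSEQ_unique simp: comp_def)
  qed
  let ?O = "PiM X (interval_outcomes a b)"
  have curve_meas [measurable]: "(\<lambda>t. restrict (curve t) X) \<in> measurable N ?O"
    using curve_in borel_measurable_continuous_onI[OF curve_cont]
    by (intro measurable_restrict) (auto simp: interval_outcomes_def intro!: measurable_restrict_space2)
  define \<mu> where "\<mu> = density (distr N ?O (\<lambda>t. restrict (curve t) X)) (\<lambda>_. ennreal (L 1))"
  have sets: "sets \<mu> = sets ?O" by (simp add: \<mu>_def)
  have fin: "finite_measure \<mu>"
  proof (rule finite_measureI)
    interpret D: prob_space "distr N ?O (\<lambda>t. restrict (curve t) X)"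
      by (rule N.prob_space_distr) measurable
    show "emeasure \<mu> (space \<mu>) \<noteq> \<infinity>"
      unfolding \<mu>_def space_density
      by (subst emeasure_density_const) (auto simp: D.emeasure_space_1 D.emeasure_eq_measure ennreal_mult_eq_top_iff)
  qed
  have "(\<integral>\<omega>. poly_value p \<omega> \<partial>\<mu>) = L p" if "p \<in> polys_over X" for p
  proof -
    \<comment> \<open>Membership is carried through the induction because the additive step needs
      both summands to be integrable.\<close>
    have "(\<integral>\<omega>. poly_value p \<omega> \<partial>\<mu>) = L p \<and> p \<in> polys_over X"
      using that
    proof (induction p rule: polys_over_induct)
      case (single \<alpha> c)
      have over: "Poly_Mapping.single \<alpha> c \<in> polys_over X" using single by simp
      have "(\<integral>\<omega>. poly_value (Poly_Mapping.single \<alpha> c) \<omega> \<partial>\<mu>)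
          = L 1 * (\<integral>t. poly_value (Poly_Mapping.single \<alpha> c) (restrict (curve t) X) \<partial>N)"
        unfolding \<mu>_def using L1 measurable_poly_value[OF over, of a b]
          integral_distr[OF curve_meas measurable_poly_value[OF over]]
        by (subst integral_density) (auto simp del: poly_value_single)
      also have "\<dots> = L 1 * (\<integral>t. c * monomial_value \<alpha> (curve t) \<partial>N)"
        using single
        by (intro arg_cong2[where f = "(*)"] Bochner_Integration.integral_cong refl)
           (auto intro!: monomial_value_cong)
      also have "\<dots> = c * L (Poly_Mapping.single \<alpha> 1)"
        using L1 moment[OF single] by simp
      also have "\<dots> = L (Poly_Mapping.single \<alpha> c)"
        using L_scale[of c "Poly_Mapping.single \<alpha> 1"] by (simp add: mult_single)
      finally show ?case using over by simp
    next
      case (plus p q)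
      then show ?case
        using integrable_poly_value[OF fin sets] by (auto simp: L_add)
    qed
    then show ?thesis ..
  qed
  with sets fin show ?thesis by blast
qed

section \<open>Comparison of measures through squares of polynomials\<close>

text \<open>Uniform limits of polynomials on the box. Uniformity makes an approximation valid for
  every finite measure at once, and the range [0, 1] keeps products and squares under
  control.\<close>

definition uniform_unit_limits :: "'x set \<Rightarrow> ('x \<Rightarrow> real) \<Rightarrow> ('x \<Rightarrow> real) \<Rightarrow> (('x \<Rightarrow> real) \<Rightarrow> real) set" where
  "uniform_unit_limits U a b = {f \<in> borel_measurable (PiM U (interval_outcomes a b)).
     (\<forall>\<omega>\<in>space (PiM U (interval_outcomes a b)). f \<omega> \<in> {0..1}) \<and>
     (\<forall>\<delta>>0. \<exists>p\<in>polys_over U. \<forall>\<omega>\<in>space (PiM U (interval_outcomes a b)). \<bar>f \<omega> - poly_value p \<omega>\<bar> \<le> \<delta>)}"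

lemma uniform_unit_limits_approx:
  assumes "f \<in> uniform_unit_limits U a b" "0 < \<delta>"
  shows "\<exists>p\<in>polys_over U. \<forall>\<omega>\<in>space (PiM U (interval_outcomes a b)). \<bar>f \<omega> - poly_value p \<omega>\<bar> \<le> \<delta>"
  using assms by (simp add: uniform_unit_limits_def)

lemma uniform_unit_limits_compl:
  assumes "f \<in> uniform_unit_limits U a b"
  shows "(\<lambda>\<omega>. 1 - f \<omega>) \<in> uniform_unit_limits U a b"
proof -
  have "\<exists>p\<in>polys_over U. \<forall>\<omega>\<in>space (PiM U (interval_outcomes a b)). \<bar>1 - f \<omega> - poly_value p \<omega>\<bar> \<le> \<delta>"
    if \<delta>: "0 < \<delta>" for \<delta>
  proof -
    obtain p where "p \<in> polys_over U"
      "\<forall>\<omega>\<in>space (PiM U (interval_outcomes a b)). \<bar>f \<omega> - poly_value p \<omega>\<bar> \<le> \<delta>"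
      using uniform_unit_limits_approx[OF assms \<delta>] by blast
    moreover have "\<bar>1 - f \<omega> - poly_value (1 - p) \<omega>\<bar> = \<bar>f \<omega> - poly_value p \<omega>\<bar>" for \<omega>
      by simp
    ultimately show ?thesis by (intro bexI[of _ "1 - p"]) (auto simp del: poly_value_minus)
  qed
  with assms show ?thesis unfolding uniform_unit_limits_def by auto
qed

lemma uniform_unit_limits_mult:
  assumes f: "f \<in> uniform_unit_limits U a b" and g: "g \<in> uniform_unit_limits U a b"
  shows "(\<lambda>\<omega>. f \<omega> * g \<omega>) \<in> uniform_unit_limits U a b"
proof -
  let ?S = "space (PiM U (interval_outcomes a b))"
  have "\<exists>p\<in>polys_over U. \<forall>\<omega>\<in>?S. \<bar>f \<omega> * g \<omega> - poly_value p \<omega>\<bar> \<le> \<delta>" if "0 < \<delta>" for \<delta>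
  proof -
    \<comment> \<open>The error of the product is at most \<open>\<eta> + 2 * \<eta>\<close>: since
      \<open>\<eta> \<le> 1\<close>, the polynomial near \<open>f\<close> is bounded by 2.\<close>
    define \<eta> where "\<eta> = min 1 (\<delta> / 3)"
    have \<eta>: "0 < \<eta>" "\<eta> \<le> 1" "3 * \<eta> \<le> \<delta>" using that by (auto simp: \<eta>_def)
    obtain p where p: "p \<in> polys_over U" "\<forall>\<omega>\<in>?S. \<bar>f \<omega> - poly_value p \<omega>\<bar> \<le> \<eta>"
      using uniform_unit_limits_approx[OF f \<eta>(1)] by blast
    obtain q where q: "q \<in> polys_over U" "\<forall>\<omega>\<in>?S. \<bar>g \<omega> - poly_value q \<omega>\<bar> \<le> \<eta>"
      using uniform_unit_limits_approx[OF g \<eta>(1)] by blast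
    have "\<bar>f \<omega> * g \<omega> - poly_value (p * q) \<omega>\<bar> \<le> \<delta>" if \<omega>: "\<omega> \<in> ?S" for \<omega>
    proof -
      let ?p = "poly_value p \<omega>" and ?q = "poly_value q \<omega>"
      have fg: "0 \<le> f \<omega>" "f \<omega> \<le> 1" "0 \<le> g \<omega>" "g \<omega> \<le> 1"
        using f g \<omega> unfolding uniform_unit_limits_def by auto
      have "\<bar>f \<omega> * g \<omega> - ?p * ?q\<bar> = \<bar>(f \<omega> - ?p) * g \<omega> + ?p * (g \<omega> - ?q)\<bar>"
        by (simp add: algebra_simps)
      also have "\<dots> \<le> \<bar>f \<omega> - ?p\<bar> * \<bar>g \<omega>\<bar> + \<bar>?p\<bar> * \<bar>g \<omega> - ?q\<bar>"
        by (rule order_trans[OF abs_triangle_ineq]) (simp add: abs_mult)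
      also have "\<dots> \<le> \<eta> * 1 + 2 * \<eta>"
        using p(2)[rule_format, OF \<omega>] q(2)[rule_format, OF \<omega>] fg \<eta> by (intro add_mono mult_mono) auto
      finally show ?thesis using \<eta> by simp
    qed
    with p q show ?thesis by blast
  qed
  with f g show ?thesis unfolding uniform_unit_limits_def by (auto simp: mult_le_one)
qed

lemma uniform_unit_limits_coordinate:
  assumes i: "i \<in> U" and "a i \<le> b i" and h: "continuous_on UNIV h" "\<And>x. h x \<in> {0..1}"
  shows "(\<lambda>\<omega>. h (\<omega> i)) \<in> uniform_unit_limits U a b"
proof -
  let ?S = "space (PiM U (interval_outcomes a b))"
  have "\<exists>p\<in>polys_over U. \<forall>\<omega>\<in>?S. \<bar>h (\<omega> i) - poly_value p \<omega>\<bar> \<le> \<delta>" if \<delta>: "0 < \<delta>" for \<delta>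
  proof -
    obtain n where "\<forall>k\<ge>n. \<forall>\<omega>. \<omega> i \<in> {a i..b i} \<longrightarrow>
        \<bar>poly_value (bernstein_poly (a i) (b i) h k i) \<omega> - h (\<omega> i)\<bar> < \<delta>"
      using bernstein_poly_converges[OF \<open>a i \<le> b i\<close> continuous_on_subset[OF h(1) subset_UNIV] \<delta>, of i] ..
    from this[rule_format, OF order_refl] have n: "\<omega> i \<in> {a i..b i} \<Longrightarrow>
        \<bar>poly_value (bernstein_poly (a i) (b i) h n i) \<omega> - h (\<omega> i)\<bar> < \<delta>" for \<omega> .
    have "bernstein_poly (a i) (b i) h n i \<in> polys_over U"
      using i by (intro subsetD[OF polys_over_mono bernstein_poly_over]) auto
    moreover have "\<bar>h (\<omega> i) - poly_value (bernstein_poly (a i) (b i) h n i) \<omega>\<bar> \<le> \<delta>" if "\<omega> \<in> ?S" for \<omega>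
    proof -
      have "\<omega> i \<in> {a i..b i}" using that i by (simp add: space_box PiE_iff)
      from n[of \<omega>, OF this] show ?thesis by linarith
    qed
    ultimately show ?thesis by blast
  qed
  moreover have "(\<lambda>\<omega>. h (\<omega> i)) \<in> borel_measurable (PiM U (interval_outcomes a b))"
    using measurable_compose[OF measurable_coordinate[OF i] borel_measurable_continuous_onI[OF h(1)]] .
  ultimately show ?thesis using h(2) unfolding uniform_unit_limits_def by auto
qed

section \<open>Approximation of indicators in the mean\<close>

locale finite_box_measure = finite_measure \<mu> for \<mu> :: "('x \<Rightarrow> real) measure" +
  fixes U :: "'x set" and a b :: "'x \<Rightarrow> real"
  assumes sets_box: "sets \<mu> = sets (PiM U (interval_outcomes a b))"
begin

lemma space_eq: "space \<mu> = space (PiM U (interval_outcomes a b))"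
  by (rule sets_eq_imp_space_eq[OF sets_box])

lemma unit_limit_measurable:
  "f \<in> uniform_unit_limits U a b \<Longrightarrow> f \<in> borel_measurable \<mu>"
  unfolding uniform_unit_limits_def using measurable_cong_sets[OF sets_box refl] by blast

lemma unit_limit_range: "f \<in> uniform_unit_limits U a b \<Longrightarrow> \<omega> \<in> space \<mu> \<Longrightarrow> 0 \<le> f \<omega> \<and> f \<omega> \<le> 1"
  unfolding uniform_unit_limits_def by (auto simp: space_eq)

definition distance :: "('x \<Rightarrow> real) set \<Rightarrow> (('x \<Rightarrow> real) \<Rightarrow> real) \<Rightarrow> real" where
  "distance A f = (\<integral>\<omega>. \<bar>indicator A \<omega> - f \<omega>\<bar> \<partial>\<mu>)"

lemma integrable_distance:
  assumes "A \<in> sets \<mu>" "f \<in> uniform_unit_limits U a b"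
  shows "integrable \<mu> (\<lambda>\<omega>. \<bar>indicator A \<omega> - f \<omega>\<bar>)"
  using unit_limit_range[OF assms(2)] unit_limit_measurable[OF assms(2)] assms(1)
  by (intro integrable_const_bound[of _ 1] AE_I2) (auto simp: indicator_def)

lemma distance_compl:
  "distance (space \<mu> - A) (\<lambda>\<omega>. 1 - f \<omega>) = distance A f"
  unfolding distance_def by (intro Bochner_Integration.integral_cong) (auto simp: indicator_def)

lemma distance_Int:
  assumes "A \<in> sets \<mu>" "B \<in> sets \<mu>" "f \<in> uniform_unit_limits U a b" "g \<in> uniform_unit_limits U a b"
  shows "distance (A \<inter> B) (\<lambda>\<omega>. f \<omega> * g \<omega>) \<le> distance A f + distance B g"
proof -
  have "distance (A \<inter> B) (\<lambda>\<omega>. f \<omega> * g \<omega>)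
      \<le> (\<integral>\<omega>. \<bar>indicator A \<omega> - f \<omega>\<bar> + \<bar>indicator B \<omega> - g \<omega>\<bar> \<partial>\<mu>)"
    unfolding distance_def
  proof (rule integral_mono)
    fix \<omega> assume \<omega>: "\<omega> \<in> space \<mu>"
    let ?A = "indicator A \<omega> :: real" and ?B = "indicator B \<omega> :: real"
    have "?A * ?B - f \<omega> * g \<omega> = (?A - f \<omega>) * ?B + f \<omega> * (?B - g \<omega>)"
      by (simp add: algebra_simps)
    also have "\<bar>\<dots>\<bar> \<le> \<bar>?A - f \<omega>\<bar> * \<bar>?B\<bar> + \<bar>f \<omega>\<bar> * \<bar>?B - g \<omega>\<bar>"
      by (rule order_trans[OF abs_triangle_ineq]) (simp add: abs_mult)
    also have "\<dots> \<le> \<bar>?A - f \<omega>\<bar> * 1 + 1 * \<bar>?B - g \<omega>\<bar>"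
      using unit_limit_range[OF assms(3) \<omega>] by (intro add_mono mult_mono) (auto simp: indicator_def)
    finally show "\<bar>indicator (A \<inter> B) \<omega> - f \<omega> * g \<omega>\<bar> \<le> \<bar>?A - f \<omega>\<bar> + \<bar>?B - g \<omega>\<bar>"
      by (simp add: indicator_inter_arith)
  qed (use assms in \<open>auto intro!: integrable_distance uniform_unit_limits_mult\<close>)
  also have "\<dots> = distance A f + distance B g"
    unfolding distance_def using assms by (intro Bochner_Integration.integral_add integrable_distance)
  finally show ?thesis .
qed

text \<open>Pointwise, the indicators of \<open>A\<close> and \<open>B\<close> differ by the
  indicator of \<open>B - A\<close>.\<close>

lemma distance_superset:
  assumes "A \<in> sets \<mu>" "B \<in> sets \<mu>" "A \<subseteq> B" "f \<in> uniform_unit_limits U a b"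
  shows "distance B f \<le> measure \<mu> B - measure \<mu> A + distance A f"
proof -
  have diff: "integrable \<mu> (indicator (B - A) :: _ \<Rightarrow> real)"
    using assms by (simp add: emeasure_eq_measure)
  have "distance B f \<le> (\<integral>\<omega>. indicator (B - A) \<omega> + \<bar>indicator A \<omega> - f \<omega>\<bar> \<partial>\<mu>)"
    unfolding distance_def using assms
    by (intro integral_mono integrable_distance Bochner_Integration.integrable_add diff)
       (auto simp: indicator_def)
  also have "\<dots> = measure \<mu> (B - A) + distance A f"
    unfolding distance_def using assms
    by (subst Bochner_Integration.integral_add[OF diff]) (auto intro!: integrable_distance)
  also have "measure \<mu> (B - A) = measure \<mu> B - measure \<mu> A"
    using assms by (intro finite_measure_Diff) auto
  finally show ?thesis .
qed

text \<open>The functions \<open>max 0 (1 - n * infdist x A)\<close> converge pointwise to the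
  indicator of a closed set, and dominated convergence applies. \<open>A\<close> is nonempty because
  \<open>infdist\<close> to the empty set is 0 by convention, which would give the constant
  1.\<close>

lemma distance_closed_coordinate:
  assumes i: "i \<in> U" and "a i \<le> b i" and A: "closed A" "A \<noteq> {}"
  shows "(\<lambda>n. distance {\<omega>\<in>space \<mu>. \<omega> i \<in> A} (\<lambda>\<omega>. max 0 (1 - real n * infdist (\<omega> i) A))) \<longlonglongrightarrow> 0"
proof -
  have [measurable]: "(\<lambda>\<omega>. \<omega> i) \<in> borel_measurable \<mu>"
    using measurable_coordinate[OF i] measurable_cong_sets[OF sets_box refl] by blast
  have [measurable]: "A \<in> sets borel" using A(1) by (rule borel_closed)
  have [measurable]: "(\<lambda>x. infdist x A) \<in> borel_measurable borel"
    by (intro borel_measurable_continuous_onI continuous_intros)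
  have "(\<lambda>n. distance {\<omega>\<in>space \<mu>. \<omega> i \<in> A} (\<lambda>\<omega>. max 0 (1 - real n * infdist (\<omega> i) A)))
      \<longlonglongrightarrow> (\<integral>\<omega>. 0 \<partial>\<mu>)"
    unfolding distance_def
  proof (rule integral_dominated_convergence[where w = "\<lambda>_. 1"])
    show "AE \<omega> in \<mu>. (\<lambda>n. \<bar>indicator {\<omega>\<in>space \<mu>. \<omega> i \<in> A} \<omega> - max 0 (1 - real n * infdist (\<omega> i) A)\<bar>) \<longlonglongrightarrow> 0"
    proof (intro AE_I2)
      fix \<omega> assume \<omega>: "\<omega> \<in> space \<mu>"
      show "(\<lambda>n. \<bar>indicator {\<omega>\<in>space \<mu>. \<omega> i \<in> A} \<omega> - max 0 (1 - real n * infdist (\<omega> i) A)\<bar>) \<longlonglongrightarrow> 0"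
      proof (cases "\<omega> i \<in> A")
        case True
        with \<omega> show ?thesis by simp
      next
        case False
        then have pos: "0 < infdist (\<omega> i) A"
          using A in_closed_iff_infdist_zero[of A "\<omega> i"] infdist_nonneg[of "\<omega> i" A] by linarith
        obtain N where N: "1 < real N * infdist (\<omega> i) A"
          using reals_Archimedean3[OF pos] by blast
        have "max 0 (1 - real n * infdist (\<omega> i) A) = 0" if "n \<ge> N" for n
        proof -
          have "real N * infdist (\<omega> i) A \<le> real n * infdist (\<omega> i) A"
            using that pos by (intro mult_right_mono) auto
          with N show ?thesis by simp
        qed
        then have "eventually (\<lambda>n. \<bar>indicator {\<omega>\<in>space \<mu>. \<omega> i \<in> A} \<omega> - max 0 (1 - real n * infdist (\<omega> i) A)\<bar> = 0) sequentially"
          using False unfolding eventually_sequentially by (intro exI[of _ N]) auto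
        then show ?thesis by (rule tendsto_eventually)
      qed
    qed
    show "AE \<omega> in \<mu>. norm \<bar>indicator {\<omega>\<in>space \<mu>. \<omega> i \<in> A} \<omega> - max 0 (1 - real n * infdist (\<omega> i) A)\<bar> \<le> 1" for n
      using infdist_nonneg[of _ A] by (intro AE_I2) (auto simp: indicator_def max_def)
  qed auto
  then show ?thesis by simp
qed

end

text \<open>Sets whose indicators are approximable in the means of both measures at once by uniform limits
  of polynomials form a sigma-algebra.\<close>

lemma measure_le_of_polynomial_squares:
  fixes \<mu> \<nu> :: "('x \<Rightarrow> real) measure"
  assumes \<mu>: "finite_measure \<mu>" "sets \<mu> = sets (PiM U (interval_outcomes a b))"
    and \<nu>: "finite_measure \<nu>" "sets \<nu> = sets (PiM U (interval_outcomes a b))"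
    and interval: "\<And>i. i \<in> U \<Longrightarrow> a i \<le> b i"
    and squares: "\<And>p. p \<in> polys_over U \<Longrightarrow>
      (\<integral>\<omega>. poly_value (p\<^sup>2) \<omega> \<partial>\<mu>) \<le> (\<integral>\<omega>. poly_value (p\<^sup>2) \<omega> \<partial>\<nu>)"
    and A: "A \<in> sets (PiM U (interval_outcomes a b))"
  shows "emeasure \<mu> A \<le> emeasure \<nu> A"
proof -
  interpret \<mu>: finite_box_measure \<mu> U a b
    using \<mu> by (intro finite_box_measure.intro) (auto simp: finite_box_measure_axioms_def)
  interpret \<nu>: finite_box_measure \<nu> U a b
    using \<nu> by (intro finite_box_measure.intro) (auto simp: finite_box_measure_axioms_def)
  let ?S = "space (PiM U (interval_outcomes a b))" and ?F = "sets (PiM U (interval_outcomes a b))"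
  have [simp]: "sets \<mu> = ?F" "sets \<nu> = ?F" "space \<mu> = ?S" "space \<nu> = ?S"
    using \<mu> \<nu> \<mu>.space_eq \<nu>.space_eq by auto
  \<comment> \<open>One \<open>f\<close> has to serve both measures, because a single polynomial
    near it is inserted into the inequality for squares.\<close>
  define D where "D = {A \<in> ?F. \<forall>\<epsilon>>0. \<exists>f\<in>uniform_unit_limits U a b.
    \<mu>.distance A f \<le> \<epsilon> \<and> \<nu>.distance A f \<le> \<epsilon>}"
  have D_sets: "A \<in> ?F" if "A \<in> D" for A using that by (simp add: D_def)
  have D_approx: "\<exists>f\<in>uniform_unit_limits U a b. \<mu>.distance A f \<le> \<epsilon> \<and> \<nu>.distance A f \<le> \<epsilon>"
    if "A \<in> D" "0 < \<epsilon>" for A \<epsilon>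
    using that by (simp add: D_def)
  have D_compl: "?S - A \<in> D" if A: "A \<in> D" for A
    unfolding D_def
  proof (intro CollectI conjI allI impI)
    fix \<epsilon> :: real assume "0 < \<epsilon>"
    with D_approx[OF A] obtain f where "f \<in> uniform_unit_limits U a b" "\<mu>.distance A f \<le> \<epsilon>" "\<nu>.distance A f \<le> \<epsilon>"
      by blast
    then show "\<exists>f\<in>uniform_unit_limits U a b. \<mu>.distance (?S - A) f \<le> \<epsilon> \<and> \<nu>.distance (?S - A) f \<le> \<epsilon>"
      using \<mu>.distance_compl[of A f] \<nu>.distance_compl[of A f]
      by (intro bexI[of _ "\<lambda>\<omega>. 1 - f \<omega>"]) (auto intro: uniform_unit_limits_compl)
  qed (use D_sets A in auto)
  have D_Int: "A \<inter> B \<in> D" if A: "A \<in> D" and B: "B \<in> D" for A B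
    unfolding D_def
  proof (intro CollectI conjI allI impI)
    fix \<epsilon> :: real assume "0 < \<epsilon>"
    then have "0 < \<epsilon> / 2" by simp
    from D_approx[OF A this] D_approx[OF B this] obtain f g where fg: "f \<in> uniform_unit_limits U a b" "g \<in> uniform_unit_limits U a b"
      and d: "\<mu>.distance A f \<le> \<epsilon> / 2" "\<nu>.distance A f \<le> \<epsilon> / 2" "\<mu>.distance B g \<le> \<epsilon> / 2" "\<nu>.distance B g \<le> \<epsilon> / 2"
      by blast
    show "\<exists>f\<in>uniform_unit_limits U a b. \<mu>.distance (A \<inter> B) f \<le> \<epsilon> \<and> \<nu>.distance (A \<inter> B) f \<le> \<epsilon>"
      using \<mu>.distance_Int[of A B f g] \<nu>.distance_Int[of A B f g] fg d D_sets A B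
      by (intro bexI[of _ "\<lambda>\<omega>. f \<omega> * g \<omega>"]) (auto intro: uniform_unit_limits_mult)
  qed (use D_sets A B in auto)
  have D_Un: "A \<union> B \<in> D" if "A \<in> D" "B \<in> D" for A B
  proof -
    have "A \<union> B = ?S - ((?S - A) \<inter> (?S - B))"
      using that[THEN D_sets] by (auto dest: sets.sets_into_space)
    then show ?thesis using that by (simp only: D_compl D_Int)
  qed
  have D_empty: "{} \<in> D"
  proof -
    have "(\<lambda>_. 0) \<in> uniform_unit_limits U a b"
      unfolding uniform_unit_limits_def by (auto intro!: bexI[of _ 0])
    then show ?thesis unfolding D_def by (auto intro!: bexI[of _ "\<lambda>_. 0"] simp: \<mu>.distance_def \<nu>.distance_def)
  qed
  have D_UN: "(\<Union>n. B n) \<in> D" if B: "range B \<subseteq> D" for B :: "nat \<Rightarrow> _"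
    unfolding D_def
  proof (intro CollectI conjI allI impI)
    show UB: "(\<Union>n. B n) \<in> ?F" using B D_sets by auto
    fix \<epsilon> :: real assume "0 < \<epsilon>"
    \<comment> \<open>The finite unions exhaust the countable one in both measures; an approximant
      of a late finite union also serves for the whole.\<close>
    define C where "C n = (\<Union>k\<le>n. B k)" for n
    have CD: "C n \<in> D" for n
    proof (induction n)
      case (Suc n)
      have "C (Suc n) = C n \<union> B (Suc n)" by (auto simp: C_def le_Suc_eq)
      with Suc B show ?case by (auto intro: D_Un)
    qed (use B in \<open>auto simp: C_def\<close>)
    have "incseq C" unfolding incseq_def C_def by (intro allI impI UN_mono) auto
    have UC: "(\<Union>n. C n) = (\<Union>n. B n)" by (auto simp: C_def)
    have "(\<lambda>n. measure \<mu> (C n)) \<longlonglongrightarrow> measure \<mu> (\<Union>n. B n)"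
      using \<mu>.finite_Lim_measure_incseq[of C] CD D_sets \<open>incseq C\<close> by (auto simp: UC)
    moreover have "(\<lambda>n. measure \<nu> (C n)) \<longlonglongrightarrow> measure \<nu> (\<Union>n. B n)"
      using \<nu>.finite_Lim_measure_incseq[of C] CD D_sets \<open>incseq C\<close> by (auto simp: UC)
    ultimately have "eventually (\<lambda>n. measure \<mu> (C n) > measure \<mu> (\<Union>n. B n) - \<epsilon> / 2
        \<and> measure \<nu> (C n) > measure \<nu> (\<Union>n. B n) - \<epsilon> / 2) sequentially"
      using \<open>0 < \<epsilon>\<close> by (intro eventually_conj order_tendstoD(1)) auto
    then obtain n where n: "measure \<mu> (C n) > measure \<mu> (\<Union>n. B n) - \<epsilon> / 2"
      "measure \<nu> (C n) > measure \<nu> (\<Union>n. B n) - \<epsilon> / 2"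
      by (auto simp: eventually_sequentially)
    obtain f where f: "f \<in> uniform_unit_limits U a b" "\<mu>.distance (C n) f \<le> \<epsilon> / 2" "\<nu>.distance (C n) f \<le> \<epsilon> / 2"
      using D_approx[OF CD, of "\<epsilon> / 2" n] \<open>0 < \<epsilon>\<close> by auto
    have "C n \<subseteq> (\<Union>n. B n)" by (auto simp: C_def)
    then have "\<mu>.distance (\<Union>n. B n) f \<le> \<epsilon>" "\<nu>.distance (\<Union>n. B n) f \<le> \<epsilon>"
      using \<mu>.distance_superset[of "C n" "\<Union>n. B n" f] \<nu>.distance_superset[of "C n" "\<Union>n. B n" f]
        D_sets[OF CD] UB f n by simp_all
    with f show "\<exists>f\<in>uniform_unit_limits U a b. \<mu>.distance (\<Union>n. B n) f \<le> \<epsilon> \<and> \<nu>.distance (\<Union>n. B n) f \<le> \<epsilon>"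
      by blast
  qed
  have coordinate: "{\<omega>\<in>?S. \<omega> i \<in> A} \<in> D" if i: "i \<in> U" and A: "A \<in> sets borel" for i A
  proof -
    \<comment> \<open>Induction over the generation of the Borel sets from closed sets, for which
      the distance functions provide approximants.\<close>
    have "A \<in> sigma_sets UNIV (Collect closed)" using A by (simp add: borel_eq_closed)
    then show ?thesis
    proof (induction rule: sigma_sets.induct)
      case (Basic A)
      show ?case
      proof (cases "A = {}")
        case True
        then show ?thesis using D_empty by simp
      next
        case False
        define f where "f n \<omega> = max 0 (1 - real n * infdist (\<omega> i) A)" for n and \<omega> :: "'x \<Rightarrow> real"
        have f: "f n \<in> uniform_unit_limits U a b" for n
          unfolding f_def using i interval infdist_nonneg[of _ A]
          by (intro uniform_unit_limits_coordinate continuous_intros) auto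
        have [measurable]: "A \<in> sets borel" using Basic by (auto intro: borel_closed)
        have "{\<omega>\<in>?S. \<omega> i \<in> A} \<in> ?F"
          using measurable_sets[OF measurable_coordinate[OF i], of A] \<open>A \<in> sets borel\<close>
          by (simp add: vimage_def Int_def conj_commute)
        moreover have "\<exists>f\<in>uniform_unit_limits U a b.
            \<mu>.distance {\<omega>\<in>?S. \<omega> i \<in> A} f \<le> \<epsilon> \<and> \<nu>.distance {\<omega>\<in>?S. \<omega> i \<in> A} f \<le> \<epsilon>" if "0 < \<epsilon>" for \<epsilon>
        proof -
          have "eventually (\<lambda>n. \<mu>.distance {\<omega>\<in>?S. \<omega> i \<in> A} (f n) < \<epsilon> \<and> \<nu>.distance {\<omega>\<in>?S. \<omega> i \<in> A} (f n) < \<epsilon>) sequentially"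
            using \<mu>.distance_closed_coordinate[OF i interval[OF i], of A]
              \<nu>.distance_closed_coordinate[OF i interval[OF i], of A] Basic False that
            unfolding f_def by (intro eventually_conj order_tendstoD(2)) auto
          then obtain n where "\<mu>.distance {\<omega>\<in>?S. \<omega> i \<in> A} (f n) < \<epsilon> \<and> \<nu>.distance {\<omega>\<in>?S. \<omega> i \<in> A} (f n) < \<epsilon>"
            unfolding eventually_sequentially by blast
          with f[of n] show ?thesis by (intro bexI[of _ "f n"]) auto
        qed
        ultimately show ?thesis by (simp add: D_def)
      qed
    next
      case Empty
      then show ?case using D_empty by simp
    next
      case (Compl A)
      have "{\<omega>\<in>?S. \<omega> i \<in> UNIV - A} = ?S - {\<omega>\<in>?S. \<omega> i \<in> A}" by auto
      then show ?case using D_compl[OF Compl.IH] by simp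
    next
      case (Union B)
      have "{\<omega>\<in>?S. \<omega> i \<in> (\<Union>n. B n)} = (\<Union>n. {\<omega>\<in>?S. \<omega> i \<in> B n})" by auto
      moreover have "(\<Union>n. {\<omega>\<in>?S. \<omega> i \<in> B n}) \<in> D" using Union.IH by (intro D_UN) auto
      ultimately show ?case by simp
    qed
  qed
  have "sigma_algebra ?S D"
    unfolding sigma_algebra_iff2
  proof (intro conjI ballI allI impI)
    show "D \<subseteq> Pow ?S" using D_sets sets.sets_into_space by blast
  qed (use D_empty D_compl D_UN in auto)
  \<comment> \<open>The product sigma-algebra is generated by conditions on a single
    coordinate.\<close>
  then have "sigma_sets ?S {{\<omega>\<in>?S. \<omega> i \<in> A} | i A. i \<in> U \<and> A \<in> sets (interval_outcomes a b i)} \<subseteq> D"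
  proof (rule sigma_algebra.sigma_sets_subset)
    have "{\<omega>\<in>?S. \<omega> i \<in> A} \<in> D" if i: "i \<in> U" and A: "A \<in> sets (interval_outcomes a b i)" for i A
    proof -
      obtain B where "B \<in> sets borel" "A = {a i..b i} \<inter> B"
        using A by (auto simp: interval_outcomes_def sets_restrict_space)
      moreover from this have "{\<omega>\<in>?S. \<omega> i \<in> A} = {\<omega>\<in>?S. \<omega> i \<in> B}"
        using i by (auto simp: space_box PiE_iff)
      ultimately show ?thesis using coordinate[OF i] by simp
    qed
    then show "{{\<omega>\<in>?S. \<omega> i \<in> A} | i A. i \<in> U \<and> A \<in> sets (interval_outcomes a b i)} \<subseteq> D" by auto
  qed
  with A have "A \<in> D" by (auto simp: sets_PiM_single space_PiM)
  \<comment> \<open>Each measure contributes an error of \<open>2 * \<epsilon>\<close> plus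
    \<open>3 * \<epsilon>\<close> times its total mass; \<open>c\<close> collects the two.\<close>
  define c where "c = 4 + 3 * (measure \<mu> ?S + measure \<nu> ?S)"
  have "0 < c" unfolding c_def by (simp add: add_pos_nonneg)
  have close: "measure \<mu> A \<le> measure \<nu> A + c * \<epsilon>" if "0 < \<epsilon>" "\<epsilon> \<le> 1" for \<epsilon>
  proof -
    obtain f where f: "f \<in> uniform_unit_limits U a b" "\<mu>.distance A f \<le> \<epsilon>" "\<nu>.distance A f \<le> \<epsilon>"
      using D_approx[OF \<open>A \<in> D\<close> \<open>0 < \<epsilon>\<close>] by blast
    obtain p where p: "p \<in> polys_over U" "\<forall>\<omega>\<in>?S. \<bar>f \<omega> - poly_value p \<omega>\<bar> \<le> \<epsilon>"
      using uniform_unit_limits_approx[OF f(1) \<open>0 < \<epsilon>\<close>] by blast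
    have pt: "\<bar>indicator A \<omega> - poly_value (p\<^sup>2) \<omega>\<bar> \<le> 2 * \<bar>indicator A \<omega> - f \<omega>\<bar> + 3 * \<epsilon>" if \<omega>: "\<omega> \<in> ?S" for \<omega>
    proof -
      let ?p = "poly_value p \<omega>" and ?A = "indicator A \<omega> :: real"
      have r: "0 \<le> f \<omega>" "f \<omega> \<le> 1" using \<mu>.unit_limit_range[OF f(1)] \<omega> by auto
      \<comment> \<open>The indicator equals its own square, so differences of squares can be
        factored. The cofactors are at most 2 and, because \<open>\<epsilon> \<le> 1\<close>, at
        most 3.\<close>
      have "?A - ?p\<^sup>2 = (?A - f \<omega>) * (?A + f \<omega>) + (f \<omega> - ?p) * (f \<omega> + ?p)"
        by (simp add: power2_eq_square algebra_simps indicator_def)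
      also have "\<bar>\<dots>\<bar> \<le> \<bar>?A - f \<omega>\<bar> * \<bar>?A + f \<omega>\<bar> + \<bar>f \<omega> - ?p\<bar> * \<bar>f \<omega> + ?p\<bar>"
        by (rule order_trans[OF abs_triangle_ineq]) (simp add: abs_mult)
      also have "\<dots> \<le> \<bar>?A - f \<omega>\<bar> * 2 + \<epsilon> * 3"
        using r p(2)[rule_format, OF \<omega>] \<open>\<epsilon> \<le> 1\<close> \<open>0 < \<epsilon>\<close>
        by (intro add_mono mult_mono) (auto simp: indicator_def)
      finally show ?thesis by simp
    qed
    have mean: "\<bar>measure \<rho> A - (\<integral>\<omega>. poly_value (p\<^sup>2) \<omega> \<partial>\<rho>)\<bar> \<le> 2 * \<epsilon> + 3 * \<epsilon> * measure \<rho> ?S"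
      if \<rho>: "finite_box_measure \<rho> U a b" "finite_box_measure.distance \<rho> A f \<le> \<epsilon>" for \<rho>
    proof -
      interpret \<rho>: finite_box_measure \<rho> U a b by fact
      have [simp]: "space \<rho> = ?S" by (rule \<rho>.space_eq)
      have A': "A \<in> sets \<rho>" using A \<rho>.sets_box by simp
      have int_p: "integrable \<rho> (poly_value (p\<^sup>2))"
        using p by (intro integrable_poly_value[of _ U a b] \<rho>.sets_box polys_over_power) (auto intro: \<rho>.finite_measure_axioms)
      have int_A: "integrable \<rho> (indicator A :: _ \<Rightarrow> real)"
        using A' by (simp add: \<rho>.emeasure_eq_measure)
      have "measure \<rho> A - (\<integral>\<omega>. poly_value (p\<^sup>2) \<omega> \<partial>\<rho>) = (\<integral>\<omega>. indicator A \<omega> - poly_value (p\<^sup>2) \<omega> \<partial>\<rho>)"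
        using int_p int_A A' sets.Int_space_eq2[OF A] by (simp del: poly_value_power)
      also have "\<bar>\<dots>\<bar> \<le> (\<integral>\<omega>. \<bar>indicator A \<omega> - poly_value (p\<^sup>2) \<omega>\<bar> \<partial>\<rho>)"
        using integral_norm_bound[of \<rho> "\<lambda>\<omega>. indicator A \<omega> - poly_value (p\<^sup>2) \<omega>"] by simp
      also have "\<dots> \<le> (\<integral>\<omega>. 2 * \<bar>indicator A \<omega> - f \<omega>\<bar> + 3 * \<epsilon> \<partial>\<rho>)"
        using int_p int_A \<rho>.integrable_distance[OF A' f(1)] pt
        by (intro integral_mono) (auto simp del: poly_value_power)
      also have "\<dots> = 2 * \<rho>.distance A f + 3 * \<epsilon> * measure \<rho> ?S"
        using \<rho>.integrable_distance[OF A' f(1)] by (simp add: \<rho>.distance_def)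
      finally show ?thesis using \<rho>(2) by linarith
    qed
    have "measure \<mu> A \<le> measure \<nu> A + (4 * \<epsilon> + 3 * \<epsilon> * measure \<mu> ?S + 3 * \<epsilon> * measure \<nu> ?S)"
      using mean[OF \<mu>.finite_box_measure_axioms f(2)] mean[OF \<nu>.finite_box_measure_axioms f(3)] squares[OF p(1)]
      by linarith
    then show ?thesis by (simp add: c_def algebra_simps)
  qed
  have "measure \<mu> A \<le> measure \<nu> A"
  proof (rule field_le_epsilon)
    fix e :: real assume "0 < e"
    define \<epsilon> where "\<epsilon> = min 1 (e / c)"
    have "0 < \<epsilon>" "\<epsilon> \<le> 1" "c * \<epsilon> \<le> e"
      using \<open>0 < e\<close> \<open>0 < c\<close> by (auto simp: \<epsilon>_def min_def field_simps)
    with close[of \<epsilon>] show "measure \<mu> A \<le> measure \<nu> A + e" by linarith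
  qed
  then show ?thesis by (simp add: \<mu>.emeasure_eq_measure \<nu>.emeasure_eq_measure ennreal_leI)
qed

section \<open>The semidefinite programs\<close>

text \<open>A vector is read as the coefficients of a polynomial, which turns conditions on matrices
  into inequalities for squares.\<close>

lemma quadratic_form_moment:
  "(\<Sum>\<alpha>\<in>I. \<Sum>\<beta>\<in>I. v \<alpha> * moment_matrix y \<alpha> \<beta> * v \<beta>)
    = riesz y ((\<Sum>\<alpha>\<in>I. Poly_Mapping.single \<alpha> (v \<alpha>))\<^sup>2)"
  by (simp add: power2_eq_square sum_product mult_single riesz_sum moment_matrix_def mult_ac)

lemma quadratic_form_localising:
  "(\<Sum>\<alpha>\<in>I. \<Sum>\<beta>\<in>I. v \<alpha> * localising_matrix g y \<alpha> \<beta> * v \<beta>)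
    = riesz y ((\<Sum>\<alpha>\<in>I. Poly_Mapping.single \<alpha> (v \<alpha>))\<^sup>2 * g)"
proof -
  have "(\<Sum>\<alpha>\<in>I. Poly_Mapping.single \<alpha> (v \<alpha>))\<^sup>2
      = (\<Sum>\<alpha>\<in>I. \<Sum>\<beta>\<in>I. Poly_Mapping.single (\<alpha> + \<beta>) (v \<alpha> * v \<beta>))"
    by (simp add: power2_eq_square sum_product mult_single)
  then have "(\<Sum>\<alpha>\<in>I. Poly_Mapping.single \<alpha> (v \<alpha>))\<^sup>2 * g
      = (\<Sum>\<alpha>\<in>I. \<Sum>\<beta>\<in>I. Poly_Mapping.single (\<alpha> + \<beta>) (v \<alpha> * v \<beta>) * g)"
    by (simp add: sum_distrib_right)
  moreover have "riesz y (Poly_Mapping.single \<gamma> c * g)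
      = c * (\<Sum>\<delta>\<in>Poly_Mapping.keys g. Poly_Mapping.lookup g \<delta> * y (\<gamma> + \<delta>))" for \<gamma> c
    by (cases "c = 0") (simp_all add: riesz_mult sum_distrib_left mult.assoc)
  ultimately show ?thesis
    by (simp add: riesz_sum localising_matrix_def mult_ac)
qed

lemma sum_single_lookup:
  assumes "finite I" "Poly_Mapping.keys q \<subseteq> I"
  shows "(\<Sum>\<alpha>\<in>I. Poly_Mapping.single \<alpha> (Poly_Mapping.lookup q \<alpha>)) = q"
proof -
  have "(\<Sum>\<alpha>\<in>I. Poly_Mapping.single \<alpha> (Poly_Mapping.lookup q \<alpha>))
      = (\<Sum>\<alpha>\<in>Poly_Mapping.keys q. Poly_Mapping.single \<alpha> (Poly_Mapping.lookup q \<alpha>))"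
    using assms by (intro sum.mono_neutral_right) (auto simp: in_keys_iff)
  then show ?thesis by (simp flip: poly_eq_sum_single)
qed

lemma keys_sum_single: "Poly_Mapping.keys (\<Sum>\<alpha>\<in>I. Poly_Mapping.single \<alpha> (v \<alpha>)) \<subseteq> I"
proof (induction I rule: infinite_finite_induct)
  case (insert \<alpha> I)
  then show ?case
    using keys_add[of "Poly_Mapping.single \<alpha> (v \<alpha>)" "\<Sum>\<alpha>\<in>I. Poly_Mapping.single \<alpha> (v \<alpha>)"]
    by (auto split: if_splits)
qed auto

lemma all_sum_single_iff:
  fixes P :: "'x rpoly \<Rightarrow> bool"
  assumes "finite I"
  shows "(\<forall>v. P (\<Sum>\<alpha>\<in>I. Poly_Mapping.single \<alpha> (v \<alpha>))) \<longleftrightarrow> (\<forall>q. Poly_Mapping.keys q \<subseteq> I \<longrightarrow> P q)"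
proof (intro iffI allI impI)
  fix q :: "'x rpoly" assume v: "\<forall>v. P (\<Sum>\<alpha>\<in>I. Poly_Mapping.single \<alpha> (v \<alpha>))" and q: "Poly_Mapping.keys q \<subseteq> I"
  from v[rule_format, of "Poly_Mapping.lookup q"] show "P q" by (simp only: sum_single_lookup[OF assms q])
qed (auto simp: keys_sum_single)

text \<open>Symmetry of the matrix is commutativity of the addition of exponents, so only the
  quadratic form matters.\<close>

lemma psd_on_moment_iff:
  assumes "finite I"
  shows "psd_on I (moment_matrix y) \<longleftrightarrow> (\<forall>q. Poly_Mapping.keys q \<subseteq> I \<longrightarrow> 0 \<le> riesz y (q\<^sup>2))"
  unfolding psd_on_def quadratic_form_moment 
    all_sum_single_iff[OF assms, where P = "\<lambda>p. 0 \<le> riesz y (p\<^sup>2)"]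
  by (simp add: moment_matrix_def add.commute)

lemma psd_on_localising_iff:
  assumes "finite I"
  shows "psd_on I (localising_matrix g y) \<longleftrightarrow>
    (\<forall>q. Poly_Mapping.keys q \<subseteq> I \<longrightarrow> 0 \<le> riesz y (q\<^sup>2 * g))"
  unfolding psd_on_def quadratic_form_localising
    all_sum_single_iff[OF assms, where P = "\<lambda>p. 0 \<le> riesz y (p\<^sup>2 * g)"]
  by (simp add: localising_matrix_def add.commute)

lemma keys_mult_multi_indices:
  assumes "Poly_Mapping.keys p \<subseteq> multi_indices U k" "Poly_Mapping.keys q \<subseteq> multi_indices U l"
  shows "Poly_Mapping.keys (p * q) \<subseteq> multi_indices U (k + l)"
  using keys_mult[of p q] multi_indices_add assms by blast

lemma keys_square_multi_indices:
  "Poly_Mapping.keys q \<subseteq> multi_indices U k \<Longrightarrow> Poly_Mapping.keys (q\<^sup>2) \<subseteq> multi_indices U (2 * k)"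
  using keys_mult_multi_indices[of q U k q k] by (simp add: power2_eq_square mult_2)

lemma keys_square_times_linear:
  assumes "Poly_Mapping.keys q \<subseteq> multi_indices U (k - 1)" "1 \<le> k" "g \<in> polys_over U" "total_degree g \<le> 1"
  shows "Poly_Mapping.keys (q\<^sup>2 * g) \<subseteq> multi_indices U (2 * k)"
proof -
  have "Poly_Mapping.keys (q\<^sup>2 * g) \<subseteq> multi_indices U (2 * (k - 1) + 1)"
    by (rule keys_mult_multi_indices[OF keys_square_multi_indices[OF assms(1)]
          keys_subset_multi_indices[OF assms(3,4)]])
  \<comment> \<open>At \<open>k = 0\<close> truncated subtraction would leave degree 1 on the left
    against 0 on the right.\<close>
  also have "\<dots> \<subseteq> multi_indices U (2 * k)" using \<open>1 \<le> k\<close> by (intro multi_indices_mono) auto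
  finally show ?thesis .
qed

lemma multi_indices_polys_over: "Poly_Mapping.keys q \<subseteq> multi_indices U k \<Longrightarrow> q \<in> polys_over U"
  by (auto simp: polys_over_def multi_indices_def)

lemma riesz_cong:
  "(\<And>\<alpha>. \<alpha> \<in> Poly_Mapping.keys p \<Longrightarrow> y \<alpha> = z \<alpha>) \<Longrightarrow> riesz y p = riesz z p"
  by (simp add: riesz_def)

lemma riesz_restrict: "Poly_Mapping.keys p \<subseteq> I \<Longrightarrow> riesz (restrict y I) p = riesz y p"
  by (rule riesz_cong) auto

lemma riesz_moments:
  assumes \<mu>: "finite_measure \<mu>" "sets \<mu> = sets (PiM U (interval_outcomes a b))"
    and "p \<in> polys_over U"
  shows "riesz (moments \<mu>) p = (\<integral>\<omega>. poly_value p \<omega> \<partial>\<mu>)"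
proof -
  have "riesz (moments \<mu>) p = (\<integral>\<omega>. poly_value p \<omega> \<partial>\<mu>) \<and> p \<in> polys_over U"
    using assms(3)
  proof (induction p rule: polys_over_induct)
    case (plus p q)
    then show ?case using integrable_poly_value[OF \<mu>] by (auto simp: riesz_add)
  qed (simp add: moments_def)
  then show ?thesis ..
qed

lemma integral_le_of_emeasure_le:
  fixes f :: "'a \<Rightarrow> real"
  assumes sets: "sets \<mu> = sets \<nu>" and le: "\<And>A. A \<in> sets \<nu> \<Longrightarrow> emeasure \<mu> A \<le> emeasure \<nu> A"
    and f: "integrable \<nu> f" "\<And>\<omega>. \<omega> \<in> space \<nu> \<Longrightarrow> 0 \<le> f \<omega>"
  shows "(\<integral>\<omega>. f \<omega> \<partial>\<mu>) \<le> (\<integral>\<omega>. f \<omega> \<partial>\<nu>)"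
proof -
  have space: "space \<mu> = space \<nu>" by (rule sets_eq_imp_space_eq[OF sets])
  \<comment> \<open>The order on measures compares \<open>emeasure\<close> on all sets;
    nonmeasurable ones have the default value 0.\<close>
  have "\<mu> \<le> \<nu>"
    unfolding le_measure_iff le_fun_def using sets space le
    by (auto, metis emeasure_notin_sets zero_le)
  then have "(\<integral>\<^sup>+\<omega>. ennreal (f \<omega>) \<partial>\<mu>) \<le> (\<integral>\<^sup>+\<omega>. ennreal (f \<omega>) \<partial>\<nu>)"
    by (rule nn_integral_mono_measure[OF sets])
  moreover have "(\<integral>\<^sup>+\<omega>. ennreal (f \<omega>) \<partial>\<nu>) < \<top>"
    using integrableD(2)[OF f(1)] by (simp add: top.not_eq_extremum)
  moreover have "f \<in> borel_measurable \<mu>" "f \<in> borel_measurable \<nu>"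
    using f(1) measurable_cong_sets[OF sets refl] by auto
  ultimately show ?thesis
    using f(2) by (subst (1 2) integral_eq_nn_integral) (auto simp: space intro!: AE_I2 enn2real_mono)
qed

section \<open>The cone of sums of squares without degree bound\<close>

definition sos :: "'x set \<Rightarrow> 'x rpoly set" where
  "sos U = {p. \<exists>(n::nat) q. (\<forall>i<n. q i \<in> polys_over U) \<and> p = (\<Sum>i<n. (q i)\<^sup>2)}"

lemma sos_polys_eq: "sos_polys U k = {p \<in> sos U. total_degree p \<le> 2 * k}"
  by (auto simp: sos_polys_def sos_def)

lemma sos_square: "q \<in> polys_over U \<Longrightarrow> q\<^sup>2 \<in> sos U"
  unfolding sos_def by (auto intro!: exI[of _ "1::nat"] exI[of _ "\<lambda>_. q"])

lemma sos_zero [simp]: "0 \<in> sos U"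
  using sos_square[of 0 U] by simp

lemma sos_add:
  assumes "p \<in> sos U" "p' \<in> sos U"
  shows "p + p' \<in> sos U"
proof -
  obtain n and q :: "nat \<Rightarrow> _" where q: "\<forall>i<n. q i \<in> polys_over U" "p = (\<Sum>i<n. (q i)\<^sup>2)"
    using assms(1) by (auto simp: sos_def)
  obtain n' and q' :: "nat \<Rightarrow> _" where q': "\<forall>i<n'. q' i \<in> polys_over U" "p' = (\<Sum>i<n'. (q' i)\<^sup>2)"
    using assms(2) by (auto simp: sos_def)
  define r where "r i = (if i < n then q i else q' (i - n))" for i
  have "(\<Sum>i<n + n'. (r i)\<^sup>2) = (\<Sum>i<n. (r i)\<^sup>2) + (\<Sum>i<n'. (r (n + i))\<^sup>2)"
    by (induction n') (auto simp: add.assoc)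
  then have "p + p' = (\<Sum>i<n + n'. (r i)\<^sup>2)"
    by (simp add: q q' r_def)
  moreover have "\<forall>i<n + n'. r i \<in> polys_over U"
    using q q' by (auto simp: r_def)
  ultimately show ?thesis unfolding sos_def by blast
qed

lemma sos_scale:
  assumes "p \<in> sos U" "0 \<le> c"
  shows "Poly_Mapping.single 0 c * p \<in> sos U"
proof -
  obtain n and q :: "nat \<Rightarrow> _" where q: "\<forall>i<n. q i \<in> polys_over U" "p = (\<Sum>i<n. (q i)\<^sup>2)"
    using assms(1) by (auto simp: sos_def)
  have "(Poly_Mapping.single 0 (sqrt c) * r)\<^sup>2 = Poly_Mapping.single 0 c * r\<^sup>2" for r :: "'a rpoly"
    using assms(2) by (simp add: power_mult_distrib) (simp add: power2_eq_square mult_single)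
  then have "Poly_Mapping.single 0 c * p = (\<Sum>i<n. (Poly_Mapping.single 0 (sqrt c) * q i)\<^sup>2)"
    by (simp add: q sum_distrib_left)
  moreover have "\<forall>i<n. Poly_Mapping.single 0 (sqrt c) * q i \<in> polys_over U"
    using q by auto
  ultimately show ?thesis
    unfolding sos_def by (intro CollectI exI[of _ n] exI[of _ "\<lambda>i. Poly_Mapping.single 0 (sqrt c) * q i"]) blast
qed

lemma sos_over: "p \<in> sos U \<Longrightarrow> p \<in> polys_over U"
  by (auto simp: sos_def)

lemma poly_value_sos_nonneg: "p \<in> sos U \<Longrightarrow> 0 \<le> poly_value p \<omega>"
  by (auto simp: sos_def intro!: sum_nonneg)

text \<open>Here the absence of cancellation enters: every squared polynomial has degree at most
  \<open>k\<close>, so it is among those tested by \<open>square\<close>. With \<open>g = 1\<close>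
  this serves moment matrices, with a constraint polynomial localising matrices.\<close>

lemma riesz_sos_polys:
  assumes p: "p \<in> sos_polys U k"
    and square: "\<And>q. Poly_Mapping.keys q \<subseteq> multi_indices U k \<Longrightarrow> 0 \<le> riesz y (q\<^sup>2 * g)"
  shows "0 \<le> riesz y (p * g)"
proof -
  obtain n and q :: "nat \<Rightarrow> _" where q: "\<forall>i<n. q i \<in> polys_over U" "p = (\<Sum>i<n. (q i)\<^sup>2)"
    and deg: "total_degree p \<le> 2 * k"
    using p by (auto simp: sos_polys_def)
  have "Poly_Mapping.keys (q i) \<subseteq> multi_indices U k" if "i < n" for i
    using q that deg total_degree_summand_of_sos[of q n k i] by (intro keys_subset_multi_indices) auto
  then have "0 \<le> (\<Sum>i<n. riesz y ((q i)\<^sup>2 * g))"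
    by (intro sum_nonneg square) auto
  then show ?thesis
    by (simp add: q(2) sum_distrib_right riesz_sum)
qed

section \<open>Both programs for a fixed scenario: monotonicity and weak duality\<close>

locale box_scenario =
  fixes X :: "'x set" and M :: "'x set set" and a b :: "'x \<Rightarrow> real"
    and e :: "'x set \<Rightarrow> ('x \<Rightarrow> real) measure"
  assumes finite_X: "finite X" and X_nonempty: "X \<noteq> {}"
    and scenario: "measurement_scenario X M"
    and interval: "\<And>x. x \<in> X \<Longrightarrow> a x \<le> b x"
    and model: "empirical_model M (interval_outcomes a b) e"
begin

abbreviation "box_space U \<equiv> PiM U (interval_outcomes a b)"

lemma context_subset: "C \<in> M \<Longrightarrow> C \<subseteq> X"
  using scenario by (auto simp: measurement_scenario_def)

lemma finite_context: "C \<in> M \<Longrightarrow> finite C"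
  using context_subset finite_X finite_subset by blast

lemma finite_M: "finite M"
  using context_subset finite_X by (meson Pow_iff finite_Pow_iff rev_finite_subset subsetI)

lemma M_nonempty: "M \<noteq> {}"
  using scenario X_nonempty by (auto simp: measurement_scenario_def)

lemma context_covers: "i \<in> X \<Longrightarrow> \<exists>C\<in>M. i \<in> C"
  using scenario by (auto simp: measurement_scenario_def)

lemma e_prob: "C \<in> M \<Longrightarrow> prob_space (e C)"
  and e_sets: "C \<in> M \<Longrightarrow> sets (e C) = sets (box_space C)"
  using model by (auto simp: empirical_model_def)

lemma e_finite: "C \<in> M \<Longrightarrow> finite_measure (e C)"
  using e_prob by (simp add: prob_space_def)

lemma integrable_e: "C \<in> M \<Longrightarrow> p \<in> polys_over C \<Longrightarrow> integrable (e C) (poly_value p)"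
  using integrable_poly_value e_finite e_sets by blast

lemma riesz_moments_e: "C \<in> M \<Longrightarrow> p \<in> polys_over C \<Longrightarrow> riesz (moments (e C)) p = (\<integral>\<omega>. poly_value p \<omega> \<partial>e C)"
  using riesz_moments e_finite e_sets by blast

lemma finite_multi_indices_X: "finite (multi_indices X k)"
  using finite_X by (rule finite_multi_indices)

lemma sdp_feasible_iff:
  "y \<in> sdp_feasible X M m g e k \<longleftrightarrow>
     y \<in> multi_indices X (2 * k) \<rightarrow>\<^sub>E UNIV \<and>
     (\<forall>C\<in>M. \<forall>q. Poly_Mapping.keys q \<subseteq> multi_indices C k \<longrightarrow> riesz y (q\<^sup>2) \<le> (\<integral>\<omega>. poly_value (q\<^sup>2) \<omega> \<partial>e C)) \<and>
     (\<forall>j\<in>{1..m}. \<forall>q. Poly_Mapping.keys q \<subseteq> multi_indices X (k - 1) \<longrightarrow> 0 \<le> riesz y (q\<^sup>2 * g j)) \<and>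
     (\<forall>q. Poly_Mapping.keys q \<subseteq> multi_indices X k \<longrightarrow> 0 \<le> riesz y (q\<^sup>2))"
proof -
  have "psd_on (multi_indices C k) (moment_matrix (\<lambda>\<alpha>. moments (e C) \<alpha> - y \<alpha>)) \<longleftrightarrow>
      (\<forall>q. Poly_Mapping.keys q \<subseteq> multi_indices C k \<longrightarrow> riesz y (q\<^sup>2) \<le> (\<integral>\<omega>. poly_value (q\<^sup>2) \<omega> \<partial>e C))"
    if C: "C \<in> M" for C
  proof -
    have "riesz (moments (e C)) (q\<^sup>2) = (\<integral>\<omega>. poly_value (q\<^sup>2) \<omega> \<partial>e C)"
      if "Poly_Mapping.keys q \<subseteq> multi_indices C k" for q
      using C multi_indices_polys_over[OF that] by (intro riesz_moments_e) auto
    then show ?thesis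
      by (simp add: psd_on_moment_iff finite_multi_indices finite_context[OF C] riesz_diff_family
          del: poly_value_power)
  qed
  then show ?thesis
    by (simp add: sdp_feasible_def psd_on_moment_iff psd_on_localising_iff finite_multi_indices_X
        del: poly_value_power)
qed

lemma sdp_feasibleD:
  assumes "y \<in> sdp_feasible X M m g e k"
  shows "C \<in> M \<Longrightarrow> Poly_Mapping.keys q \<subseteq> multi_indices C k \<Longrightarrow> riesz y (q\<^sup>2) \<le> (\<integral>\<omega>. poly_value (q\<^sup>2) \<omega> \<partial>e C)"
    and "j \<in> {1..m} \<Longrightarrow> Poly_Mapping.keys q \<subseteq> multi_indices X (k - 1) \<Longrightarrow> 0 \<le> riesz y (q\<^sup>2 * g j)"
    and "Poly_Mapping.keys q \<subseteq> multi_indices X k \<Longrightarrow> 0 \<le> riesz y (q\<^sup>2)"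
  using assms unfolding sdp_feasible_iff by blast+

text \<open>The lower level tests fewer polynomials, and what it evaluates has degree at most
  \<open>2 * k\<close>, where truncation changes nothing.\<close>

lemma sdp_feasible_restrict:
  assumes y: "y \<in> sdp_feasible X M m g e (Suc k)" and "1 \<le> k"
    and g: "\<And>j. j \<in> {1..m} \<Longrightarrow> g j \<in> polys_over X \<and> total_degree (g j) = 1"
  shows "restrict y (multi_indices X (2 * k)) \<in> sdp_feasible X M m g e k"
proof -
  let ?y = "restrict y (multi_indices X (2 * k))"
  have sq: "riesz ?y (q\<^sup>2) = riesz y (q\<^sup>2)" if "Poly_Mapping.keys q \<subseteq> multi_indices X k" for q
    by (intro riesz_restrict keys_square_multi_indices that)
  have loc: "riesz ?y (q\<^sup>2 * g j) = riesz y (q\<^sup>2 * g j)"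
    if "j \<in> {1..m}" "Poly_Mapping.keys q \<subseteq> multi_indices X (k - 1)" for q j
    using that g[OF that(1)] \<open>1 \<le> k\<close> by (intro riesz_restrict keys_square_times_linear) auto
  have up: "multi_indices U k \<subseteq> multi_indices U (Suc k)" for U
    by (rule multi_indices_mono) auto
  have down: "multi_indices X (k - 1) \<subseteq> multi_indices X (Suc k - 1)"
    by (rule multi_indices_mono) auto
  show ?thesis
    unfolding sdp_feasible_iff
  proof (intro conjI ballI allI impI)
    fix C and q :: "'x rpoly" assume C: "C \<in> M" "Poly_Mapping.keys q \<subseteq> multi_indices C k"
    have "Poly_Mapping.keys q \<subseteq> multi_indices X k"
      using C(2) multi_indices_mono[OF context_subset[OF C(1)] order_refl] by (rule order_trans)
    then have "riesz ?y (q\<^sup>2) = riesz y (q\<^sup>2)" by (rule sq)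
    with sdp_feasibleD(1)[OF y C(1) order_trans[OF C(2) up]]
    show "riesz ?y (q\<^sup>2) \<le> (\<integral>\<omega>. poly_value (q\<^sup>2) \<omega> \<partial>e C)" by (simp only:)
  next
    fix j and q :: "'x rpoly" assume j: "j \<in> {1..m}" "Poly_Mapping.keys q \<subseteq> multi_indices X (k - 1)"
    then show "0 \<le> riesz ?y (q\<^sup>2 * g j)"
      using sdp_feasibleD(2)[OF y j(1) order_trans[OF j(2) down]] by (simp only: loc)
  next
    fix q :: "'x rpoly" assume q: "Poly_Mapping.keys q \<subseteq> multi_indices X k"
    then show "0 \<le> riesz ?y (q\<^sup>2)"
      using sdp_feasibleD(3)[OF y order_trans[OF q up]] by (simp only: sq)
  qed auto
qed

lemma zero_in_multi_indices: "0 \<in> multi_indices U k"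
  by (simp add: multi_indices_def)

lemma sdp_val_antimono:
  assumes "1 \<le> k" and g: "\<And>j. j \<in> {1..m} \<Longrightarrow> g j \<in> polys_over X \<and> total_degree (g j) = 1"
  shows "sdp_val X M m g e (Suc k) \<le> sdp_val X M m g e k"
  unfolding sdp_val_def
proof (rule SUP_least)
  fix y assume "y \<in> sdp_feasible X M m g e (Suc k)"
  then have "restrict y (multi_indices X (2 * k)) \<in> sdp_feasible X M m g e k"
    using assms by (rule sdp_feasible_restrict)
  then show "ereal (y 0) \<le> (SUP y\<in>sdp_feasible X M m g e k. ereal (y 0))"
    by (rule SUP_upper2) (simp add: zero_in_multi_indices)
qed

text \<open>A certificate stays feasible, with the same objective, when the degree bounds
  grow.\<close>

lemma dsdp_val_antimono: "dsdp_val X M m g e (Suc k) \<le> dsdp_val X M m g e k"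
  unfolding dsdp_val_def
  by (rule INF_superset_mono) (fastforce simp: dsdp_feasible_def sos_polys_eq)+

lemma weak_duality:
  assumes y: "y \<in> sdp_feasible X M m g e k" and p: "(p, \<sigma>) \<in> dsdp_feasible X M m g k"
  shows "y 0 \<le> (\<Sum>C\<in>M. \<integral>\<omega>. poly_value (p C) \<omega> \<partial>e C)"
proof -
  have p_sos: "p C \<in> sos_polys C k" if "C \<in> M" for C
    using p that by (simp add: dsdp_feasible_def)
  have eq: "(\<Sum>C\<in>M. p C) - 1 = \<sigma> 0 + (\<Sum>j=1..m. \<sigma> j * g j)"
    using p by (simp add: dsdp_feasible_def)
  have sos: "\<sigma> 0 \<in> sos_polys X k" "\<And>j. j \<in> {1..m} \<Longrightarrow> \<sigma> j \<in> sos_polys X (k - 1)"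
    using p by (simp_all add: dsdp_feasible_def)
  have "0 \<le> riesz y (\<sigma> 0 * 1)"
    by (rule riesz_sos_polys[OF sos(1)]) (simp add: sdp_feasibleD(3)[OF y])
  moreover have "0 \<le> riesz y (\<sigma> j * g j)" if "j \<in> {1..m}" for j
    by (rule riesz_sos_polys[OF sos(2)[OF that]]) (rule sdp_feasibleD(2)[OF y that])
  ultimately have "0 \<le> riesz y ((\<Sum>C\<in>M. p C) - 1)"
    unfolding eq riesz_add riesz_sum by (intro add_nonneg_nonneg sum_nonneg) simp_all
  moreover have "riesz y (p C) \<le> (\<integral>\<omega>. poly_value (p C) \<omega> \<partial>e C)" if C: "C \<in> M" for C
  proof -
    \<comment> \<open>The difference of the two moment families is itself nonnegative on squares in
      the variables of \<open>C\<close>, so the lemma on sums of squares applies to it as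
      well.\<close>
    have "0 \<le> riesz (\<lambda>\<alpha>. moments (e C) \<alpha> - y \<alpha>) (p C * 1)"
    proof (rule riesz_sos_polys[OF p_sos[OF C]])
      fix q :: "'x rpoly" assume q: "Poly_Mapping.keys q \<subseteq> multi_indices C k"
      then have "q \<in> polys_over C" by (rule multi_indices_polys_over)
      with sdp_feasibleD(1)[OF y C q] C show "0 \<le> riesz (\<lambda>\<alpha>. moments (e C) \<alpha> - y \<alpha>) (q\<^sup>2 * 1)"
        by (simp add: riesz_diff_family riesz_moments_e polys_over_power del: poly_value_power)
    qed
    moreover have "p C \<in> polys_over C" using p_sos[OF C] by (simp add: sos_polys_eq sos_over)
    ultimately show ?thesis using C by (simp add: riesz_diff_family riesz_moments_e)
  qed
  ultimately show ?thesis
    by (simp add: riesz_minus riesz_sum) (meson order_trans sum_mono)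
qed

lemma sdp_val_le_dsdp_val: "sdp_val X M m g e k \<le> dsdp_val X M m g e k"
  unfolding sdp_val_def dsdp_val_def using weak_duality
  by (intro SUP_least INF_greatest) auto

section \<open>Subordinate measures as feasible points of the primal program\<close>

lemma measurable_projection:
  "C \<in> M \<Longrightarrow> sets \<mu> = sets (box_space X) \<Longrightarrow> (\<lambda>\<omega>. restrict \<omega> C) \<in> measurable \<mu> (box_space C)"
  using measurable_restrict_subset[OF context_subset] measurable_cong_sets[OF _ refl] by blast

lemma integral_marginal:
  assumes "C \<in> M" "sets \<mu> = sets (box_space X)" "p \<in> polys_over C"
  shows "(\<integral>\<omega>. poly_value p \<omega> \<partial>marginal (interval_outcomes a b) C \<mu>) = (\<integral>\<omega>. poly_value p \<omega> \<partial>\<mu>)"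
  unfolding marginal_def integral_distr[OF measurable_projection[OF assms(1,2)] measurable_poly_value[OF assms(3)]]
  using assms(3) by (intro Bochner_Integration.integral_cong refl poly_value_cong) auto

text \<open>Marginals preserve total mass, and a single context bounds it by the mass of
  \<open>e C\<close>; there is a context because \<open>X\<close> is nonempty.\<close>

lemma finite_subordinate:
  assumes "\<mu> \<in> subordinate_measures X M (interval_outcomes a b) e"
  shows "finite_measure \<mu>"
proof
  obtain C where C: "C \<in> M" using M_nonempty by blast
  have sets: "sets \<mu> = sets (box_space X)" using assms by (simp add: subordinate_measures_def)
  have "emeasure \<mu> (space \<mu>) = emeasure (marginal (interval_outcomes a b) C \<mu>) (space (box_space C))"
    unfolding marginal_def
    using measurable_space[OF measurable_projection[OF C sets]]
    by (subst emeasure_distr[OF measurable_projection[OF C sets]]) (auto intro!: arg_cong[of _ _ "emeasure \<mu>"])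
  also have "\<dots> \<le> emeasure (e C) (space (box_space C))"
    using assms C by (simp add: subordinate_measures_def)
  also have "\<dots> < \<top>"
    using finite_measure.emeasure_finite[OF e_finite[OF C]] by (simp add: top.not_eq_extremum)
  finally show "emeasure \<mu> (space \<mu>) \<noteq> \<infinity>" by simp
qed

lemma subordinate_feasible:
  assumes \<mu>: "\<mu> \<in> subordinate_measures X M (interval_outcomes a b) e" and "1 \<le> k"
    and g: "\<And>j. j \<in> {1..m} \<Longrightarrow> g j \<in> polys_over X \<and> total_degree (g j) = 1"
    and g_nonneg: "\<And>\<omega> j. \<omega> \<in> space (box_space X) \<Longrightarrow> j \<in> {1..m} \<Longrightarrow> 0 \<le> poly_value (g j) \<omega>"
  shows "restrict (moments \<mu>) (multi_indices X (2 * k)) \<in> sdp_feasible X M m g e k"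
proof -
  let ?y = "restrict (moments \<mu>) (multi_indices X (2 * k))"
  have sets: "sets \<mu> = sets (box_space X)" using \<mu> by (simp add: subordinate_measures_def)
  have space: "space \<mu> = space (box_space X)" by (rule sets_eq_imp_space_eq[OF sets])
  have fin: "finite_measure \<mu>" by (rule finite_subordinate[OF \<mu>])
  have y: "riesz ?y p = (\<integral>\<omega>. poly_value p \<omega> \<partial>\<mu>)" if "Poly_Mapping.keys p \<subseteq> multi_indices X (2 * k)" for p
    using riesz_restrict[OF that] riesz_moments[OF fin sets multi_indices_polys_over[OF that]] by simp
  show ?thesis
    unfolding sdp_feasible_iff
  proof (intro conjI ballI allI impI)
    fix C and q :: "'x rpoly" assume C: "C \<in> M" and q: "Poly_Mapping.keys q \<subseteq> multi_indices C k"
    have "Poly_Mapping.keys (q\<^sup>2) \<subseteq> multi_indices X (2 * k)"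
      using keys_square_multi_indices[OF q] multi_indices_mono[OF context_subset[OF C]] by blast
    then have "riesz ?y (q\<^sup>2) = (\<integral>\<omega>. poly_value (q\<^sup>2) \<omega> \<partial>\<mu>)" by (rule y)
    also have "\<dots> = (\<integral>\<omega>. poly_value (q\<^sup>2) \<omega> \<partial>marginal (interval_outcomes a b) C \<mu>)"
      using multi_indices_polys_over[OF q] by (intro integral_marginal[symmetric] C sets polys_over_power)
    also have "\<dots> \<le> (\<integral>\<omega>. poly_value (q\<^sup>2) \<omega> \<partial>e C)"
      using \<mu> C multi_indices_polys_over[OF q] e_sets[OF C]
      by (intro integral_le_of_emeasure_le integrable_e polys_over_power)
         (auto simp: subordinate_measures_def marginal_def)
    finally show "riesz ?y (q\<^sup>2) \<le> (\<integral>\<omega>. poly_value (q\<^sup>2) \<omega> \<partial>e C)" .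
  next
    fix j and q :: "'x rpoly" assume j: "j \<in> {1..m}" and q: "Poly_Mapping.keys q \<subseteq> multi_indices X (k - 1)"
    have "riesz ?y (q\<^sup>2 * g j) = (\<integral>\<omega>. poly_value (q\<^sup>2 * g j) \<omega> \<partial>\<mu>)"
      using q g[OF j] \<open>1 \<le> k\<close> by (intro y keys_square_times_linear) auto
    also have "\<dots> \<ge> 0"
      using g_nonneg j by (intro integral_nonneg_AE AE_I2) (auto simp: space)
    finally show "0 \<le> riesz ?y (q\<^sup>2 * g j)" .
  next
    fix q :: "'x rpoly" assume q: "Poly_Mapping.keys q \<subseteq> multi_indices X k"
    have "riesz ?y (q\<^sup>2) = (\<integral>\<omega>. poly_value (q\<^sup>2) \<omega> \<partial>\<mu>)" by (intro y keys_square_multi_indices q)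
    also have "\<dots> \<ge> 0" by (intro integral_nonneg_AE AE_I2) auto
    finally show "0 \<le> riesz ?y (q\<^sup>2)" .
  qed auto
qed

lemma NCF_le_sdp_val:
  assumes "1 \<le> k"
    and g: "\<And>j. j \<in> {1..m} \<Longrightarrow> g j \<in> polys_over X \<and> total_degree (g j) = 1"
    and g_nonneg: "\<And>\<omega> j. \<omega> \<in> space (box_space X) \<Longrightarrow> j \<in> {1..m} \<Longrightarrow> 0 \<le> poly_value (g j) \<omega>"
  shows "enn2ereal (NCF X M (interval_outcomes a b) e) \<le> sdp_val X M m g e k"
proof -
  have le: "enn2ereal (emeasure \<mu> (space (box_space X))) \<le> sdp_val X M m g e k"
    if \<mu>: "\<mu> \<in> subordinate_measures X M (interval_outcomes a b) e" for \<mu>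
  proof -
    interpret finite_measure \<mu> by (rule finite_subordinate[OF \<mu>])
    have space: "space \<mu> = space (box_space X)"
      using \<mu> by (intro sets_eq_imp_space_eq) (simp add: subordinate_measures_def)
    have "enn2ereal (emeasure \<mu> (space (box_space X))) = ereal (moments \<mu> 0)"
      by (simp add: moments_def emeasure_eq_measure space enn2ereal_ennreal flip: space)
    also have "\<dots> = ereal (restrict (moments \<mu>) (multi_indices X (2 * k)) 0)"
      by (simp add: zero_in_multi_indices)
    also have "\<dots> \<le> sdp_val X M m g e k"
      unfolding sdp_val_def by (intro SUP_upper subordinate_feasible assms \<mu>)
    finally show ?thesis .
  qed
  \<comment> \<open>A feasible point of value 0 shows that the primal value is nonnegative, so that
    passing to \<open>ennreal\<close> and back loses nothing.\<close>
  have "null_measure (box_space X) \<in> subordinate_measures X M (interval_outcomes a b) e"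
  proof -
    have "emeasure (marginal (interval_outcomes a b) C (null_measure (box_space X))) A = 0"
      if "C \<in> M" "A \<in> sets (box_space C)" for C A
      using that unfolding marginal_def by (subst emeasure_distr) (auto intro!: measurable_projection)
    then show ?thesis by (simp add: subordinate_measures_def)
  qed
  from le[OF this] have nonneg: "0 \<le> sdp_val X M m g e k" by (simp add: zero_ennreal.rep_eq)
  have "NCF X M (interval_outcomes a b) e \<le> e2ennreal (sdp_val X M m g e k)"
    unfolding NCF_def
  proof (rule SUP_least)
    fix \<mu> assume "\<mu> \<in> subordinate_measures X M (interval_outcomes a b) e"
    from e2ennreal_mono[OF le[OF this]]
    show "emeasure \<mu> (space (box_space X)) \<le> e2ennreal (sdp_val X M m g e k)" by simp
  qed
  then have "enn2ereal (NCF X M (interval_outcomes a b) e) \<le> enn2ereal (e2ennreal (sdp_val X M m g e k))"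
    by (simp add: less_eq_ennreal.rep_eq)
  with nonneg show ?thesis by (simp add: enn2ereal_e2ennreal)
qed

text \<open>The values of the dual program with right-hand side \<open>f\<close> in place of \<open>1\<close>, without bounds on
  degrees and without multipliers of the constraints \<open>g\<close>. Monomials not supported on \<open>X\<close> are
  ignored, so that every polynomial has such values.\<close>

definition dual_values :: "'x rpoly \<Rightarrow> real set" where
  "dual_values f = {(\<Sum>C\<in>M. \<integral>\<omega>. poly_value (p C) \<omega> \<partial>e C) | p. (\<forall>C\<in>M. p C \<in> sos C) \<and>
     (\<exists>\<sigma>\<in>sos X. \<exists>h. (\<forall>\<alpha>\<in>Poly_Mapping.keys h. \<not> Poly_Mapping.keys \<alpha> \<subseteq> X) \<and> (\<Sum>C\<in>M. p C) - f = \<sigma> + h)}"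

lemma dual_valuesI:
  assumes "\<And>C. C \<in> M \<Longrightarrow> p C \<in> sos C" "\<sigma> \<in> sos X"
    "\<And>\<alpha>. \<alpha> \<in> Poly_Mapping.keys h \<Longrightarrow> \<not> Poly_Mapping.keys \<alpha> \<subseteq> X"
    "(\<Sum>C\<in>M. p C) - f = \<sigma> + h" "c = (\<Sum>C\<in>M. \<integral>\<omega>. poly_value (p C) \<omega> \<partial>e C)"
  shows "c \<in> dual_values f"
  unfolding dual_values_def using assms by blast

lemma dual_valuesE:
  assumes "c \<in> dual_values f"
  obtains p \<sigma> h where "\<forall>C\<in>M. p C \<in> sos C" "\<sigma> \<in> sos X"
    "\<forall>\<alpha>\<in>Poly_Mapping.keys h. \<not> Poly_Mapping.keys \<alpha> \<subseteq> X"
    "(\<Sum>C\<in>M. p C) - f = \<sigma> + h" "c = (\<Sum>C\<in>M. \<integral>\<omega>. poly_value (p C) \<omega> \<partial>e C)"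
  using assms unfolding dual_values_def by blast

lemma dual_values_nonneg: "c \<in> dual_values f \<Longrightarrow> 0 \<le> c"
  by (elim dual_valuesE) (auto intro!: sum_nonneg integral_nonneg_AE AE_I2 poly_value_sos_nonneg)

lemma dual_values_add:
  assumes "c \<in> dual_values f" "d \<in> dual_values f'"
  shows "c + d \<in> dual_values (f + f')"
proof -
  obtain p \<sigma> h where p: "\<forall>C\<in>M. p C \<in> sos C" "\<sigma> \<in> sos X"
    "\<forall>\<alpha>\<in>Poly_Mapping.keys h. \<not> Poly_Mapping.keys \<alpha> \<subseteq> X"
    "(\<Sum>C\<in>M. p C) - f = \<sigma> + h" "c = (\<Sum>C\<in>M. \<integral>\<omega>. poly_value (p C) \<omega> \<partial>e C)"
    using assms(1) by (rule dual_valuesE)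
  obtain p' \<sigma>' h' where p': "\<forall>C\<in>M. p' C \<in> sos C" "\<sigma>' \<in> sos X"
    "\<forall>\<alpha>\<in>Poly_Mapping.keys h'. \<not> Poly_Mapping.keys \<alpha> \<subseteq> X"
    "(\<Sum>C\<in>M. p' C) - f' = \<sigma>' + h'" "d = (\<Sum>C\<in>M. \<integral>\<omega>. poly_value (p' C) \<omega> \<partial>e C)"
    using assms(2) by (rule dual_valuesE)
  show ?thesis
  proof (rule dual_valuesI[of "\<lambda>C. p C + p' C" "\<sigma> + \<sigma>'" "h + h'"])
    show "\<not> Poly_Mapping.keys \<alpha> \<subseteq> X" if "\<alpha> \<in> Poly_Mapping.keys (h + h')" for \<alpha>
      using that keys_add[of h h'] p(3) p'(3) by blast
    have "(\<Sum>C\<in>M. p C + p' C) - (f + f') = ((\<Sum>C\<in>M. p C) - f) + ((\<Sum>C\<in>M. p' C) - f')"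
      by (simp add: sum.distrib)
    also have "\<dots> = (\<sigma> + \<sigma>') + (h + h')" unfolding p(4) p'(4) by (simp add: algebra_simps)
    finally show "(\<Sum>C\<in>M. p C + p' C) - (f + f') = (\<sigma> + \<sigma>') + (h + h')" .
    show "c + d = (\<Sum>C\<in>M. \<integral>\<omega>. poly_value (p C + p' C) \<omega> \<partial>e C)"
      unfolding p(5) p'(5) sum.distrib[symmetric]
      using p(1) p'(1) by (intro sum.cong refl) (simp add: integrable_e sos_over)
  qed (use p p' in \<open>auto intro: sos_add\<close>)
qed

lemma dual_values_scale:
  assumes "c \<in> dual_values f" "0 \<le> t"
  shows "t * c \<in> dual_values (Poly_Mapping.single 0 t * f)"
proof -
  obtain p \<sigma> h where p: "\<forall>C\<in>M. p C \<in> sos C" "\<sigma> \<in> sos X"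
    "\<forall>\<alpha>\<in>Poly_Mapping.keys h. \<not> Poly_Mapping.keys \<alpha> \<subseteq> X"
    "(\<Sum>C\<in>M. p C) - f = \<sigma> + h" "c = (\<Sum>C\<in>M. \<integral>\<omega>. poly_value (p C) \<omega> \<partial>e C)"
    using assms(1) by (rule dual_valuesE)
  let ?t = "Poly_Mapping.single 0 t"
  show ?thesis
  proof (rule dual_valuesI[of "\<lambda>C. ?t * p C" "?t * \<sigma>" "?t * h"])
    show "\<not> Poly_Mapping.keys \<alpha> \<subseteq> X" if "\<alpha> \<in> Poly_Mapping.keys (?t * h)" for \<alpha>
      using that keys_mult[of ?t h] p(3) by (auto split: if_splits)
    have "(\<Sum>C\<in>M. ?t * p C) - ?t * f = ?t * ((\<Sum>C\<in>M. p C) - f)"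
      by (simp add: sum_distrib_left right_diff_distrib)
    then show "(\<Sum>C\<in>M. ?t * p C) - ?t * f = ?t * \<sigma> + ?t * h"
      unfolding p(4) by (simp add: algebra_simps)
    show "t * c = (\<Sum>C\<in>M. \<integral>\<omega>. poly_value (?t * p C) \<omega> \<partial>e C)"
      by (simp add: p(5) sum_distrib_left)
  qed (use p assms(2) in \<open>auto intro: sos_scale\<close>)
qed

text \<open>The certificate puts all of \<open>q\<close> into the context \<open>C\<close>. For a
  linear functional below the gauge this becomes domination by \<open>e C\<close> on squares in the
  variables of \<open>C\<close>.\<close>

lemma dual_values_sos:
  assumes "C \<in> M" "q \<in> sos C"
  shows "(\<integral>\<omega>. poly_value q \<omega> \<partial>e C) \<in> dual_values q"
proof -
  have *: "(\<Sum>D\<in>M. if D = C then q else 0) = q"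
    "(\<Sum>D\<in>M. \<integral>\<omega>. poly_value (if D = C then q else 0) \<omega> \<partial>e D) = (\<integral>\<omega>. poly_value q \<omega> \<partial>e C)"
    using assms(1) finite_M by (simp_all add: if_distrib[of "\<lambda>p. \<integral>\<omega>. poly_value p \<omega> \<partial>e _"] cong: if_cong)
  show ?thesis
    by (rule dual_valuesI[of "\<lambda>D. if D = C then q else 0" 0 0]) (use assms * in auto)
qed

text \<open>The surplus \<open>f' - f\<close> is absorbed into the sum of squares
  \<open>\<sigma>\<close>; the objective does not change.\<close>

lemma dual_values_mono:
  assumes "c \<in> dual_values f'" "f' - f \<in> sos X"
  shows "c \<in> dual_values f"
proof -
  obtain p \<sigma> h where p: "\<forall>C\<in>M. p C \<in> sos C" "\<sigma> \<in> sos X"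
    "\<forall>\<alpha>\<in>Poly_Mapping.keys h. \<not> Poly_Mapping.keys \<alpha> \<subseteq> X"
    "(\<Sum>C\<in>M. p C) - f' = \<sigma> + h" "c = (\<Sum>C\<in>M. \<integral>\<omega>. poly_value (p C) \<omega> \<partial>e C)"
    using assms(1) by (rule dual_valuesE)
  have "(\<Sum>C\<in>M. p C) - f = ((\<Sum>C\<in>M. p C) - f') + (f' - f)" by simp
  also have "\<dots> = (\<sigma> + (f' - f)) + h" unfolding p(4) by (simp add: algebra_simps)
  finally show ?thesis
    by (intro dual_valuesI[of p "\<sigma> + (f' - f)" h]) (use p assms(2) in \<open>auto intro: sos_add\<close>)
qed

text \<open>For a linear functional below the gauge this becomes nonnegativity on squares.\<close>

lemma zero_dual_value_of_neg_square: "q \<in> polys_over X \<Longrightarrow> 0 \<in> dual_values (- (q\<^sup>2))"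
  by (rule dual_valuesI[of "\<lambda>_. 0" "q\<^sup>2" 0]) (auto intro: sos_square)

text \<open>A product of even powers is bounded by repeated use of
  \<open>u * w \<le> (u\<^sup>2 + w\<^sup>2) / 2\<close>, which separates the variables.\<close>

lemma dual_values_even_monomial:
  "Poly_Mapping.keys \<alpha> \<subseteq> X \<Longrightarrow> dual_values (Poly_Mapping.single \<alpha> 1 ^ (2 * j)) \<noteq> {}"
proof (induction \<alpha> arbitrary: j rule: poly_mapping_single_plus_induct)
  case zero
  obtain C where "C \<in> M" using M_nonempty by blast
  then have "(\<integral>\<omega>. poly_value (1\<^sup>2) \<omega> \<partial>e C) \<in> dual_values (1\<^sup>2)"
    by (intro dual_values_sos sos_square) auto
  then show ?case by auto
next
  case (single i n)
  obtain C where C: "C \<in> M" "Poly_Mapping.keys (Poly_Mapping.single i n) \<subseteq> C"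
    using single context_covers[of i] M_nonempty by (cases "n = 0") auto
  have "(Poly_Mapping.single (Poly_Mapping.single i n) 1 ^ j)\<^sup>2 \<in> sos C"
    using C by (intro sos_square polys_over_power) auto
  from dual_values_sos[OF C(1) this] show ?case
    by (auto simp: power_mult[symmetric] mult.commute)
next
  case (plus \<beta> \<gamma>)
  let ?u = "Poly_Mapping.single \<beta> 1 ^ (2 * j) :: 'x rpoly" and ?w = "Poly_Mapping.single \<gamma> 1 ^ (2 * j) :: 'x rpoly"
    and ?h = "Poly_Mapping.single 0 (1 / 2) :: 'x rpoly"
  have keys: "Poly_Mapping.keys \<beta> \<subseteq> X" "Poly_Mapping.keys \<gamma> \<subseteq> X"
    using plus.prems by (auto simp: keys_add_nat)
  have over: "?u \<in> polys_over X" "?w \<in> polys_over X" using keys by (auto intro!: polys_over_power)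
  \<comment> \<open>Separating the two factors squares each of them, so the induction hypothesis is
    used for \<open>2 * j\<close>; this is why \<open>j\<close> is left arbitrary.\<close>
  obtain c d where "c \<in> dual_values (?u\<^sup>2)" "d \<in> dual_values (?w\<^sup>2)"
    using plus.IH(1)[OF keys(1), of "2 * j"] plus.IH(2)[OF keys(2), of "2 * j"]
    by (auto simp: power_mult[symmetric] mult_ac)
  then have *: "1 / 2 * (c + d) \<in> dual_values (?h * (?u\<^sup>2 + ?w\<^sup>2))"
    by (intro dual_values_scale dual_values_add) auto
  have two: "?h * 2 = 1"
    using mult_single[of 0 "1 / 2 :: real" "0 :: 'x multi_index" 2] by simp
  have "Poly_Mapping.single (\<beta> + \<gamma>) 1 ^ (2 * j) = ?u * ?w"
    by (simp add: mult_single flip: power_mult_distrib)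
  also have "\<dots> = (?h * 2) * (?u * ?w)" unfolding two by simp
  finally have "?h * (?u\<^sup>2 + ?w\<^sup>2) - Poly_Mapping.single (\<beta> + \<gamma>) 1 ^ (2 * j) = ?h * (?u - ?w)\<^sup>2"
    by (simp only:) (simp add: power2_eq_square algebra_simps)
  moreover have "?h * (?u - ?w)\<^sup>2 \<in> sos X" using over by (intro sos_scale sos_square) auto
  ultimately have "1 / 2 * (c + d) \<in> dual_values (Poly_Mapping.single (\<beta> + \<gamma>) 1 ^ (2 * j))"
    by (intro dual_values_mono[OF *]) (simp only:)
  then show ?case by blast
qed

text \<open>Makes the gauge finite on the whole space, as the Hahn-Banach theorem requires. A term
  of a polynomial over \<open>X\<close> is bounded by half the sum of the squares of its monomial
  and its coefficient; a monomial not supported on \<open>X\<close> is cancelled by \<open>h\<close>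
  at no cost.\<close>

lemma dual_values_nonempty: "dual_values f \<noteq> {}"
proof (induction f rule: poly_mapping_single_plus_induct)
  case zero
  show ?case using zero_dual_value_of_neg_square[of 0] by auto
next
  case (single \<alpha> c)
  show ?case
  proof (cases "Poly_Mapping.keys \<alpha> \<subseteq> X")
    case True
    let ?x = "Poly_Mapping.single \<alpha> 1 :: 'x rpoly" and ?c = "Poly_Mapping.single 0 c :: 'x rpoly"
      and ?h = "Poly_Mapping.single 0 (1 / 2) :: 'x rpoly"
    obtain C where C: "C \<in> M" using M_nonempty by blast
    obtain d where "d \<in> dual_values (?x\<^sup>2)" using dual_values_even_monomial[OF True, of 1] by auto
    then have *: "1 / 2 * (d + (\<integral>\<omega>. poly_value (?c\<^sup>2) \<omega> \<partial>e C)) \<in> dual_values (?h * (?x\<^sup>2 + ?c\<^sup>2))"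
      using C by (intro dual_values_scale dual_values_add dual_values_sos sos_square) auto
    have two: "?h * 2 = 1"
      using mult_single[of 0 "1 / 2 :: real" "0 :: 'x multi_index" 2] by simp
    have "Poly_Mapping.single \<alpha> c = ?x * ?c" by (simp add: mult_single)
    also have "\<dots> = (?h * 2) * (?x * ?c)" unfolding two by simp
    finally have "?h * (?x\<^sup>2 + ?c\<^sup>2) - Poly_Mapping.single \<alpha> c = ?h * (?x - ?c)\<^sup>2"
      by (simp only:) (simp add: power2_eq_square algebra_simps)
    moreover have "?h * (?x - ?c)\<^sup>2 \<in> sos X"
      using True by (intro sos_scale sos_square polys_over_minus) auto
    ultimately have "1 / 2 * (d + (\<integral>\<omega>. poly_value (?c\<^sup>2) \<omega> \<partial>e C)) \<in> dual_values (Poly_Mapping.single \<alpha> c)"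
      by (intro dual_values_mono[OF *]) (simp only:)
    then show ?thesis by blast
  next
    case False
    then have "0 \<in> dual_values (Poly_Mapping.single \<alpha> c)"
      by (intro dual_valuesI[of "\<lambda>_. 0" 0 "- Poly_Mapping.single \<alpha> c"]) (auto simp flip: single_uminus split: if_splits)
    then show ?thesis by blast
  qed
next
  case (plus f f')
  then show ?case using dual_values_add by blast
qed

text \<open>The perturbation function of the dual program. The real \<open>Inf\<close> is a true
  infimum, as the set is nonempty and bounded below by 0.\<close>

definition dual_gauge :: "'x rpoly \<Rightarrow> real" where
  "dual_gauge f = Inf (dual_values f)"

lemma dual_gauge_le: "c \<in> dual_values f \<Longrightarrow> dual_gauge f \<le> c"
  unfolding dual_gauge_def using dual_values_nonneg by (intro cInf_lower bdd_belowI[of _ 0])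

lemma dual_gauge_greatest: "(\<And>c. c \<in> dual_values f \<Longrightarrow> z \<le> c) \<Longrightarrow> z \<le> dual_gauge f"
  unfolding dual_gauge_def using dual_values_nonempty by (intro cInf_greatest)

lemma vector_space_rpoly: "vector_space (\<lambda>c (p :: 'x rpoly). Poly_Mapping.single 0 c * p)"
  by unfold_locales (auto simp: algebra_simps single_add mult_single simp flip: mult.assoc)

lemma sublinear_dual_gauge: "sublinear (\<lambda>c p. Poly_Mapping.single 0 c * p) dual_gauge"
  unfolding sublinear_def
proof (intro conjI allI impI)
  fix f f'
  have "dual_gauge (f + f') - d \<le> dual_gauge f" if "d \<in> dual_values f'" for d
    using dual_gauge_le[OF dual_values_add[OF _ that]] by (intro dual_gauge_greatest) (simp add: diff_le_eq)
  then have "dual_gauge (f + f') - dual_gauge f \<le> dual_gauge f'"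
    by (intro dual_gauge_greatest) (simp add: algebra_simps)
  then show "dual_gauge (f + f') \<le> dual_gauge f + dual_gauge f'" by simp
next
  fix c :: real and f assume "0 \<le> c"
  have le: "dual_gauge (Poly_Mapping.single 0 t * f) \<le> t * dual_gauge f" if "0 < t" for t f
  proof -
    have "dual_gauge (Poly_Mapping.single 0 t * f) / t \<le> dual_gauge f"
      using dual_gauge_le[OF dual_values_scale] that by (intro dual_gauge_greatest) (simp add: field_simps)
    with that show ?thesis by (simp add: field_simps)
  qed
  show "dual_gauge (Poly_Mapping.single 0 c * f) = c * dual_gauge f"
  proof (cases "c = 0")
    case True
    have "dual_gauge 0 = 0"
      using dual_gauge_le[OF zero_dual_value_of_neg_square[of 0]] dual_gauge_greatest[OF dual_values_nonneg, of 0]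
      by simp
    with True show ?thesis by simp
  next
    case False
    with \<open>0 \<le> c\<close> have "0 < c" by simp
    then have "dual_gauge (Poly_Mapping.single 0 (1 / c) * (Poly_Mapping.single 0 c * f))
        \<le> 1 / c * dual_gauge (Poly_Mapping.single 0 c * f)" by (intro le) auto
    also have "Poly_Mapping.single 0 (1 / c) * (Poly_Mapping.single 0 c * f) = f"
      using \<open>0 < c\<close> by (simp add: mult_single flip: mult.assoc)
    finally show ?thesis using le[OF \<open>0 < c\<close>, of f] \<open>0 < c\<close> by (simp add: field_simps)
  qed
qed

text \<open>Because \<open>L\<close> touches the gauge at \<open>1\<close>, its representing measure
  has mass \<open>dual_gauge 1\<close>, and this measure competes in the supremum that defines
  \<open>NCF\<close>.\<close>

lemma dual_gauge_one_le_NCF: "ereal (dual_gauge 1) \<le> enn2ereal (NCF X M (interval_outcomes a b) e)"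
proof -
  obtain L where L: "\<And>p q. L (p + q) = L p + L q" "\<And>c p. L (Poly_Mapping.single 0 c * p) = c * L p"
    "\<And>p. L p \<le> dual_gauge p" "L 1 = dual_gauge 1"
    using hahn_banach_sublinear[OF vector_space_rpoly sublinear_dual_gauge] by blast
  have L_le: "L (p\<^sup>2) \<le> (\<integral>\<omega>. poly_value (p\<^sup>2) \<omega> \<partial>e C)" if "C \<in> M" "p \<in> polys_over C" for C p
    using L(3)[of "p\<^sup>2"] dual_gauge_le[OF dual_values_sos[OF that(1) sos_square[OF that(2)]]] by linarith
  interpret box_functional X a b L
  proof
    fix p assume "p \<in> polys_over X"
    then have "L (- (p\<^sup>2)) \<le> 0"
      using L(3)[of "- (p\<^sup>2)"] dual_gauge_le[OF zero_dual_value_of_neg_square, of p] by linarith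
    moreover have "L (p\<^sup>2) + L (- (p\<^sup>2)) = 0"
      using L(1)[of "p\<^sup>2" "- (p\<^sup>2)"] L(2)[of 0 0] by simp
    ultimately show "0 \<le> L (p\<^sup>2)" by linarith
  next
    fix i u and r :: real
    assume i: "i \<in> X" and u: "u \<in> polys_over {i}" and "0 \<le> r"
      and bound: "\<And>\<omega>. \<omega> i \<in> {a i..b i} \<Longrightarrow> \<bar>poly_value u \<omega>\<bar> \<le> r"
    \<comment> \<open>The maximal contexts cover \<open>X\<close>, so each single variable is
      controlled by the probability measure of some context.\<close>
    obtain C where C: "C \<in> M" "i \<in> C" using context_covers[OF i] by blast
    interpret prob_space "e C" by (rule e_prob[OF C(1)])
    have uC: "u \<in> polys_over C" using u polys_over_mono[of "{i}" C] C by blast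
    have "L (u\<^sup>2) \<le> (\<integral>\<omega>. poly_value (u\<^sup>2) \<omega> \<partial>e C)" by (rule L_le[OF C(1) uC])
    also have "\<dots> \<le> (\<integral>\<omega>. r\<^sup>2 \<partial>e C)"
    proof (rule integral_mono)
      show "integrable (e C) (poly_value (u\<^sup>2))" using C uC by (intro integrable_e polys_over_power)
      fix \<omega> assume "\<omega> \<in> space (e C)"
      then have "\<omega> i \<in> {a i..b i}"
        using sets_eq_imp_space_eq[OF e_sets[OF C(1)]] C(2) by (auto simp: space_box PiE_iff)
      then have "\<bar>poly_value u \<omega>\<bar>\<^sup>2 \<le> r\<^sup>2" by (intro power_mono bound) auto
      then show "poly_value (u\<^sup>2) \<omega> \<le> r\<^sup>2" by simp
    qed simp
    also have "\<dots> = r\<^sup>2" by (simp add: prob_space)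
    finally show "L (u\<^sup>2) \<le> r\<^sup>2" .
  qed (use finite_X interval L in auto)
  obtain \<mu> where sets: "sets \<mu> = sets (box_space X)" and fin: "finite_measure \<mu>"
    and \<mu>: "\<And>p. p \<in> polys_over X \<Longrightarrow> (\<integral>\<omega>. poly_value p \<omega> \<partial>\<mu>) = L p"
    using representing_measure by blast
  interpret \<mu>: finite_measure \<mu> by (rule fin)
  have "emeasure (marginal (interval_outcomes a b) C \<mu>) A \<le> emeasure (e C) A"
    if C: "C \<in> M" and A: "A \<in> sets (box_space C)" for C A
  proof (rule measure_le_of_polynomial_squares[OF _ _ e_finite[OF C] e_sets[OF C] _ _ A])
    show "finite_measure (marginal (interval_outcomes a b) C \<mu>)"
      unfolding marginal_def by (intro \<mu>.finite_measure_distr measurable_projection C sets)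
    fix p assume p: "p \<in> polys_over C"
    then have "(\<integral>\<omega>. poly_value (p\<^sup>2) \<omega> \<partial>marginal (interval_outcomes a b) C \<mu>) = (\<integral>\<omega>. poly_value (p\<^sup>2) \<omega> \<partial>\<mu>)"
      by (intro integral_marginal C sets polys_over_power)
    also have "\<dots> = L (p\<^sup>2)"
      using p polys_over_mono[OF context_subset[OF C]] by (intro \<mu> polys_over_power) blast
    also have "\<dots> \<le> (\<integral>\<omega>. poly_value (p\<^sup>2) \<omega> \<partial>e C)" by (rule L_le[OF C p])
    finally show "(\<integral>\<omega>. poly_value (p\<^sup>2) \<omega> \<partial>marginal (interval_outcomes a b) C \<mu>)
        \<le> (\<integral>\<omega>. poly_value (p\<^sup>2) \<omega> \<partial>e C)" .
  qed (use context_subset[OF C] interval in \<open>auto simp: marginal_def\<close>)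
  with sets have "\<mu> \<in> subordinate_measures X M (interval_outcomes a b) e"
    by (simp add: subordinate_measures_def)
  then have "emeasure \<mu> (space (box_space X)) \<le> NCF X M (interval_outcomes a b) e"
    unfolding NCF_def by (rule SUP_upper)
  moreover have "emeasure \<mu> (space (box_space X)) = ennreal (dual_gauge 1)"
  proof -
    have "measure \<mu> (space \<mu>) = dual_gauge 1" using \<mu>[of 1] L(4) by simp
    then show ?thesis using sets_eq_imp_space_eq[OF sets] by (simp add: \<mu>.emeasure_eq_measure)
  qed
  ultimately have "enn2ereal (ennreal (dual_gauge 1)) \<le> enn2ereal (NCF X M (interval_outcomes a b) e)"
    by (simp add: less_eq_ennreal.rep_eq)
  moreover have "0 \<le> dual_gauge 1" by (rule dual_gauge_greatest[OF dual_values_nonneg])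
  ultimately show ?thesis by (simp add: enn2ereal_ennreal)
qed

text \<open>A given certificate involves finitely many polynomials, so it meets the degree bounds
  from some level on, with multipliers 0 for the constraint polynomials.\<close>

lemma dsdp_val_le_dual_value:
  assumes "c \<in> dual_values 1"
  shows "eventually (\<lambda>k. dsdp_val X M m g e k \<le> ereal c) sequentially"
proof -
  obtain p \<sigma> h where p: "\<forall>C\<in>M. p C \<in> sos C" "\<sigma> \<in> sos X"
    "\<forall>\<alpha>\<in>Poly_Mapping.keys h. \<not> Poly_Mapping.keys \<alpha> \<subseteq> X"
    "(\<Sum>C\<in>M. p C) - 1 = \<sigma> + h" "c = (\<Sum>C\<in>M. \<integral>\<omega>. poly_value (p C) \<omega> \<partial>e C)"
    using assms by (rule dual_valuesE)
  have "h = (\<Sum>C\<in>M. p C) - 1 - \<sigma>" using p(4) by simp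
  also have "\<dots> \<in> polys_over X"
    using p(1,2) sos_over polys_over_mono[OF context_subset]
    by (intro polys_over_minus polys_over_sum) (blast, auto)
  \<comment> \<open>All other terms of the identity are polynomials over \<open>X\<close>, while no
    monomial of \<open>h\<close> is supported on \<open>X\<close>.\<close>
  finally have "Poly_Mapping.keys h = {}" using p(3) by (auto simp: polys_over_def)
  then have "h = 0" by simp
  define K where "K = total_degree \<sigma> + (\<Sum>C\<in>M. total_degree (p C))"
  have "dsdp_val X M m g e k \<le> ereal c" if "K \<le> k" for k
  proof -
    define \<tau> where "\<tau> j = (if j = 0 then \<sigma> else 0)" for j :: nat
    have "total_degree (p C) \<le> 2 * k" if "C \<in> M" for C
      using member_le_sum[OF that, of "\<lambda>C. total_degree (p C)"] finite_M \<open>K \<le> k\<close> by (simp add: K_def)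
    moreover have "total_degree \<sigma> \<le> 2 * k" using \<open>K \<le> k\<close> by (simp add: K_def)
    moreover have "total_degree (0 :: 'x rpoly) \<le> n" for n by (simp add: total_degree_le_iff)
    ultimately have "(p, \<tau>) \<in> dsdp_feasible X M m g k"
      using p(1,2,4) \<open>h = 0\<close> by (simp add: dsdp_feasible_def sos_polys_eq \<tau>_def)
    then show ?thesis unfolding dsdp_val_def by (rule INF_lower2) (simp add: p(5))
  qed
  then show ?thesis by (auto simp: eventually_sequentially)
qed

lemma dsdp_val_less_eventually:
  assumes "enn2ereal (NCF X M (interval_outcomes a b) e) < z"
  shows "eventually (\<lambda>k. dsdp_val X M m g e k < z) sequentially"
proof -
  have "ereal (dual_gauge 1) < z" using dual_gauge_one_le_NCF assms by (rule le_less_trans)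
  then obtain r where r: "ereal (dual_gauge 1) < ereal r" "ereal r < z" using ereal_dense2 by blast
  \<comment> \<open>The infimum may fail to be attained, so a dual value slightly above it is
    chosen.\<close>
  obtain c where c: "c \<in> dual_values 1" "c < r"
    using r(1) dual_gauge_greatest[of 1 r] by (force simp: not_less)
  have "ereal c < z" using c(2) r(2) by (meson ereal_less_eq(3) less_imp_le order.strict_trans1)
  then show ?thesis
    by (intro eventually_mono[OF dsdp_val_le_dual_value[OF c(1)]]) (rule le_less_trans)
qed

end

theorem theorem5:
  fixes X :: "'x set"
    and M :: "'x set set"
    and a b :: "'x \<Rightarrow> real"
    and m :: nat
    and g :: "nat \<Rightarrow> 'x rpoly"
    and e :: "'x set \<Rightarrow> ('x \<Rightarrow> real) measure"
  assumes "finite X" and "X \<noteq> {}"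
    and "measurement_scenario X M"
    and "\<And>x. x \<in> X \<Longrightarrow> a x \<le> b x"
    and "\<And>j. j \<in> {1..m} \<Longrightarrow> g j \<in> polys_over X \<and> total_degree (g j) = 1"
    and "(\<Pi>\<^sub>E x\<in>X. {a x..b x}) =
           {\<omega> \<in> X \<rightarrow>\<^sub>E UNIV. \<forall>j\<in>{1..m}. poly_value (g j) \<omega> \<ge> 0}"
    and "empirical_model M (interval_outcomes a b) e"
  shows "decreasing_bounds_to (sdp_val X M m g e)
           (enn2ereal (NCF X M (interval_outcomes a b) e)) \<and>
         decreasing_bounds_to (dsdp_val X M m g e)
           (enn2ereal (NCF X M (interval_outcomes a b) e))"
proof -
  interpret box_scenario X M a b e using assms by unfold_locales auto
  let ?N = "enn2ereal (NCF X M (interval_outcomes a b) e)"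
  have g_nonneg: "0 \<le> poly_value (g j) \<omega>" if "\<omega> \<in> space (box_space X)" "j \<in> {1..m}" for \<omega> j
    using that assms(6) by (auto simp: space_box)
  have lower: "?N \<le> sdp_val X M m g e k" if "1 \<le> k" for k
    using that assms(5) g_nonneg by (intro NCF_le_sdp_val)
  then have lower': "?N \<le> dsdp_val X M m g e k" if "1 \<le> k" for k
    using that sdp_val_le_dsdp_val order_trans by blast
  have mono: "sdp_val X M m g e (Suc k) \<le> sdp_val X M m g e k" if "1 \<le> k" for k
    using that assms(5) by (rule sdp_val_antimono)
  have upper': "eventually (\<lambda>k. dsdp_val X M m g e k < z) sequentially" if "?N < z" for z
    using that by (rule dsdp_val_less_eventually)
  \<comment> \<open>The primal values are squeezed between \<open>NCF\<close> and the dual values,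
    so both limits follow from the bound on the dual side.\<close>
  have upper: "eventually (\<lambda>k. sdp_val X M m g e k < z) sequentially" if "?N < z" for z
    by (rule eventually_mono[OF upper'[OF that]]) (rule le_less_trans[OF sdp_val_le_dsdp_val])
  have lim: "v \<longlonglongrightarrow> ?N" if "\<And>k. 1 \<le> k \<Longrightarrow> ?N \<le> v k"
    "\<And>z. ?N < z \<Longrightarrow> eventually (\<lambda>k. v k < z) sequentially" for v
  proof (rule order_tendstoI)
    fix z assume "z < ?N"
    with that(1) show "eventually (\<lambda>k. z < v k) sequentially"
      unfolding eventually_sequentially by (meson less_le_trans)
  qed (rule that(2))
  have "sdp_val X M m g e \<longlonglongrightarrow> ?N"
    using lower upper by (rule lim)
  moreover have "dsdp_val X M m g e \<longlonglongrightarrow> ?N"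
    using lower' upper' by (rule lim)
  ultimately show ?thesis
    unfolding decreasing_bounds_to_def
    using lower lower' mono dsdp_val_antimono by (intro conjI allI impI)
qed

end
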